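(* Let $\mathtt v\in V^*$ satisfy: (i) $G_{\mathtt v}$ is the maximum element, with respect to inclusion, of the set $\{G_{\mathtt w}:\mathtt w\in\gimel\cdot\mathtt v\}$; (ii) every orbit of $G_{\mathtt v}$ in each $I^{(i)}$ has the form $\{(i,p),(i,p+1),\dots,(i,p+q)\}$ for some $p,q$. Further, assume that for any $i=1,2,\dots,k-1$ and any $\mathbf a\in I^{(i)}$ and $\mathbf b\in I^{(i+1)}$ we have $\mathtt v(x_{\mathbf a})-\mathtt v(x_{\mathbf b})\notin\mathbb Z$. Then the right $U_\lambda$-module $M_{\mathtt v}$ is simple. Consequently, $M_{\mathtt v}\cong L_{\mathtt v}$ in this case.
   Context: Let $k\ge 1$ and let $\lambda=(\lambda_1,\dots,\lambda_k)$ be positive integers. Let $I$ be the set of pairs $(i,j)$ with $1\le i\le k$, $1\le j\le \lambda_i$; $I^{(i)}=\{(i,j):1\le j\le\lambda_i\}$, and $I^{(0)}=\emptyset$ (a product over the empty set is $1$). Let $\Omega=\mathbb{C}(x_{\mathbf a}:\mathbf a\in I)$ and $R=\mathbb{C}[x_{\mathbf a}:\mathbf a\in I]\subset\Omega$. For $\mathbf a\in I$, $\varphi_{\mathbf a}$ is the $\mathbb{C}$-automorphism of the field $\Omega$ with $\varphi_{\mathbf a}(x_{\mathbf b})=x_{\mathbf b}+\delta_{\mathbf a,\mathbf b}$; $\gimel$ is the abelian group generated by the $\varphi_{(i,j)}$ with $i<k$. For $i=1,\dots,k-1$ define operators on $\Omega$ $$E_i=\sum_{j=1}^{\lambda_i}\frac{\prod_{\mathbf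 a\in I^{(i+1)}}(x_{(i,j)}-x_{\mathbf a})}{\prod_{\mathbf b\in I^{(i)}\setminus\{(i,j)\}}(x_{(i,j)}-x_{\mathbf b})}\varphi_{(i,j)},\qquad F_i=\sum_{j=1}^{\lambda_i}\frac{\prod_{\mathbf a\in I^{(i-1)}}(x_{(i,j)}-x_{\mathbf a})}{\prod_{\mathbf b\in I^{(i)}\setminus\{(i,j)\}}(x_{(i,j)}-x_{\mathbf b})}\varphi_{(i,j)}^{-1}.$$ For $\mathbf a=(i,j)\in I$, $\gamma_{\mathbf a}$ is multiplication by the $j$-th elementary symmetric polynomial in $\{x_{\mathbf b}:\mathbf b\in I^{(i)}\}$. The orthogonal Gelfand-Zeitlin algebra $U_\lambda$ is the algebra of $\mathbb{C}$-linear transformations of $\Omega$ generated by all $E_i,F_i$ ($1\le i\le k-1$) and $\gamma_{\mathbf a}$ ($\mathbf a\in I$). The group $G=S_{\lambda_1}\times\dots\times S_{\lambda_k}$ acts on $\Omega$ and $R$, with $S_{\lambda_i}$ permuting $x_{(i,1)},\dots,x_{(i,\lambda_i)}$; $\underline G=S_{\lambda_1}\times\dots\times S_{\lambda_{k-1}}\subset G$; $\mathbf{R}:=R^G$. The subspace $\mathbf R\subset\Omega$ is stable under $U_\lambda$, so $\mathbf{R}^*=\mathrm{Hom}_{\mathbb C}(\mathbf R,\mathbb C)$ is a right $U_\lambda$-module via $(\ell\cdot u)(f)=\ell(u\cdot f)$. $V$ is the $\mathbb{C}$-span of all $x_{\mathbf a}$, with dual $V^*$, on which $G$ acts by the dual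 action. For $\mathtt v\in V^*$, $\mathrm{ev}_{\mathtt v}:R\to\mathbb C$ is the $\mathbb{C}$-algebra homomorphism $x_{\mathbf a}\mapsto\mathtt v(x_{\mathbf a})$, $\mathbf{ev}_{\mathtt v}\in\mathbf R^*$ is its restriction to $\mathbf R$, and $G_{\mathtt v}$ is the stabilizer of $\mathtt v$ in $\underline G$. $\gimel$ acts on $V^*$ by integer shifts: $\mathrm{ev}_{\xi^{-1}(\mathtt v)}=\mathrm{ev}_{\mathtt v}\circ\xi$ for $\xi\in\gimel$; so $\gimel\cdot\mathtt v$ consists of all $\mathtt w$ with $(\mathtt w-\mathtt v)(x_{(i,j)})\in\mathbb Z$ for $i<k$ and $(\mathtt w-\mathtt v)(x_{(k,j)})=0$. Canonical simple module: $N_{\mathtt v}:=\mathbf{ev}_{\mathtt v}\cdot U_\lambda\subset\mathbf R^*$ is the submodule generated by $\mathbf{ev}_{\mathtt v}$; it has a unique maximal (proper) submodule, and $L_{\mathtt v}$ denotes the quotient of $N_{\mathtt v}$ by it. Divided differences: $G$ is a Coxeter group with simple reflections $s=((i,p),(i,p+1))$ (transpositions of neighbours); $\partial_s=\frac{\mathrm{id}-s}{x_{(i,p)}-x_{(i,p+1)}}$, and $\partial_w=\partial_{s_1}\cdots\partial_{s_l}$ for a reduced expression $w=s_1\cdots s_l$ (independent of the reduced expression). Module $M_{\mathtt v}$: for $\mathtt v$ satisfying (i) and (ii) of the claim, $\gimel\cdot\mathtt v$ is $G_{\mathtt v}$-invariant and decomposes into $G_{\mathtt v}$-orbits $\gimel\cdot\mathtt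 v=\coprod_{j\in J}\mathcal O_j$. For $j\in J$, $\mathtt u_j$ is the unique representative of $\mathcal O_j$ such that, whenever $(i,p)$ and $(i,p+1)$ lie in the same $G_{\mathtt v}$-orbit, $(\mathtt u_j-\mathtt v)(x_{(i,p)})\ge(\mathtt u_j-\mathtt v)(x_{(i,p+1)})$ (both integers). $\xi_j\in\gimel$ is defined by $\mathtt u_j=\xi_j^{-1}(\mathtt v)$, i.e. $\mathrm{ev}_{\mathtt v}\circ\xi_j=\mathrm{ev}_{\mathtt u_j}$ on $R$. $M_{\mathtt v}\subset\mathbf R^*$ is the linear span of all $\mathrm{ev}_{\mathtt v}\circ\partial_w\circ\xi_j$ (restricted to $\mathbf R$), $j\in J$, $w\in G_{\mathtt v}$; it is a $U_\lambda$-submodule of $\mathbf R^*$. *)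

theory Defs
  imports
    Complex_Main
    "HOL-Library.Poly_Mapping"
    "HOL-Library.Product_Lexorder"
    "HOL-Library.Function_Algebras"
    "HOL-Computational_Algebra.Fraction_Field"
    "HOL-Combinatorics.Permutations"
begin

section \<open>Polynomials and rational functions\<close>

text \<open>
  Polynomials are finitely supported maps from exponent vectors to coefficients. The types below
  have a variable for every pair of natural numbers; the subsets \<open>polys\<close>, \<open>R\<close>, \<open>Omega\<close> only involve
  the variables indexed by \<open>I\<close>. The lexicographic order on pairs is used solely to make the polynomial
  type an integral domain.
\<close>

type_synonym idx = "nat \<times> nat"
type_synonym mpoly = "(idx \<Rightarrow>\<^sub>0 nat) \<Rightarrow>\<^sub>0 complex"
type_synonym mrat = "mpoly fract"

definition const :: "complex \<Rightarrow> mrat" where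
  "const c = Fract (Poly_Mapping.single 0 c) 1"

definition X :: "idx \<Rightarrow> mrat" where
  "X a = Fract (Poly_Mapping.single (Poly_Mapping.single a 1) 1) 1"

text \<open>Value of a polynomial when coefficients are mapped by \<open>\<iota>\<close> and the variable \<open>a\<close> to \<open>\<sigma> a\<close>.\<close>

definition mpoly_eval :: "(complex \<Rightarrow> 'r::comm_ring_1) \<Rightarrow> (idx \<Rightarrow> 'r) \<Rightarrow> mpoly \<Rightarrow> 'r" where
  "mpoly_eval \<iota> \<sigma> p =
     (\<Sum>m\<in>Poly_Mapping.keys p. \<iota> (Poly_Mapping.lookup p m) *
        (\<Prod>a\<in>Poly_Mapping.keys m. \<sigma> a ^ Poly_Mapping.lookup m a))"

text \<open>
  The field endomorphism over the complex numbers sending \<open>X a\<close> to \<open>\<sigma> a\<close>. It is meaningful when the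
  \<open>\<sigma> a\<close> are algebraically independent, and is only used for shifts and permutations of variables.
\<close>

definition subst_rat :: "(idx \<Rightarrow> mrat) \<Rightarrow> mrat \<Rightarrow> mrat" where
  "subst_rat \<sigma> f =
     (THE g. \<exists>p q. q \<noteq> 0 \<and> f = Fract p q \<and> g = mpoly_eval const \<sigma> p / mpoly_eval const \<sigma> q)"

text \<open>
  A map on a subset \<open>A\<close> is represented by a function that is zero outside \<open>A\<close>. For linear maps this is
  compatible with composition, pointwise addition and scaling.
\<close>

definition on_set :: "'a set \<Rightarrow> ('a \<Rightarrow> 'b::zero) \<Rightarrow> 'a \<Rightarrow> 'b" where
  "on_set A f = (\<lambda>x. if x \<in> A then f x else 0)"


section \<open>Index sets, groups and rings attached to \<open>\<lambda>\<close>\<close>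

text \<open>The list \<open>lam\<close> is zero-based, so \<open>\<lambda>\<^sub>i\<close> is \<open>lam ! (i - 1)\<close>; in particular \<open>row lam 0 = {}\<close>.\<close>

definition I :: "nat list \<Rightarrow> idx set" where
  "I lam = {(i, j). 1 \<le> i \<and> i \<le> length lam \<and> 1 \<le> j \<and> j \<le> lam ! (i - 1)}"

definition row :: "nat list \<Rightarrow> nat \<Rightarrow> idx set" where
  "row lam i = {a \<in> I lam. fst a = i}"

definition polys :: "nat list \<Rightarrow> mpoly set" where
  "polys lam = {p. \<forall>m\<in>Poly_Mapping.keys p. Poly_Mapping.keys m \<subseteq> I lam}"

definition R :: "nat list \<Rightarrow> mrat set" where
  "R lam = {Fract p 1 | p. p \<in> polys lam}"

definition Omega :: "nat list \<Rightarrow> mrat set" where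
  "Omega lam = {Fract p q | p q. p \<in> polys lam \<and> q \<in> polys lam \<and> q \<noteq> 0}"

text \<open>\<open>S\<^bsub>\<lambda>\<^sub>1\<^esub> \<times> \<dots> \<times> S\<^bsub>\<lambda>\<^sub>k\<^esub>\<close>, as the row-preserving permutations of the index set.\<close>

definition G :: "nat list \<Rightarrow> (idx \<Rightarrow> idx) set" where
  "G lam = {g. g permutes I lam \<and> (\<forall>a\<in>I lam. fst (g a) = fst a)}"

definition Gbar :: "nat list \<Rightarrow> (idx \<Rightarrow> idx) set" where
  "Gbar lam = {g \<in> G lam. \<forall>a\<in>row lam (length lam). g a = a}"

definition perm_act :: "(idx \<Rightarrow> idx) \<Rightarrow> mrat \<Rightarrow> mrat" where
  "perm_act g = subst_rat (\<lambda>a. X (g a))"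

definition RG :: "nat list \<Rightarrow> mrat set" where
  "RG lam = {f \<in> R lam. \<forall>g\<in>G lam. perm_act g f = f}"

definition phi :: "nat list \<Rightarrow> idx \<Rightarrow> mrat \<Rightarrow> mrat" where
  "phi lam a = on_set (Omega lam) (subst_rat (\<lambda>b. X b + (if b = a then 1 else 0)))"

definition phi_inv :: "nat list \<Rightarrow> idx \<Rightarrow> mrat \<Rightarrow> mrat" where
  "phi_inv lam a = on_set (Omega lam) (inv_into (Omega lam) (phi lam a))"

inductive_set gimel :: "nat list \<Rightarrow> (mrat \<Rightarrow> mrat) set" for lam :: "nat list" where
  gimel_id: "on_set (Omega lam) id \<in> gimel lam"
| gimel_phi: "\<lbrakk>(i, j) \<in> I lam; i < length lam; \<xi> \<in> gimel lam\<rbrakk> \<Longrightarrow> phi lam (i, j) \<circ> \<xi> \<in> gimel lam"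
| gimel_phi_inv:
    "\<lbrakk>(i, j) \<in> I lam; i < length lam; \<xi> \<in> gimel lam\<rbrakk> \<Longrightarrow> phi_inv lam (i, j) \<circ> \<xi> \<in> gimel lam"


section \<open>The orthogonal Gelfand-Zeitlin algebra\<close>

definition E_op :: "nat list \<Rightarrow> nat \<Rightarrow> mrat \<Rightarrow> mrat" where
  "E_op lam i = on_set (Omega lam) (\<lambda>f. \<Sum>c\<in>row lam i.
     (\<Prod>a\<in>row lam (i + 1). X c - X a) / (\<Prod>b\<in>row lam i - {c}. X c - X b) * phi lam c f)"

definition F_op :: "nat list \<Rightarrow> nat \<Rightarrow> mrat \<Rightarrow> mrat" where
  "F_op lam i = on_set (Omega lam) (\<lambda>f. \<Sum>c\<in>row lam i.
     (\<Prod>a\<in>row lam (i - 1). X c - X a) / (\<Prod>b\<in>row lam i - {c}. X c - X b) * phi_inv lam c f)"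

definition elem_sym :: "nat \<Rightarrow> idx set \<Rightarrow> mrat" where
  "elem_sym j A = (\<Sum>S | S \<subseteq> A \<and> card S = j. \<Prod>b\<in>S. X b)"

definition gamma_op :: "nat list \<Rightarrow> idx \<Rightarrow> mrat \<Rightarrow> mrat" where
  "gamma_op lam a = on_set (Omega lam) (\<lambda>f. elem_sym (snd a) (row lam (fst a)) * f)"

inductive_set U :: "nat list \<Rightarrow> (mrat \<Rightarrow> mrat) set" for lam :: "nat list" where
  U_one: "on_set (Omega lam) id \<in> U lam"
| U_E: "\<lbrakk>1 \<le> i; i < length lam\<rbrakk> \<Longrightarrow> E_op lam i \<in> U lam"
| U_F: "\<lbrakk>1 \<le> i; i < length lam\<rbrakk> \<Longrightarrow> F_op lam i \<in> U lam"
| U_gamma: "a \<in> I lam \<Longrightarrow> gamma_op lam a \<in> U lam"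
| U_add: "\<lbrakk>u \<in> U lam; u' \<in> U lam\<rbrakk> \<Longrightarrow> (\<lambda>f. u f + u' f) \<in> U lam"
| U_scale: "u \<in> U lam \<Longrightarrow> (\<lambda>f. const c * u f) \<in> U lam"
| U_mult: "\<lbrakk>u \<in> U lam; u' \<in> U lam\<rbrakk> \<Longrightarrow> u \<circ> u' \<in> U lam"


section \<open>Right modules over the algebra\<close>

record 'm rmod =
  mcar :: "'m set"
  mzero :: 'm
  madd :: "'m \<Rightarrow> 'm \<Rightarrow> 'm"
  mscale :: "complex \<Rightarrow> 'm \<Rightarrow> 'm"
  mact :: "'m \<Rightarrow> (mrat \<Rightarrow> mrat) \<Rightarrow> 'm"

definition right_module :: "nat list \<Rightarrow> 'm rmod \<Rightarrow> bool" where
  "right_module lam M \<longleftrightarrow>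
     mzero M \<in> mcar M \<and>
     (\<forall>x\<in>mcar M. \<forall>y\<in>mcar M. madd M x y \<in> mcar M) \<and>
     (\<forall>x\<in>mcar M. \<forall>y\<in>mcar M. \<forall>z\<in>mcar M. madd M (madd M x y) z = madd M x (madd M y z)) \<and>
     (\<forall>x\<in>mcar M. \<forall>y\<in>mcar M. madd M x y = madd M y x) \<and>
     (\<forall>x\<in>mcar M. madd M (mzero M) x = x) \<and>
     (\<forall>x\<in>mcar M. \<exists>y\<in>mcar M. madd M x y = mzero M) \<and>
     (\<forall>c. \<forall>x\<in>mcar M. mscale M c x \<in> mcar M) \<and>
     (\<forall>c. \<forall>x\<in>mcar M. \<forall>y\<in>mcar M. mscale M c (madd M x y) = madd M (mscale M c x) (mscale M c y)) \<and>
     (\<forall>c d. \<forall>x\<in>mcar M. mscale M (c + d) x = madd M (mscale M c x) (mscale M d x)) \<and>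
     (\<forall>c d. \<forall>x\<in>mcar M. mscale M (c * d) x = mscale M c (mscale M d x)) \<and>
     (\<forall>x\<in>mcar M. mscale M 1 x = x) \<and>
     (\<forall>x\<in>mcar M. \<forall>u\<in>U lam. mact M x u \<in> mcar M) \<and>
     (\<forall>x\<in>mcar M. \<forall>y\<in>mcar M. \<forall>u\<in>U lam. mact M (madd M x y) u = madd M (mact M x u) (mact M y u)) \<and>
     (\<forall>c. \<forall>x\<in>mcar M. \<forall>u\<in>U lam. mact M (mscale M c x) u = mscale M c (mact M x u)) \<and>
     (\<forall>x\<in>mcar M. \<forall>u\<in>U lam. \<forall>u'\<in>U lam.
        mact M x (\<lambda>f. u f + u' f) = madd M (mact M x u) (mact M x u')) \<and>
     (\<forall>c. \<forall>x\<in>mcar M. \<forall>u\<in>U lam. mact M x (\<lambda>f. const c * u f) = mscale M c (mact M x u)) \<and>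
     (\<forall>x\<in>mcar M. \<forall>u\<in>U lam. \<forall>u'\<in>U lam. mact M x (u \<circ> u') = mact M (mact M x u) u') \<and>
     (\<forall>x\<in>mcar M. mact M x (on_set (Omega lam) id) = x)"

definition submodule :: "nat list \<Rightarrow> 'm rmod \<Rightarrow> 'm set \<Rightarrow> bool" where
  "submodule lam M S \<longleftrightarrow>
     S \<subseteq> mcar M \<and> mzero M \<in> S \<and>
     (\<forall>x\<in>S. \<forall>y\<in>S. madd M x y \<in> S) \<and>
     (\<forall>c. \<forall>x\<in>S. mscale M c x \<in> S) \<and>
     (\<forall>x\<in>S. \<forall>u\<in>U lam. mact M x u \<in> S)"

definition simple_module :: "nat list \<Rightarrow> 'm rmod \<Rightarrow> bool" where
  "simple_module lam M \<longleftrightarrow>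
     right_module lam M \<and> mcar M \<noteq> {mzero M} \<and>
     (\<forall>S. submodule lam M S \<longrightarrow> S = {mzero M} \<or> S = mcar M)"

definition maximal_submodule :: "nat list \<Rightarrow> 'm rmod \<Rightarrow> 'm set \<Rightarrow> bool" where
  "maximal_submodule lam M K \<longleftrightarrow>
     submodule lam M K \<and> K \<noteq> mcar M \<and>
     (\<forall>S. submodule lam M S \<and> K \<subseteq> S \<longrightarrow> S = K \<or> S = mcar M)"

definition coset :: "'m rmod \<Rightarrow> 'm set \<Rightarrow> 'm \<Rightarrow> 'm set" where
  "coset M K x = {madd M x y | y. y \<in> K}"

definition quot_module :: "'m rmod \<Rightarrow> 'm set \<Rightarrow> 'm set rmod" where
  "quot_module M K =
     \<lparr> mcar = coset M K ` mcar M,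
       mzero = K,
       madd = (\<lambda>A B. \<Union>x\<in>A. \<Union>y\<in>B. coset M K (madd M x y)),
       mscale = (\<lambda>c A. \<Union>x\<in>A. coset M K (mscale M c x)),
       mact = (\<lambda>A u. \<Union>x\<in>A. coset M K (mact M x u)) \<rparr>"

definition module_iso :: "nat list \<Rightarrow> 'm rmod \<Rightarrow> 'n rmod \<Rightarrow> bool" where
  "module_iso lam M N \<longleftrightarrow>
     (\<exists>h. bij_betw h (mcar M) (mcar N) \<and>
        (\<forall>x\<in>mcar M. \<forall>y\<in>mcar M. h (madd M x y) = madd N (h x) (h y)) \<and>
        (\<forall>c. \<forall>x\<in>mcar M. h (mscale M c x) = mscale N c (h x)) \<and>
        (\<forall>x\<in>mcar M. \<forall>u\<in>U lam. h (mact M x u) = mact N (h x) u))"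

definition dual_scale :: "complex \<Rightarrow> (mrat \<Rightarrow> complex) \<Rightarrow> mrat \<Rightarrow> complex" where
  "dual_scale c l = (\<lambda>f. c * l f)"

definition RG_dual :: "nat list \<Rightarrow> (mrat \<Rightarrow> complex) rmod" where
  "RG_dual lam =
     \<lparr> mcar = {l. (\<forall>f. f \<notin> RG lam \<longrightarrow> l f = 0) \<and>
                 (\<forall>f\<in>RG lam. \<forall>g\<in>RG lam. l (f + g) = l f + l g) \<and>
                 (\<forall>c. \<forall>f\<in>RG lam. l (const c * f) = c * l f)},
       mzero = (\<lambda>f. 0),
       madd = (\<lambda>l l' f. l f + l' f),
       mscale = dual_scale,
       mact = (\<lambda>l u. on_set (RG lam) (\<lambda>f. l (u f))) \<rparr>"


section \<open>Characters and the canonical simple module\<close>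

text \<open>
  \<open>V\<close> has the basis \<open>x\<^sub>a\<close> for \<open>a\<close> in \<open>I\<close>, so a linear form \<open>v\<close> on it is given by the values \<open>v(x\<^sub>a)\<close>,
  written \<open>v a\<close>.
\<close>

definition V_dual :: "nat list \<Rightarrow> (idx \<Rightarrow> complex) set" where
  "V_dual lam = {v. \<forall>a. a \<notin> I lam \<longrightarrow> v a = 0}"

text \<open>The dual action: \<open>(g \<cdot> v)(x\<^sub>a) = v(g\<inverse> \<cdot> x\<^sub>a)\<close>.\<close>

definition dual_act :: "(idx \<Rightarrow> idx) \<Rightarrow> (idx \<Rightarrow> complex) \<Rightarrow> idx \<Rightarrow> complex" where
  "dual_act g v = (\<lambda>a. v (inv g a))"

definition stab :: "nat list \<Rightarrow> (idx \<Rightarrow> complex) \<Rightarrow> (idx \<Rightarrow> idx) set" where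
  "stab lam v = {g \<in> Gbar lam. dual_act g v = v}"

text \<open>Evaluation at \<open>v\<close>; only meaningful on polynomials.\<close>

definition ev :: "(idx \<Rightarrow> complex) \<Rightarrow> mrat \<Rightarrow> complex" where
  "ev v f = (THE c. \<exists>p. f = Fract p 1 \<and> c = mpoly_eval id v p)"

definition N_mod :: "nat list \<Rightarrow> (idx \<Rightarrow> complex) \<Rightarrow> (mrat \<Rightarrow> complex) rmod" where
  "N_mod lam v =
     (RG_dual lam)\<lparr>mcar := {mact (RG_dual lam) (on_set (RG lam) (ev v)) u | u. u \<in> U lam}\<rparr>"

definition L_mod :: "nat list \<Rightarrow> (idx \<Rightarrow> complex) \<Rightarrow> (mrat \<Rightarrow> complex) set rmod" where
  "L_mod lam v = quot_module (N_mod lam v) (THE K. maximal_submodule lam (N_mod lam v) K)"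


section \<open>Divided differences\<close>

text \<open>The pair \<open>(i, p)\<close> encodes the simple reflection exchanging \<open>(i, p)\<close> and \<open>(i, p + 1)\<close>.\<close>

definition next_idx :: "idx \<Rightarrow> idx" where
  "next_idx a = (fst a, snd a + 1)"

definition simple_idx :: "nat list \<Rightarrow> idx set" where
  "simple_idx lam = {a. a \<in> I lam \<and> next_idx a \<in> I lam}"

definition simple_refl :: "idx \<Rightarrow> idx \<Rightarrow> idx" where
  "simple_refl a = Transposition.transpose a (next_idx a)"

definition word_perm :: "idx list \<Rightarrow> idx \<Rightarrow> idx" where
  "word_perm as = foldr (\<lambda>a g. simple_refl a \<circ> g) as id"

definition reduced_word :: "nat list \<Rightarrow> (idx \<Rightarrow> idx) \<Rightarrow> idx list \<Rightarrow> bool" where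
  "reduced_word lam w as \<longleftrightarrow>
     set as \<subseteq> simple_idx lam \<and> word_perm as = w \<and>
     (\<forall>bs. set bs \<subseteq> simple_idx lam \<and> word_perm bs = w \<longrightarrow> length as \<le> length bs)"

definition div_diff_simple :: "idx \<Rightarrow> mrat \<Rightarrow> mrat" where
  "div_diff_simple a f = (f - perm_act (simple_refl a) f) / (X a - X (next_idx a))"

text \<open>The result does not depend on the reduced word chosen.\<close>

definition div_diff :: "nat list \<Rightarrow> (idx \<Rightarrow> idx) \<Rightarrow> mrat \<Rightarrow> mrat" where
  "div_diff lam w = foldr (\<lambda>a h. div_diff_simple a \<circ> h) (SOME as. reduced_word lam w as) id"


section \<open>The module \<open>M\<^sub>v\<close>\<close>

text \<open>The orbit of \<open>v\<close> under the shift group, which acts by \<open>ev (\<xi>\<inverse> v) = ev v \<circ> \<xi>\<close>.\<close>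

definition gimel_orbit :: "nat list \<Rightarrow> (idx \<Rightarrow> complex) \<Rightarrow> (idx \<Rightarrow> complex) set" where
  "gimel_orbit lam v = {w \<in> V_dual lam. \<exists>\<xi>\<in>gimel lam. \<forall>f\<in>R lam. ev w f = ev v (\<xi> f)}"

definition idx_orbit :: "(idx \<Rightarrow> idx) set \<Rightarrow> idx \<Rightarrow> idx set" where
  "idx_orbit H a = (\<lambda>g. g a) ` H"

definition stab_orbits :: "nat list \<Rightarrow> (idx \<Rightarrow> complex) \<Rightarrow> (idx \<Rightarrow> complex) set set" where
  "stab_orbits lam v = {(\<lambda>g. dual_act g w) ` stab lam v | w. w \<in> gimel_orbit lam v}"

text \<open>Both differences compared below are integers when \<open>u\<close> lies in \<open>gimel_orbit lam v\<close>.\<close>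

definition dominant_rel :: "nat list \<Rightarrow> (idx \<Rightarrow> complex) \<Rightarrow> (idx \<Rightarrow> complex) \<Rightarrow> bool" where
  "dominant_rel lam v u \<longleftrightarrow>
     (\<forall>a\<in>simple_idx lam. next_idx a \<in> idx_orbit (stab lam v) a \<longrightarrow>
        Re (u a - v a) \<ge> Re (u (next_idx a) - v (next_idx a)))"

definition orbit_rep :: "nat list \<Rightarrow> (idx \<Rightarrow> complex) \<Rightarrow> (idx \<Rightarrow> complex) set \<Rightarrow> idx \<Rightarrow> complex" where
  "orbit_rep lam v O' = (THE u. u \<in> O' \<and> dominant_rel lam v u)"

definition orbit_shift :: "nat list \<Rightarrow> (idx \<Rightarrow> complex) \<Rightarrow> (idx \<Rightarrow> complex) set \<Rightarrow> mrat \<Rightarrow> mrat" where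
  "orbit_shift lam v O' =
     (THE \<xi>. \<xi> \<in> gimel lam \<and> (\<forall>f\<in>R lam. ev v (\<xi> f) = ev (orbit_rep lam v O') f))"

definition M_mod :: "nat list \<Rightarrow> (idx \<Rightarrow> complex) \<Rightarrow> (mrat \<Rightarrow> complex) rmod" where
  "M_mod lam v =
     (RG_dual lam)\<lparr>mcar := module.span dual_scale
        {on_set (RG lam) (ev v \<circ> div_diff lam w \<circ> orbit_shift lam v O') | O' w.
           O' \<in> stab_orbits lam v \<and> w \<in> stab lam v}\<rparr>"

end

theory Submission
  imports Defs
begin

text \<open>
  Let \<open>H\<close> be the stabilizer of \<open>v\<close>. By the maximality of \<open>H\<close>, two entries of a row other than the last can
  be made equal by integer shifts only if they lie in one \<open>H\<close>-orbit, a block, and by the interval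
  condition \<open>H\<close> is generated by simple reflections. Functionals are described at \<open>v\<close> itself: they are the
  combinations of \<open>ev v \<circ> dd as\<close> with words \<open>as\<close> in these reflections (\<open>local_fun\<close>), transported to the shifted
  points by \<open>twist d\<close>. Divided differences depend only on the permutation of a reduced word and vanish for
  the other words (\<open>dd_reduced_unique\<close>, \<open>dd_nonreduced\<close>), so the module of the theorem is the sum of the
  pieces \<open>twist d ` local_fun maxlen\<close> over the dominant shifts \<open>d\<close> (\<open>carrier_M\<close>).

  Two facts describe the action. First, multiplication by every symmetric polynomial belongs to the
  algebra (\<open>mulop_RG\<close>); such polynomials separate the pieces, and at a regular shift, where the
  coordinates in each row but the last are distinct, they realize all jets. Secondly, a generator moves one coordinate
  of the shifted point up or down (\<open>gz_op_expansion\<close>): the terms of its sum that belong to a group of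
  equal coordinates combine to a divided difference (\<open>symmetrized_fraction_eq_dd\<close>), preceded by
  multiplication with a rational function. Its numerator does not vanish at \<open>v\<close>, because no entry differs
  by an integer from an entry of a neighbouring row, and its denominator does not vanish because
  entries of different groups stay apart. So this multiplication is invertible on functionals.

  Now let a nonzero submodule be given. It contains the evaluation at some dominant shift
  (\<open>extract_component\<close>, \<open>socle\<close>), and raising coordinates one at a time it contains the evaluation at a
  regular one (\<open>ev_climb\<close>). Its parts at all regular shifts agree (\<open>regular_piece_eq\<close>). Letting two
  neighbouring coordinates meet and separate again applies the divided difference of the reflection that
  exchanges them (\<open>regular_D\<close>); so the part at a regular shift contains all \<open>ev v \<circ> dd as\<close>. Any other dominant
  shift is reached from a regular one by lowering coordinates that are alone in their group, which loses
  nothing (\<open>descend\<close>). Hence the submodule is everything. The submodule generated by \<open>ev v\<close> is then the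
  whole module too, and its simple quotient is the module itself.
\<close>


section \<open>Substitution homomorphisms on rational functions\<close>

lemma poly_mapping_sum_singles:
  fixes p :: "'a \<Rightarrow>\<^sub>0 'b::comm_monoid_add"
  shows "(\<Sum>k\<in>Poly_Mapping.keys p. Poly_Mapping.single k (Poly_Mapping.lookup p k)) = p"
proof (rule poly_mapping_eqI)
  fix k
  show "Poly_Mapping.lookup (\<Sum>k\<in>Poly_Mapping.keys p. Poly_Mapping.single k (Poly_Mapping.lookup p k)) k
      = Poly_Mapping.lookup p k"
    by (auto simp: lookup_sum lookup_single when_def in_keys_iff sum.delta)
qed

lemma poly_mapping_additive_induct [case_names single add]:
  fixes p :: "'a \<Rightarrow>\<^sub>0 'b::comm_monoid_add"
  assumes single: "\<And>k c. Q (Poly_Mapping.single k c)"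
    and add: "\<And>p q. Q p \<Longrightarrow> Q q \<Longrightarrow> Q (p + q)"
  shows "Q p"
proof -
  have "Q (\<Sum>k\<in>A. Poly_Mapping.single k (Poly_Mapping.lookup p k))" if "finite A" for A
    using that
  proof induction
    case empty
    show ?case using single[of _ 0] by simp
  qed (auto intro: single add)
  from this[of "Poly_Mapping.keys p"] show ?thesis by (simp add: poly_mapping_sum_singles)
qed

definition mono_val :: "(idx \<Rightarrow> 'r::comm_ring_1) \<Rightarrow> (idx \<Rightarrow>\<^sub>0 nat) \<Rightarrow> 'r" where
  "mono_val \<sigma> m = (\<Prod>a\<in>Poly_Mapping.keys m. \<sigma> a ^ Poly_Mapping.lookup m a)"

lemma mono_val_superset:
  assumes "finite A" "Poly_Mapping.keys m \<subseteq> A"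
  shows "mono_val \<sigma> m = (\<Prod>a\<in>A. \<sigma> a ^ Poly_Mapping.lookup m a)"
  unfolding mono_val_def using assms
  by (intro prod.mono_neutral_left) (auto simp: in_keys_iff)

lemma mono_val_zero [simp]: "mono_val \<sigma> 0 = 1"
  by (simp add: mono_val_def)

lemma mono_val_single [simp]: "mono_val \<sigma> (Poly_Mapping.single a n) = \<sigma> a ^ n"
  by (simp add: mono_val_def)

lemma mono_val_add: "mono_val \<sigma> (m + n) = mono_val \<sigma> m * mono_val \<sigma> n"
proof -
  let ?A = "Poly_Mapping.keys m \<union> Poly_Mapping.keys n"
  have "mono_val \<sigma> (m + n) = (\<Prod>a\<in>?A. \<sigma> a ^ Poly_Mapping.lookup (m + n) a)"
    by (rule mono_val_superset) (use keys_add[of m n] in auto)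
  also have "\<dots> = (\<Prod>a\<in>?A. \<sigma> a ^ Poly_Mapping.lookup m a) * (\<Prod>a\<in>?A. \<sigma> a ^ Poly_Mapping.lookup n a)"
    by (simp add: lookup_add power_add prod.distrib)
  also have "\<dots> = mono_val \<sigma> m * mono_val \<sigma> n"
    by (simp add: mono_val_superset[of ?A])
  finally show ?thesis .
qed

definition is_ring_hom :: "('a::comm_ring_1 \<Rightarrow> 'b::comm_ring_1) \<Rightarrow> bool" where
  "is_ring_hom h \<longleftrightarrow> h 1 = 1 \<and> (\<forall>x y. h (x + y) = h x + h y) \<and> (\<forall>x y. h (x * y) = h x * h y)"

lemma is_ring_homD:
  assumes "is_ring_hom h"
  shows "h 1 = 1" "h (x + y) = h x + h y" "h (x * y) = h x * h y" "h 0 = 0"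
    "h (x ^ n) = h x ^ n" "h (sum g A) = (\<Sum>a\<in>A. h (g a))" "h (prod g A) = (\<Prod>a\<in>A. h (g a))"
    "h (- x) = - h x" "h (x - y) = h x - h y"
proof -
  show 1: "h 1 = 1" and a: "\<And>x y. h (x + y) = h x + h y" and m: "\<And>x y. h (x * y) = h x * h y"
    using assms by (auto simp: is_ring_hom_def)
  show 0: "h 0 = 0" using a[of 0 0] by simp
  show "h (x ^ n) = h x ^ n" by (induction n) (simp_all add: 1 m)
  show "h (sum g A) = (\<Sum>a\<in>A. h (g a))"
    by (induction A rule: infinite_finite_induct) (simp_all add: 0 a)
  show "h (prod g A) = (\<Prod>a\<in>A. h (g a))"
    by (induction A rule: infinite_finite_induct) (simp_all add: 1 m)
  show n: "h (- x) = - h x" for x using a[of x "- x"] 0 by (simp add: eq_neg_iff_add_eq_0 add.commute)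
  show "h (x - y) = h x - h y" using a[of x "- y"] n[of y] by simp
qed

lemma mpoly_eval_superset:
  assumes "finite A" "Poly_Mapping.keys p \<subseteq> A" "is_ring_hom \<iota>"
  shows "mpoly_eval \<iota> \<sigma> p = (\<Sum>m\<in>A. \<iota> (Poly_Mapping.lookup p m) * mono_val \<sigma> m)"
  unfolding mpoly_eval_def mono_val_def using assms
  by (intro sum.mono_neutral_left) (auto simp: in_keys_iff is_ring_homD)

lemma mpoly_eval_single:
  assumes "is_ring_hom \<iota>"
  shows "mpoly_eval \<iota> \<sigma> (Poly_Mapping.single m c) = \<iota> c * mono_val \<sigma> m"
  using mpoly_eval_superset[of "{m}" "Poly_Mapping.single m c" \<iota> \<sigma>] assms by simp

lemma mpoly_eval_add:
  assumes "is_ring_hom \<iota>"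
  shows "mpoly_eval \<iota> \<sigma> (p + q) = mpoly_eval \<iota> \<sigma> p + mpoly_eval \<iota> \<sigma> q"
proof -
  let ?A = "Poly_Mapping.keys p \<union> Poly_Mapping.keys q"
  have "mpoly_eval \<iota> \<sigma> (p + q) = (\<Sum>m\<in>?A. \<iota> (Poly_Mapping.lookup (p + q) m) * mono_val \<sigma> m)"
    by (rule mpoly_eval_superset) (use keys_add[of p q] assms in auto)
  also have "\<dots> = (\<Sum>m\<in>?A. \<iota> (Poly_Mapping.lookup p m) * mono_val \<sigma> m)
                 + (\<Sum>m\<in>?A. \<iota> (Poly_Mapping.lookup q m) * mono_val \<sigma> m)"
    by (simp add: lookup_add is_ring_homD[OF assms] distrib_right sum.distrib)
  also have "\<dots> = mpoly_eval \<iota> \<sigma> p + mpoly_eval \<iota> \<sigma> q"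
    using assms by (simp add: mpoly_eval_superset[of ?A])
  finally show ?thesis .
qed

lemma mpoly_eval_ring_hom:
  assumes "is_ring_hom \<iota>"
  shows "is_ring_hom (mpoly_eval \<iota> \<sigma>)"
proof -
  note hom = is_ring_homD[OF assms]
  have "mpoly_eval \<iota> \<sigma> (p * q) = mpoly_eval \<iota> \<sigma> p * mpoly_eval \<iota> \<sigma> q" for p q
  proof (induction p rule: poly_mapping_additive_induct)
    case (single m c)
    show ?case
    proof (induction q rule: poly_mapping_additive_induct)
      case (single n d)
      show ?case by (simp add: mult_single mpoly_eval_single[OF assms] hom mono_val_add algebra_simps)
    next
      case (add p q)
      then show ?case by (simp add: distrib_left mpoly_eval_add[OF assms])
    qed
  next
    case (add p q)
    then show ?case by (simp add: distrib_right mpoly_eval_add[OF assms])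
  qed
  moreover have "mpoly_eval \<iota> \<sigma> 1 = 1"
    using mpoly_eval_single[OF assms, of \<sigma> 0 1] by (simp add: hom)
  ultimately show ?thesis by (simp add: is_ring_hom_def mpoly_eval_add[OF assms])
qed

lemma ring_hom_mpoly_eval:
  assumes "is_ring_hom h"
  shows "h (mpoly_eval \<iota> s q) = mpoly_eval (h \<circ> \<iota>) (h \<circ> s) q"
  by (simp add: mpoly_eval_def is_ring_homD[OF assms])

definition emb :: "mpoly \<Rightarrow> mrat" where
  "emb p = Fract p 1"

lemma emb_hom: "is_ring_hom emb"
  by (simp add: is_ring_hom_def emb_def One_fract_def)

lemma emb_eq_iff [simp]: "emb p = emb q \<longleftrightarrow> p = q"
  by (simp add: emb_def eq_fract)

lemma Fract_emb: "Fract p q = emb p / emb q"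
  by (simp add: emb_def)

lemma const_emb: "const c = emb (Poly_Mapping.single 0 c)"
  by (simp add: const_def emb_def)

lemma const_hom: "is_ring_hom const"
  by (simp add: is_ring_hom_def const_emb single_add mult_single
      flip: is_ring_homD(1-3)[OF emb_hom])

lemmas const_simps = is_ring_homD[OF const_hom]

lemma const_eq_iff [simp]: "const c = const d \<longleftrightarrow> c = d"
  by (simp add: const_emb inj_eq[OF inj_single])

lemma X_emb: "X a = emb (Poly_Mapping.single (Poly_Mapping.single a 1) 1)"
  by (simp add: X_def emb_def)

lemma emb_monomial: "emb (Poly_Mapping.single m 1) = mono_val X m"
proof (induction m rule: poly_mapping_additive_induct)
  case (single a n)
  show ?case
  proof (induction n)
    case 0
    show ?case by (simp add: is_ring_homD[OF emb_hom])
  next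
    case (Suc n)
    have "emb (Poly_Mapping.single (Poly_Mapping.single a (Suc n)) 1)
        = emb (Poly_Mapping.single (Poly_Mapping.single a 1) 1) * emb (Poly_Mapping.single (Poly_Mapping.single a n) 1)"
      by (simp add: mult_single flip: is_ring_homD(3)[OF emb_hom] single_add)
    then show ?case using Suc by (simp add: X_emb)
  qed
next
  case (add p q)
  have "emb (Poly_Mapping.single (p + q) 1) = emb (Poly_Mapping.single p 1) * emb (Poly_Mapping.single q 1)"
    by (simp add: mult_single flip: is_ring_homD(3)[OF emb_hom])
  then show ?case using add by (simp add: mono_val_add)
qed

lemma emb_eval: "emb p = mpoly_eval const X p"
proof (induction p rule: poly_mapping_additive_induct)
  case (single m c)
  have "emb (Poly_Mapping.single m c) = emb (Poly_Mapping.single 0 c) * emb (Poly_Mapping.single m 1)"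
    by (simp add: mult_single flip: is_ring_homD(3)[OF emb_hom])
  then show ?case by (simp add: mpoly_eval_single[OF const_hom] emb_monomial flip: const_emb)
next
  case (add p q)
  then show ?case by (simp add: is_ring_homD[OF emb_hom] mpoly_eval_add[OF const_hom])
qed

text \<open>Shifts and permutations of the variables are compared by their values on the variables:
  endomorphisms of the field over the complex numbers that agree there are equal.\<close>

definition fhom :: "(mrat \<Rightarrow> mrat) \<Rightarrow> bool" where
  "fhom \<phi> \<longleftrightarrow> (\<forall>f g. \<phi> (f + g) = \<phi> f + \<phi> g) \<and> (\<forall>f g. \<phi> (f * g) = \<phi> f * \<phi> g)
      \<and> (\<forall>c. \<phi> (const c) = const c)"

lemma fhom_ring_hom: "fhom \<phi> \<Longrightarrow> is_ring_hom \<phi>"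
proof -
  assume \<phi>: "fhom \<phi>"
  then have "\<phi> (const 1) = const 1" by (simp only: fhom_def)
  with \<phi> show ?thesis by (simp add: fhom_def is_ring_hom_def const_simps(1))
qed

lemma fhomD:
  assumes "fhom \<phi>"
  shows "\<phi> 1 = 1" "\<phi> (x + y) = \<phi> x + \<phi> y" "\<phi> (x * y) = \<phi> x * \<phi> y" "\<phi> 0 = 0"
    "\<phi> (x ^ n) = \<phi> x ^ n" "\<phi> (sum g A) = (\<Sum>a\<in>A. \<phi> (g a))" "\<phi> (prod g A) = (\<Prod>a\<in>A. \<phi> (g a))"
    "\<phi> (- x) = - \<phi> x" "\<phi> (x - y) = \<phi> x - \<phi> y" "\<phi> (const c) = const c"
    "\<phi> (x / y) = \<phi> x / \<phi> y" "\<phi> x = 0 \<longleftrightarrow> x = 0"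
proof -
  note h = is_ring_homD[OF fhom_ring_hom[OF assms]]
  show "\<phi> 1 = 1" "\<phi> (x + y) = \<phi> x + \<phi> y" "\<phi> (x * y) = \<phi> x * \<phi> y" "\<phi> 0 = 0"
    "\<phi> (x ^ n) = \<phi> x ^ n" "\<phi> (sum g A) = (\<Sum>a\<in>A. \<phi> (g a))" "\<phi> (prod g A) = (\<Prod>a\<in>A. \<phi> (g a))"
    "\<phi> (- x) = - \<phi> x" "\<phi> (x - y) = \<phi> x - \<phi> y" by (fact h)+
  show "\<phi> (const c) = const c" using assms by (simp add: fhom_def)
  show z: "\<phi> x = 0 \<longleftrightarrow> x = 0" for x
  proof
    assume 0: "\<phi> x = 0"
    show "x = 0"
    proof (rule ccontr)
      assume "x \<noteq> 0"
      then have "\<phi> x * \<phi> (1 / x) = 1" by (simp flip: h(3) add: h)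
      then show False using 0 by simp
    qed
  qed (simp add: h)
  show "\<phi> (x / y) = \<phi> x / \<phi> y"
  proof (cases "y = 0")
    case False
    then have "\<phi> (x / y) * \<phi> y = \<phi> x" by (simp flip: h(3))
    then show ?thesis using False z[of y] by (simp add: eq_divide_eq)
  qed (simp add: h)
qed

lemma fhom_eqI:
  assumes "fhom \<phi>" "fhom \<psi>" "\<And>a. \<phi> (X a) = \<psi> (X a)"
  shows "\<phi> f = \<psi> f"
proof -
  have *: "\<chi> (emb p) = mpoly_eval const (\<chi> \<circ> X) p" if "fhom \<chi>" for \<chi> p
  proof -
    have "\<chi> \<circ> const = const"
      by (rule ext) (simp add: fhomD(10)[OF that])
    then show ?thesis
      by (simp add: emb_eval ring_hom_mpoly_eval[OF fhom_ring_hom[OF that]])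
  qed
  have "\<phi> \<circ> X = \<psi> \<circ> X"
    by (rule ext) (simp add: assms(3))
  then have emb: "\<phi> (emb p) = \<psi> (emb p)" for p
    by (simp add: *[OF assms(1)] *[OF assms(2)])
  obtain p q where "f = emb p / emb q"
    by (cases f) (simp only: Fract_emb)
  then show ?thesis
    by (simp only: fhomD(11)[OF assms(1)] fhomD(11)[OF assms(2)] emb)
qed

lemma fhom_comp: "fhom \<phi> \<Longrightarrow> fhom \<psi> \<Longrightarrow> fhom (\<phi> \<circ> \<psi>)"
  by (simp add: fhom_def)

lemma fhom_id: "fhom id"
  by (simp add: fhom_def)

text \<open>A substitution with a left inverse is injective on polynomials, hence extends to fractions.\<close>

lemma subst_rat_fhom:
  assumes inv: "\<And>a. mpoly_eval const (emb \<circ> t) (s a) = X a"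
  shows "fhom (subst_rat (emb \<circ> s))" "subst_rat (emb \<circ> s) (X a) = emb (s a)"
proof -
  let ?e = "mpoly_eval const (emb \<circ> s)"
  note e = is_ring_homD[OF mpoly_eval_ring_hom[OF const_hom, of "emb \<circ> s"]]
  have factor: "?e q = emb (mpoly_eval (Poly_Mapping.single 0) s q)" for q
  proof -
    have "emb \<circ> Poly_Mapping.single 0 = const"
      by (rule ext) (simp add: const_emb)
    then show ?thesis by (simp add: ring_hom_mpoly_eval[OF emb_hom])
  qed
  have inverse: "mpoly_eval const (emb \<circ> t) (mpoly_eval (Poly_Mapping.single 0) s q) = emb q" for q
  proof -
    have "mpoly_eval const (emb \<circ> t) \<circ> Poly_Mapping.single 0 = const"
      by (rule ext) (simp add: mpoly_eval_single[OF const_hom])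
    moreover have "mpoly_eval const (emb \<circ> t) \<circ> s = X"
      by (rule ext) (simp add: inv)
    ultimately show ?thesis
      by (simp add: ring_hom_mpoly_eval[OF mpoly_eval_ring_hom[OF const_hom]] emb_eval)
  qed
  have inj: "?e q \<noteq> 0" if "q \<noteq> 0" for q
  proof
    assume "?e q = 0"
    then have "mpoly_eval (Poly_Mapping.single 0) s q = 0"
      using factor[of q] emb_eq_iff[of _ 0] by (simp add: is_ring_homD[OF emb_hom])
    then have "emb q = 0"
      using inverse[of q] by (simp add: is_ring_homD[OF mpoly_eval_ring_hom[OF const_hom]])
    then show False using that emb_eq_iff[of q 0] by (simp add: is_ring_homD[OF emb_hom])
  qed
  have sub: "subst_rat (emb \<circ> s) (Fract p q) = ?e p / ?e q" if "q \<noteq> 0" for p q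
    unfolding subst_rat_def
  proof (rule the_equality)
    show "\<exists>p' q'. q' \<noteq> 0 \<and> Fract p q = Fract p' q' \<and> ?e p / ?e q = ?e p' / ?e q'"
      using that by blast
  next
    fix g assume "\<exists>p' q'. q' \<noteq> 0 \<and> Fract p q = Fract p' q' \<and> g = ?e p' / ?e q'"
    then obtain p' q' where *: "q' \<noteq> 0" "Fract p q = Fract p' q'" "g = ?e p' / ?e q'" by blast
    then have "p * q' = p' * q" using that by (simp add: eq_fract)
    then have "?e p * ?e q' = ?e p' * ?e q" using e(3)[of p q'] e(3)[of p' q] by simp
    then show "g = ?e p / ?e q" using inj that * by (simp add: frac_eq_eq)
  qed
  have sub1: "subst_rat (emb \<circ> s) (emb p) = ?e p" for p
    using sub[of 1 p] by (simp add: emb_def e)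
  show "fhom (subst_rat (emb \<circ> s))"
    unfolding fhom_def
  proof (intro conjI allI)
    fix f g :: mrat and c
    obtain p q p' q' where f: "f = Fract p q" "q \<noteq> 0" and g: "g = Fract p' q'" "q' \<noteq> 0"
      by (metis Fract_cases)
    show "subst_rat (emb \<circ> s) (f + g) = subst_rat (emb \<circ> s) f + subst_rat (emb \<circ> s) g"
      using f g inj[of q] inj[of q'] by (simp add: sub e add_frac_eq)
    show "subst_rat (emb \<circ> s) (f * g) = subst_rat (emb \<circ> s) f * subst_rat (emb \<circ> s) g"
      using f g inj[of q] inj[of q'] by (simp add: sub e)
    show "subst_rat (emb \<circ> s) (const c) = const c"
      by (simp add: const_emb sub1 mpoly_eval_single[OF const_hom])
  qed
  show "subst_rat (emb \<circ> s) (X a) = emb (s a)"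
    by (simp add: X_emb sub1 mpoly_eval_single[OF const_hom] const_simps)
qed

definition shift :: "(idx \<Rightarrow> int) \<Rightarrow> mrat \<Rightarrow> mrat" where
  "shift d = subst_rat (\<lambda>b. X b + const (of_int (d b)))"

lemma shift_fhom: "fhom (shift d)" and shift_X [simp]: "shift d (X a) = X a + const (of_int (d a))"
proof -
  define s where "s c a = (Poly_Mapping.single (Poly_Mapping.single a 1) 1
      + Poly_Mapping.single 0 (c a) :: mpoly)" for c :: "idx \<Rightarrow> complex" and a
  have emb_s: "emb (s c a) = X a + const (c a)" for c a
    by (simp add: s_def X_emb const_emb is_ring_homD[OF emb_hom])
  have inv: "mpoly_eval const (emb \<circ> s (\<lambda>b. - c b)) (s c a) = X a" for a c
    by (simp add: s_def[of c] mpoly_eval_add[OF const_hom] mpoly_eval_single[OF const_hom] emb_s const_simps)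
  have "shift d = subst_rat (emb \<circ> s (\<lambda>b. of_int (d b)))"
    by (simp add: shift_def comp_def emb_s)
  then show "fhom (shift d)" "shift d (X a) = X a + const (of_int (d a))"
    using subst_rat_fhom[OF inv] by (simp_all add: emb_s)
qed

lemma assumes "bij g"
  shows perm_act_fhom: "fhom (perm_act g)" and perm_act_X: "perm_act g (X a) = X (g a)"
proof -
  define s where "s g a = (Poly_Mapping.single (Poly_Mapping.single (g a) 1) 1 :: mpoly)"
    for g :: "idx \<Rightarrow> idx" and a
  have emb_s: "emb (s g a) = X (g a)" for g a
    by (simp add: s_def X_emb)
  have inv: "mpoly_eval const (emb \<circ> s (inv g)) (s g a) = X a" if "bij g" for a g
    using that
    by (simp add: s_def[of g] mpoly_eval_single[OF const_hom] emb_s const_simps bij_is_inj)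
  have "perm_act g = subst_rat (emb \<circ> s g)" for g
    by (simp add: perm_act_def comp_def emb_s)
  then show "fhom (perm_act g)" "perm_act g (X a) = X (g a)"
    using subst_rat_fhom[OF inv, of g] assms by (simp_all add: emb_s)
qed

lemmas shift_simps = fhomD[OF shift_fhom]
lemmas perm_act_simps = fhomD[OF perm_act_fhom]

lemma shift_shift: "shift d (shift e f) = shift (\<lambda>a. d a + e a) f"
  using fhom_eqI[OF fhom_comp[OF shift_fhom shift_fhom] shift_fhom, of d e "\<lambda>a. d a + e a" f]
  by (simp add: shift_simps const_simps algebra_simps)

lemma shift_0: "shift (\<lambda>a. 0) f = f"
  using fhom_eqI[OF shift_fhom fhom_id, of "\<lambda>a. 0" f] by (simp add: const_simps)

lemma perm_act_comp: "bij g \<Longrightarrow> bij h \<Longrightarrow> perm_act g (perm_act h f) = perm_act (g \<circ> h) f"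
  using fhom_eqI[OF fhom_comp[OF perm_act_fhom perm_act_fhom] perm_act_fhom, of g h "g \<circ> h" f]
  by (simp add: perm_act_X bij_comp)

lemma perm_act_id: "perm_act id f = f"
  using fhom_eqI[OF perm_act_fhom fhom_id, of id f] by (simp add: perm_act_X)

lemma perm_act_shift:
  assumes "bij g" shows "perm_act g (shift d f) = shift (d \<circ> inv g) (perm_act g f)"
proof -
  have "(perm_act g \<circ> shift d) f = (shift (d \<circ> inv g) \<circ> perm_act g) f"
    by (rule fhom_eqI[OF fhom_comp fhom_comp])
      (use assms in \<open>auto simp: perm_act_fhom shift_fhom perm_act_X perm_act_simps bij_is_inj\<close>)
  then show ?thesis by simp
qed

lemma shift_phi: "subst_rat (\<lambda>b. X b + (if b = a then 1 else 0)) = shift (\<lambda>b. if b = a then 1 else 0)"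
  by (simp add: shift_def const_simps if_distrib cong: if_cong)


section \<open>The polynomial ring and evaluation\<close>

lemma R_emb: "R lam = emb ` polys lam"
  by (auto simp: R_def emb_def)

lemma polys_add: "p \<in> polys lam \<Longrightarrow> q \<in> polys lam \<Longrightarrow> p + q \<in> polys lam"
  unfolding polys_def using keys_add[of p q] by blast

lemma polys_mult:
  assumes "p \<in> polys lam" "q \<in> polys lam" shows "p * q \<in> polys lam"
  unfolding polys_def
proof safe
  fix m a b assume "m \<in> Poly_Mapping.keys (p * q)" and a: "(a, b) \<in> Poly_Mapping.keys m"
  then obtain m1 m2 where "m = m1 + m2" "m1 \<in> Poly_Mapping.keys p" "m2 \<in> Poly_Mapping.keys q"
    using keys_mult[of p q] by blast
  then show "(a, b) \<in> I lam"
    using assms a keys_add[of m1 m2] unfolding polys_def by blast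
qed

lemma R_add [intro]: "f \<in> R lam \<Longrightarrow> g \<in> R lam \<Longrightarrow> f + g \<in> R lam"
  unfolding R_emb by (auto simp flip: is_ring_homD(2)[OF emb_hom] intro: polys_add)

lemma R_mult [intro]: "f \<in> R lam \<Longrightarrow> g \<in> R lam \<Longrightarrow> f * g \<in> R lam"
  unfolding R_emb by (auto simp flip: is_ring_homD(3)[OF emb_hom] intro: polys_mult)

lemma R_const [intro, simp]: "const c \<in> R lam"
  unfolding R_emb by (rule image_eqI[where x = "Poly_Mapping.single 0 c"]) (simp_all add: const_emb polys_def)

lemma R_0 [intro, simp]: "0 \<in> R lam" and R_1 [intro, simp]: "1 \<in> R lam"
  using R_const[of 0 lam] R_const[of 1 lam] by (simp_all add: const_simps)

lemma R_X [intro]: "a \<in> I lam \<Longrightarrow> X a \<in> R lam"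
  unfolding R_emb by (rule image_eqI[where x = "Poly_Mapping.single (Poly_Mapping.single a 1) 1"])
    (simp_all add: X_emb polys_def)

lemma R_uminus [intro]: "f \<in> R lam \<Longrightarrow> - f \<in> R lam"
  using R_mult[OF R_const[of "-1"], of f] by (simp add: const_simps)

lemma R_diff [intro]: "f \<in> R lam \<Longrightarrow> g \<in> R lam \<Longrightarrow> f - g \<in> R lam"
  using R_add[OF _ R_uminus, of f lam g] by simp

lemma R_power [intro]: "f \<in> R lam \<Longrightarrow> f ^ n \<in> R lam"
  by (induction n) auto

lemma R_sum [intro]: "(\<And>a. a \<in> A \<Longrightarrow> f a \<in> R lam) \<Longrightarrow> sum f A \<in> R lam"
  by (induction A rule: infinite_finite_induct) auto

lemma R_prod [intro]: "(\<And>a. a \<in> A \<Longrightarrow> f a \<in> R lam) \<Longrightarrow> prod f A \<in> R lam"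
  by (induction A rule: infinite_finite_induct) auto

lemma R_induct [consumes 1, case_names const X add mult]:
  assumes f: "f \<in> R lam"
    and const: "\<And>c. Q (const c)"
    and X: "\<And>a. a \<in> I lam \<Longrightarrow> Q (X a)"
    and add: "\<And>f g. f \<in> R lam \<Longrightarrow> g \<in> R lam \<Longrightarrow> Q f \<Longrightarrow> Q g \<Longrightarrow> Q (f + g)"
    and mult: "\<And>f g. f \<in> R lam \<Longrightarrow> g \<in> R lam \<Longrightarrow> Q f \<Longrightarrow> Q g \<Longrightarrow> Q (f * g)"
  shows "Q f"
proof -
  define P where "P f \<longleftrightarrow> f \<in> R lam \<and> Q f" for f
  have Pc: "P (const c)" for c using const by (simp add: P_def)
  have P0: "P 0" and P1: "P 1" using Pc[of 0] Pc[of 1] by (simp_all add: const_simps)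
  have Padd: "P (f + g)" if "P f" "P g" for f g using that add by (auto simp: P_def)
  have Pmult: "P (f * g)" if "P f" "P g" for f g using that mult by (auto simp: P_def)
  have Psum: "P (sum h A)" if "\<And>a. a \<in> A \<Longrightarrow> P (h a)" for h :: "(idx \<Rightarrow>\<^sub>0 nat) \<Rightarrow> mrat" and A
    using that by (induction A rule: infinite_finite_induct) (auto intro: P0 Padd)
  have Pprod: "P (prod h A)" if "\<And>a. a \<in> A \<Longrightarrow> P (h a)" for h :: "idx \<Rightarrow> mrat" and A
    using that by (induction A rule: infinite_finite_induct) (auto intro: P1 Pmult)
  have Ppow: "P (h ^ n)" if "P h" for h n
    using that by (induction n) (auto intro: P1 Pmult)
  obtain p where p: "p \<in> polys lam" and fp: "f = mpoly_eval const X p"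
    using f by (auto simp: R_emb emb_eval)
  have "P (mpoly_eval const X p)"
    unfolding mpoly_eval_def
    by (intro Psum Pmult Pprod Ppow Pc) (use p in \<open>auto simp: P_def polys_def intro: X\<close>)
  then show ?thesis by (simp add: fp P_def)
qed

lemma Omega_quot: "Omega lam = {f / g | f g. f \<in> R lam \<and> g \<in> R lam \<and> g \<noteq> 0}"
proof -
  have "q \<noteq> 0 \<longleftrightarrow> emb q \<noteq> 0" for q
    using emb_eq_iff[of q 0] by (simp add: is_ring_homD[OF emb_hom])
  then show ?thesis
    unfolding Omega_def R_emb Fract_emb by blast
qed

lemma R_subset_Omega: "f \<in> R lam \<Longrightarrow> f \<in> Omega lam"
  unfolding Omega_quot by (rule CollectI, rule exI[of _ f], rule exI[of _ 1]) simp

lemma Omega_mult_R: "f \<in> R lam \<Longrightarrow> g \<in> Omega lam \<Longrightarrow> f * g \<in> Omega lam"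
proof -
  assume f: "f \<in> R lam" and "g \<in> Omega lam"
  then obtain p q where pq: "g = p / q" "p \<in> R lam" "q \<in> R lam" "q \<noteq> 0"
    by (auto simp: Omega_quot)
  then have "f * g = (f * p) / q" by simp
  with pq R_mult[OF f pq(2)] show ?thesis unfolding Omega_quot by blast
qed

lemma shift_R [intro]: "f \<in> R lam \<Longrightarrow> shift d f \<in> R lam"
  by (induction rule: R_induct) (auto simp: shift_simps)

lemma shift_Omega: "f \<in> Omega lam \<Longrightarrow> shift d f \<in> Omega lam"
  unfolding Omega_quot by (force simp: shift_simps)

lemma perm_act_R [intro]:
  assumes "g permutes I lam" "f \<in> R lam" shows "perm_act g f \<in> R lam"
proof -
  have "bij g" using assms permutes_bij by blast
  from assms(2) show ?thesis
    by (induction rule: R_induct)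
      (auto simp: perm_act_simps[OF \<open>bij g\<close>] perm_act_X[OF \<open>bij g\<close>] permutes_in_image[OF assms(1)])
qed

lemma ev_emb: "ev v (emb p) = mpoly_eval id v p"
  unfolding ev_def emb_def[symmetric] by (rule the_equality) auto

lemma id_hom: "is_ring_hom (id :: complex \<Rightarrow> complex)"
  by (simp add: is_ring_hom_def)

lemma ev_const [simp]: "ev v (const c) = c"
  by (simp add: const_emb ev_emb mpoly_eval_single id_hom)

lemma ev_X [simp]: "ev v (X a) = v a"
  by (simp add: X_emb ev_emb mpoly_eval_single id_hom)

lemma ev_add: "f \<in> R lam \<Longrightarrow> g \<in> R lam \<Longrightarrow> ev v (f + g) = ev v f + ev v g"
  unfolding R_emb
  by (auto simp: ev_emb is_ring_homD[OF mpoly_eval_ring_hom[OF id_hom]] simp flip: is_ring_homD(2)[OF emb_hom])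

lemma ev_mult: "f \<in> R lam \<Longrightarrow> g \<in> R lam \<Longrightarrow> ev v (f * g) = ev v f * ev v g"
  unfolding R_emb
  by (auto simp: ev_emb is_ring_homD[OF mpoly_eval_ring_hom[OF id_hom]] simp flip: is_ring_homD(3)[OF emb_hom])

lemma ev_0 [simp]: "ev v 0 = 0" and ev_1 [simp]: "ev v 1 = 1"
  using ev_const[of v 0] ev_const[of v 1] by (simp_all add: const_simps)

lemma ev_uminus: "f \<in> R lam \<Longrightarrow> ev v (- f) = - ev v f"
  using ev_mult[OF R_const[of "-1" lam], of f v] unfolding ev_const
  by (simp add: const_simps(1,8))

lemma ev_diff: "f \<in> R lam \<Longrightarrow> g \<in> R lam \<Longrightarrow> ev v (f - g) = ev v f - ev v g"
  using ev_add[OF _ R_uminus, of f lam g v] by (simp add: ev_uminus)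

lemma ev_power: "f \<in> R lam \<Longrightarrow> ev v (f ^ n) = ev v f ^ n"
  by (induction n) (auto simp: ev_mult[OF _ R_power])

lemma ev_sum: "(\<And>a. a \<in> A \<Longrightarrow> f a \<in> R lam) \<Longrightarrow> ev v (sum f A) = (\<Sum>a\<in>A. ev v (f a))"
proof (induction A rule: infinite_finite_induct)
  case (insert x F)
  then show ?case using ev_add[OF _ R_sum, of "f x" lam F f v] by simp
qed auto

lemma ev_shift: "f \<in> R lam \<Longrightarrow> ev v (shift d f) = ev (\<lambda>a. v a + of_int (d a)) f"
  by (induction rule: R_induct)
    (auto simp: shift_simps ev_add[OF R_X R_const] ev_add[OF shift_R shift_R] ev_mult[OF shift_R shift_R]
      ev_add ev_mult)

lemma ev_perm_act:
  assumes "g permutes I lam" "f \<in> R lam" shows "ev v (perm_act g f) = ev (v \<circ> g) f"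
proof -
  have b: "bij g" using assms permutes_bij by blast
  note p = perm_act_R[OF assms(1)]
  from assms(2) show ?thesis
    by (induction rule: R_induct)
      (auto simp: perm_act_simps[OF b] perm_act_X[OF b] ev_add ev_mult ev_add[OF p p] ev_mult[OF p p])
qed

lemma ev_cong: "f \<in> R lam \<Longrightarrow> (\<And>a. a \<in> I lam \<Longrightarrow> v a = w a) \<Longrightarrow> ev v f = ev w f"
  by (induction rule: R_induct) (auto simp: ev_add ev_mult)

lemma X_inj: "X a = X b \<longleftrightarrow> a = b"
proof
  assume "X a = X b"
  then have "ev (\<lambda>c. if c = a then 1 else 0) (X a) = ev (\<lambda>c. if c = a then 1 else 0) (X b)" by simp
  then show "a = b" by (simp split: if_splits)
qed simp


section \<open>Divided differences\<close>

lemma next_idx_simps [simp]: "fst (next_idx a) = fst a" "snd (next_idx a) = Suc (snd a)"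
  "next_idx a \<noteq> a" "a \<noteq> next_idx a" "next_idx a = next_idx b \<longleftrightarrow> a = b"
  by (auto simp: next_idx_def prod_eq_iff)

lemma simple_refl_simps [simp]:
  "simple_refl a a = next_idx a" "simple_refl a (next_idx a) = a"
  "simple_refl a (simple_refl a b) = b" "bij (simple_refl a)"
  by (simp_all add: simple_refl_def)

lemma simple_refl_other [simp]: "b \<noteq> a \<Longrightarrow> b \<noteq> next_idx a \<Longrightarrow> simple_refl a b = b"
  by (simp add: simple_refl_def transpose_def)

lemma simple_refl_involution [simp]: "simple_refl a \<circ> simple_refl a = id"
  by (simp add: simple_refl_def)

lemma simple_refl_inv [simp]: "inv (simple_refl a) = simple_refl a"
  by (simp add: inv_unique_comp)

abbreviation s_act :: "idx \<Rightarrow> mrat \<Rightarrow> mrat" where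
  "s_act a \<equiv> perm_act (simple_refl a)"

lemmas s_act_simps = perm_act_simps[OF simple_refl_simps(4)]

lemma s_act_X [simp]: "s_act a (X b) = X (simple_refl a b)"
  by (simp add: perm_act_X)

lemma s_act_involution [simp]: "s_act a (s_act a f) = f"
  by (simp add: perm_act_comp perm_act_id)

abbreviation D :: "idx \<Rightarrow> mrat \<Rightarrow> mrat" where
  "D \<equiv> div_diff_simple"

lemma X_diff_nonzero: "a \<noteq> b \<Longrightarrow> X a - X b \<noteq> 0"
  by (simp add: X_inj)

lemma D_add: "D a (f + g) = D a f + D a g"
  by (simp add: div_diff_simple_def s_act_simps add_divide_distrib[symmetric] algebra_simps)

lemma D_0 [simp]: "D a 0 = 0"
  by (simp add: div_diff_simple_def s_act_simps)

lemma D_leibniz: "D a (f * g) = D a f * g + s_act a f * D a g"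
  by (simp add: div_diff_simple_def s_act_simps add_divide_distrib[symmetric] algebra_simps)

lemma D_invariant: "s_act a f = f \<Longrightarrow> D a f = 0"
  by (simp add: div_diff_simple_def)

lemma D_mult_invariant: "s_act a r = r \<Longrightarrow> D a (r * f) = r * D a f"
  by (simp add: D_leibniz D_invariant)

lemma D_const [simp]: "D a (const c) = 0"
  by (simp add: D_invariant s_act_simps)

lemma minus_divide_minus: "(b - a) / (d - c) = (a - b) / (c - d)" for a :: "'a::field"
  by (metis minus_diff_eq minus_divide_divide)

lemma s_act_D: "s_act a (D a f) = D a f"
  by (simp only: div_diff_simple_def s_act_simps s_act_involution s_act_X simple_refl_simps
      minus_divide_minus[of "s_act a f" f])

lemma D_D [simp]: "D a (D a f) = 0"
  by (rule D_invariant[OF s_act_D])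

lemma s_act_eq_D: "s_act a f = f - (X a - X (next_idx a)) * D a f"
  using X_diff_nonzero[of a "next_idx a"]
  by (simp only: div_diff_simple_def times_divide_eq_right nonzero_mult_div_cancel_left) simp

lemma D_X: "D a (X b) = (if b = a then 1 else if b = next_idx a then - 1 else 0)"
proof -
  have *: "y - x = - (x - y)" for x y :: mrat by simp
  have ne: "X a - X (next_idx a) \<noteq> 0" by (rule X_diff_nonzero) simp
  consider "b = a" | "b = next_idx a" | "b \<noteq> a" "b \<noteq> next_idx a" by blast
  then show ?thesis
  proof cases
    case 1
    then show ?thesis using ne by (simp only: div_diff_simple_def s_act_X simple_refl_simps divide_self if_True simp_thms)
  next
    case 2
    then show ?thesis
      unfolding div_diff_simple_def using ne *[of "X (next_idx a)" "X a"]
      by (simp only: s_act_X simple_refl_simps divide_minus_left divide_self next_idx_simps if_False if_True simp_thms)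
  next
    case 3
    then show ?thesis by (simp add: D_invariant)
  qed
qed

lemma simple_refl_permutes: "a \<in> simple_idx lam \<Longrightarrow> simple_refl a permutes I lam"
  unfolding simple_refl_def by (rule permutes_swap_id) (auto simp: simple_idx_def)

lemma s_act_R [intro]: "a \<in> simple_idx lam \<Longrightarrow> f \<in> R lam \<Longrightarrow> s_act a f \<in> R lam"
  by (rule perm_act_R[OF simple_refl_permutes])

lemma D_R [intro]:
  assumes "a \<in> simple_idx lam" "f \<in> R lam" shows "D a f \<in> R lam"
  using assms(2)
  by (induction rule: R_induct) (auto simp: D_X D_add D_leibniz intro!: R_add R_mult s_act_R assms)

lemma braid_identity:
  fixes p q :: "'a::field"
  assumes "p \<noteq> 0" "q \<noteq> 0" "p + q \<noteq> 0"
  shows "(((f - f1) / p - (f2 - f21) / (p + q)) / q - ((f1 - f) / (- p) - (f12 - f121) / q) / (p + q)) / p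
       = (((f - f2) / q - (f1 - f12) / (p + q)) / p - ((f2 - f) / (- q) - (f21 - f121) / p) / (p + q)) / q"
  using assms by (simp add: divide_simps) (simp add: algebra_simps)

lemma diff_add_cancel_middle: "(x - y) + (y - z) = x - z" for x :: "'a::ab_group_add"
  by simp

lemma D_braid:
  assumes b: "b = next_idx a"
  shows "D a (D b (D a f)) = D b (D a (D b f))"
proof -
  define c where "c = next_idx b"
  have ne: "a \<noteq> b" "b \<noteq> c" "a \<noteq> c" "c \<noteq> a" "c \<noteq> b" "b \<noteq> a"
    by (auto simp: b c_def next_idx_def prod_eq_iff)
  have sa: "simple_refl a a = b" "simple_refl a b = a" "simple_refl a c = c"
    using ne by (simp_all add: b)
  have sb: "simple_refl b b = c" "simple_refl b c = b" "simple_refl b a = a"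
    using ne by (simp_all add: c_def)
  have perm: "simple_refl a \<circ> (simple_refl b \<circ> simple_refl a) = simple_refl b \<circ> (simple_refl a \<circ> simple_refl b)"
  proof
    fix x show "(simple_refl a \<circ> (simple_refl b \<circ> simple_refl a)) x = (simple_refl b \<circ> (simple_refl a \<circ> simple_refl b)) x"
      using ne sa sb b c_def by (cases "x = a"; cases "x = b"; cases "x = c") auto
  qed
  have sts: "s_act a (s_act b (s_act a f)) = s_act b (s_act a (s_act b f))"
    using perm by (simp add: perm_act_comp bij_comp)
  define p q where "p = X a - X b" and "q = X b - X c"
  have pq: "p \<noteq> 0" "q \<noteq> 0" "p + q \<noteq> 0" "X a - X c = p + q" "X b - X a = - p" "X c - X b = - q"
    unfolding p_def q_def diff_add_cancel_middle minus_diff_eq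
    by (rule X_diff_nonzero refl; use ne in simp)+
  have Da: "D a g = (g - s_act a g) / p" for g by (simp add: div_diff_simple_def p_def b)
  have Db: "D b g = (g - s_act b g) / q" for g by (simp add: div_diff_simple_def q_def c_def)
  have "s_act a p = - p" "s_act b p = p + q" "s_act a q = p + q" "s_act b q = - q"
    using pq(4-6) sa sb by (simp_all only: s_act_simps s_act_X p_def q_def)
  then show ?thesis
    using braid_identity[OF pq(1-3), of f "s_act a f" "s_act b f" "s_act b (s_act a f)" "s_act a (s_act b f)"
        "s_act a (s_act b (s_act a f))"]
    by (simp add: Da Db s_act_simps sts add.commute)
qed

lemma commute_identity:
  "((f - f2) / q - (f1 - f12) / q) / p = ((f - f1) / p - (f2 - f12) / p) / q" for p :: "'a::field"
  by (simp add: diff_divide_distrib[symmetric] algebra_simps)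

lemma D_commute:
  assumes "a \<noteq> b" "next_idx a \<noteq> b" "next_idx b \<noteq> a"
  shows "D a (D b f) = D b (D a f)"
proof -
  have ab: "simple_refl a b = b" "simple_refl a (next_idx b) = next_idx b"
    "simple_refl b a = a" "simple_refl b (next_idx a) = next_idx a"
    using assms by auto
  have "simple_refl a \<circ> simple_refl b = simple_refl b \<circ> simple_refl a"
  proof
    fix x show "(simple_refl a \<circ> simple_refl b) x = (simple_refl b \<circ> simple_refl a) x"
      using ab by (cases "x = a"; cases "x = next_idx a"; cases "x = b"; cases "x = next_idx b") auto
  qed
  then have "s_act a (s_act b f) = s_act b (s_act a f)"
    by (simp add: perm_act_comp)
  then show ?thesis
    unfolding div_diff_simple_def
    by (simp only: s_act_simps s_act_X ab commute_identity)
qed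

definition dd :: "idx list \<Rightarrow> mrat \<Rightarrow> mrat" where
  "dd as = foldr (\<lambda>a h. div_diff_simple a \<circ> h) as id"

lemma dd_simps [simp]: "dd [] f = f" "dd (a # as) f = D a (dd as f)"
  by (simp_all add: dd_def)

lemma dd_append [simp]: "dd (as @ bs) f = dd as (dd bs f)"
  by (induction as) simp_all

lemma dd_add: "dd as (f + g) = dd as f + dd as g"
  by (induction as) (simp_all add: D_add)

lemma dd_0 [simp]: "dd as 0 = 0"
  by (induction as) simp_all

lemma dd_mult_invariant:
  "(\<And>a. a \<in> set as \<Longrightarrow> s_act a r = r) \<Longrightarrow> dd as (r * f) = r * dd as f"
  by (induction as) (simp_all add: D_mult_invariant)

lemma dd_const_mult: "dd as (const c * f) = const c * dd as f"
  by (rule dd_mult_invariant) (simp add: s_act_simps)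

lemma dd_R [intro]: "set as \<subseteq> simple_idx lam \<Longrightarrow> f \<in> R lam \<Longrightarrow> dd as f \<in> R lam"
  by (induction as) auto

lemma split_fraction:
  fixes a b c :: "'a::field"
  assumes "a \<noteq> 0" "b \<noteq> 0" "c = b - a"
  shows "t / a - t / b = t / (a * b) * c"
  unfolding assms(3) using assms(1,2) by (simp add: diff_frac_eq algebra_simps)

lemma collect_fraction:
  fixes c d :: "'a::field"
  assumes "c \<noteq> 0" "d = - c"
  shows "(s * c + f / p - g / q) / c = s + f / (p * c) + g / (q * d)"
  using assms by (simp add: add_divide_distrib diff_divide_distrib)

text \<open>The sum over a row, whose single terms have poles along the diagonals, is an iterated divided
  difference of its first term. This is why the operators of the algebra preserve polynomials and why
  they act on functionals built from divided differences.\<close>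

lemma symmetrized_fraction_eq_dd:
  fixes i p m :: nat and F :: "nat \<Rightarrow> mrat"
  defines "x \<equiv> \<lambda>l. X (i, p + l)"
  assumes step: "\<And>j. j < m \<Longrightarrow> s_act (i, p + j) (F j) = F (Suc j)"
    and fixed: "\<And>j l. j < m \<Longrightarrow> l < j \<Longrightarrow> s_act (i, p + j) (F l) = F l"
  shows "(\<Sum>l\<le>m. F l / (\<Prod>l'\<in>{..m} - {l}. x l - x l')) = dd (rev (map (\<lambda>j. (i, p + j)) [0..<m])) (F 0)"
  using step fixed
proof (induction m)
  case 0
  then show ?case by simp
next
  case (Suc n)
  let ?s = "s_act (i, p + n)"
  have x: "?s (x l) = x l" if "l < n" for l
    using that by (simp add: x_def next_idx_def)
  have xn: "?s (x n) = x (Suc n)" by (simp add: x_def next_idx_def)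
  have ne: "x l - x l' \<noteq> 0" if "l \<noteq> l'" for l l' using that by (simp add: x_def X_inj)
  define T where "T l = F l / (\<Prod>l'\<in>{..<n} - {l}. x l - x l')" for l
  define P where "P l = (\<Prod>l'<n. x l - x l')" for l
  have sT: "?s (T l) = T l" if "l < n" for l
    unfolding T_def using that Suc.prems(2)[of n l] x by (simp add: s_act_simps)
  have sP: "?s (P n) = P (Suc n)"
    unfolding P_def using x xn by (simp add: s_act_simps)
  have S: "(\<Sum>l\<le>n. F l / (\<Prod>l'\<in>{..n} - {l}. x l - x l')) = (\<Sum>l<n. T l / (x l - x n)) + F n / P n"
  proof -
    have "{..n} - {l} = insert n ({..<n} - {l})" if "l < n" for l using that by auto
    moreover have "{..n} - {n} = {..<n}" by auto
    ultimately show ?thesis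
      by (simp add: lessThan_Suc_atMost[symmetric] T_def P_def mult_ac)
  qed
  have S': "(\<Sum>l\<le>Suc n. F l / (\<Prod>l'\<in>{..Suc n} - {l}. x l - x l'))
     = (\<Sum>l<n. T l / ((x l - x n) * (x l - x (Suc n)))) + F n / (P n * (x n - x (Suc n)))
       + F (Suc n) / (P (Suc n) * (x (Suc n) - x n))"
  proof -
    have "{..Suc n} - {l} = insert n (insert (Suc n) ({..<n} - {l}))" if "l < n" for l using that by auto
    moreover have "{..Suc n} - {n} = insert (Suc n) {..<n}" "{..Suc n} - {Suc n} = insert n {..<n}" by auto
    ultimately show ?thesis
      by (simp add: lessThan_Suc_atMost[symmetric] T_def P_def mult_ac)
  qed
  have split: "T l / (x l - x n) - T l / (x l - x (Suc n))
      = (T l / ((x l - x n) * (x l - x (Suc n)))) * (x n - x (Suc n))" if "l < n" for l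
  proof -
    have "x l - x n \<noteq> 0" "x l - x (Suc n) \<noteq> 0" by (rule ne; use that in simp)+
    then show ?thesis by (rule split_fraction) simp
  qed
  have nn: "x n - x (Suc n) \<noteq> 0" by (rule ne) simp
  have "D (i, p + n) (\<Sum>l\<le>n. F l / (\<Prod>l'\<in>{..n} - {l}. x l - x l'))
     = ((\<Sum>l<n. T l / (x l - x n)) + F n / P n - ((\<Sum>l<n. T l / (x l - x (Suc n))) + F (Suc n) / P (Suc n)))
       / (x n - x (Suc n))"
    unfolding S div_diff_simple_def using sT x xn sP Suc.prems(1)[of n]
    by (simp add: s_act_simps) (simp add: x_def next_idx_def)
  also have "\<dots> = ((\<Sum>l<n. T l / (x l - x n) - T l / (x l - x (Suc n))) + F n / P n - F (Suc n) / P (Suc n))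
       / (x n - x (Suc n))"
    by (simp add: sum_subtractf algebra_simps)
  also have "\<dots> = ((\<Sum>l<n. T l / ((x l - x n) * (x l - x (Suc n)))) * (x n - x (Suc n))
       + F n / P n - F (Suc n) / P (Suc n)) / (x n - x (Suc n))"
    by (simp add: split sum_distrib_right)
  also have "\<dots> = (\<Sum>l\<le>Suc n. F l / (\<Prod>l'\<in>{..Suc n} - {l}. x l - x l'))"
  proof -
    show ?thesis unfolding S' by (rule collect_fraction[OF nn]) simp
  qed
  finally show ?case using Suc by simp
qed


section \<open>Reduced words\<close>

lemma finite_I: "finite (I lam)"
proof (rule finite_subset)
  show "I lam \<subseteq> Sigma {..length lam} (\<lambda>i. {..lam ! (i - 1)})" by (auto simp: I_def)
qed auto

lemma idx_less_iff: "(a::idx) < b \<longleftrightarrow> fst a < fst b \<or> fst a = fst b \<and> snd a < snd b"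
  by (cases a; cases b) (auto simp: less_prod_def)

lemma G_D: 
  assumes "g \<in> G lam"
  shows "g permutes I lam" "bij g" "a \<in> I lam \<Longrightarrow> g a \<in> I lam" "a \<in> I lam \<Longrightarrow> fst (g a) = fst a"
    "a \<in> I lam \<Longrightarrow> inv g a \<in> I lam" "g (inv g a) = a" "inv g (g a) = a"
    "a \<in> I lam \<Longrightarrow> fst (inv g a) = fst a"
proof -
  show p: "g permutes I lam" using assms by (simp add: G_def)
  show b: "bij g" using p permutes_bij by blast
  show "a \<in> I lam \<Longrightarrow> g a \<in> I lam" using p by (simp add: permutes_in_image)
  show f: "a \<in> I lam \<Longrightarrow> fst (g a) = fst a" for a using assms by (auto simp: G_def)
  show i: "a \<in> I lam \<Longrightarrow> inv g a \<in> I lam" using permutes_inv[OF p] by (simp add: permutes_in_image)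
  show gi: "g (inv g a) = a" "inv g (g a) = a" using p by (simp_all add: permutes_inverses)
  show "a \<in> I lam \<Longrightarrow> fst (inv g a) = fst a" using f[of "inv g a"] i gi by simp
qed

lemma G_comp: "g \<in> G lam \<Longrightarrow> h \<in> G lam \<Longrightarrow> g \<circ> h \<in> G lam"
  by (auto simp: G_def intro: permutes_compose simp: permutes_in_image)

lemma G_id: "id \<in> G lam"
  by (simp add: G_def permutes_id)

lemma G_inv: "g \<in> G lam \<Longrightarrow> inv g \<in> G lam"
  unfolding G_def[of lam]
  by (intro CollectI conjI ballI) (auto intro: permutes_inv G_D(1) G_D(8) simp flip: G_def)

lemma finite_G: "finite (G lam)"
  by (rule finite_subset[OF _ finite_permutations[OF finite_I[of lam]]]) (auto simp: G_def)

lemma simple_refl_G: "a \<in> simple_idx lam \<Longrightarrow> simple_refl a \<in> G lam"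
  using simple_refl_permutes[of a lam]
  by (auto simp: G_def simple_refl_def transpose_def)

lemma word_perm_simps [simp]: "word_perm [] = id" "word_perm (a # as) = simple_refl a \<circ> word_perm as"
  by (simp_all add: word_perm_def)

lemma word_perm_G: "set as \<subseteq> simple_idx lam \<Longrightarrow> word_perm as \<in> G lam"
  by (induction as) (auto simp: G_id intro!: G_comp simple_refl_G)

definition inversions :: "nat list \<Rightarrow> (idx \<Rightarrow> idx) \<Rightarrow> (idx \<times> idx) set" where
  "inversions lam g = {(a, b). a \<in> I lam \<and> b \<in> I lam \<and> a < b \<and> g b < g a}"

lemma finite_inversions: "finite (inversions lam g)"
  by (rule finite_subset[OF _ finite_cartesian_product[OF finite_I finite_I]]) (auto simp: inversions_def)

definition left_descent :: "(idx \<Rightarrow> idx) \<Rightarrow> idx \<Rightarrow> bool" where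
  "left_descent g a \<longleftrightarrow> inv g (next_idx a) < inv g a"

lemma simple_refl_less_iff:
  assumes "c \<noteq> d" "\<not> (c = a \<and> d = next_idx a)" "\<not> (c = next_idx a \<and> d = a)"
  shows "simple_refl a c < simple_refl a d \<longleftrightarrow> c < d"
proof -
  have r: "simple_refl a e = (if e = a then next_idx a else if e = next_idx a then a else e)" for e
    by simp
  obtain i p j q k t where eq: "a = (i, p)" "c = (j, q)" "d = (k, t)" by (metis surj_pair)
  consider "c = a" "d \<noteq> a" "d \<noteq> next_idx a" | "c = next_idx a" "d \<noteq> a" "d \<noteq> next_idx a"
    | "d = a" "c \<noteq> a" "c \<noteq> next_idx a" | "d = next_idx a" "c \<noteq> a" "c \<noteq> next_idx a"
    | "c \<noteq> a" "c \<noteq> next_idx a" "d \<noteq> a" "d \<noteq> next_idx a"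
    using assms by blast
  then show ?thesis
    unfolding r by cases (simp_all add: next_idx_def eq, auto)
qed

text \<open>Composing with a simple reflection creates or removes exactly the inversion between the two
  exchanged values.\<close>

lemma card_inversions_step:
  assumes g: "g \<in> G lam" and a: "a \<in> simple_idx lam"
  shows "left_descent g a \<Longrightarrow> card (inversions lam g) = Suc (card (inversions lam (simple_refl a \<circ> g)))"
    and "\<not> left_descent g a \<Longrightarrow> card (inversions lam (simple_refl a \<circ> g)) = Suc (card (inversions lam g))"
proof -
  have aI: "a \<in> I lam" "next_idx a \<in> I lam" using a by (auto simp: simple_idx_def)
  have less: "a < next_idx a" by (simp add: idx_less_iff)
  let ?x = "inv g a" and ?y = "inv g (next_idx a)"
  have xy: "?x \<in> I lam" "?y \<in> I lam" "g ?x = a" "g ?y = next_idx a" "?x \<noteq> ?y"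
  proof -
    show x: "g ?x = a" and y: "g ?y = next_idx a" by (rule G_D(6)[OF g])+
    show "?x \<noteq> ?y" using x y next_idx_simps(3)[of a] by auto
  qed (rule G_D(5)[OF g], rule aI)+
  have eq: "c = ?x" if "g c = a" for c using that G_D(7)[OF g, of c] by simp
  have eq': "c = ?y" if "g c = next_idx a" for c using that G_D(7)[OF g, of c] by simp
  have same: "simple_refl a (g d) < simple_refl a (g c) \<longleftrightarrow> g d < g c"
    if "{c, d} \<noteq> {?x, ?y}" "c < d" for c d
  proof (rule simple_refl_less_iff)
    show "g d \<noteq> g c" using that G_D(7)[OF g, of c] G_D(7)[OF g, of d] by auto
    show "\<not> (g d = a \<and> g c = next_idx a)" using that(1) eq[of d] eq'[of c] by (auto simp: insert_commute)
    show "\<not> (g d = next_idx a \<and> g c = a)" using that(1) eq[of c] eq'[of d] by auto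
  qed
  { assume "left_descent g a"
    then have d: "?y < ?x" by (simp add: left_descent_def)
    have "inversions lam g = insert (?y, ?x) (inversions lam (simple_refl a \<circ> g))"
    proof (rule set_eqI, clarify)
      fix c d
      show "(c, d) \<in> inversions lam g \<longleftrightarrow> (c, d) \<in> insert (?y, ?x) (inversions lam (simple_refl a \<circ> g))"
      proof (cases "{c, d} = {?x, ?y}")
        case True
        then consider "c = ?x" "d = ?y" | "c = ?y" "d = ?x" by (auto simp: doubleton_eq_iff)
        then show ?thesis
          by cases (use d less_not_sym[OF d] xy less less_not_sym[OF less] in \<open>simp_all add: inversions_def\<close>)
      next
        case False
        then have "(c, d) \<noteq> (?y, ?x)" by auto
        then show ?thesis using same[OF False] by (auto simp: inversions_def)
      qed
    qed
    moreover have "(?y, ?x) \<notin> inversions lam (simple_refl a \<circ> g)"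
      using xy less by (auto simp: inversions_def)
    ultimately show "card (inversions lam g) = Suc (card (inversions lam (simple_refl a \<circ> g)))"
      by (simp add: finite_inversions) }
  { assume "\<not> left_descent g a"
    then have d: "?x < ?y" using xy(5) by (simp add: left_descent_def)
    have "inversions lam (simple_refl a \<circ> g) = insert (?x, ?y) (inversions lam g)"
    proof (rule set_eqI, clarify)
      fix c d
      show "(c, d) \<in> inversions lam (simple_refl a \<circ> g) \<longleftrightarrow> (c, d) \<in> insert (?x, ?y) (inversions lam g)"
      proof (cases "{c, d} = {?x, ?y}")
        case True
        then consider "c = ?x" "d = ?y" | "c = ?y" "d = ?x" by (auto simp: doubleton_eq_iff)
        then show ?thesis
          by cases (use d less_not_sym[OF d] xy less less_not_sym[OF less] in \<open>simp_all add: inversions_def\<close>)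
      next
        case False
        then have "(c, d) \<noteq> (?x, ?y)" by auto
        then show ?thesis using same[OF False] by (auto simp: inversions_def)
      qed
    qed
    moreover have "(?x, ?y) \<notin> inversions lam g"
      using xy less by (auto simp: inversions_def)
    ultimately show "card (inversions lam (simple_refl a \<circ> g)) = Suc (card (inversions lam g))"
      by (simp add: finite_inversions) }
qed

lemma card_inversions_id: "card (inversions lam id) = 0"
proof -
  have "inversions lam id = {}" by (auto simp: inversions_def)
  then show ?thesis by simp
qed

lemma card_inversions_le_length:
  "set as \<subseteq> simple_idx lam \<Longrightarrow> card (inversions lam (word_perm as)) \<le> length as"
proof (induction as)
  case (Cons a as)
  then have "word_perm as \<in> G lam" "a \<in> simple_idx lam" by (auto intro: word_perm_G)
  note step = card_inversions_step[OF this]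
  have "card (inversions lam (word_perm as)) \<le> length as" using Cons by simp
  then have "card (inversions lam (simple_refl a \<circ> word_perm as)) \<le> Suc (length as)"
    using step by linarith
  then show ?case by (simp only: word_perm_simps(2) length_Cons)
qed (simp add: card_inversions_id)

text \<open>Without descents the inverse increases along every row; an increasing self-map of a finite row is
  squeezed to the identity from both ends.\<close>

lemma no_left_descent_id:
  assumes g: "g \<in> G lam" and nd: "\<And>a. a \<in> simple_idx lam \<Longrightarrow> \<not> left_descent g a"
  shows "g = id"
proof -
  let ?h = "inv g"
  have mono: "snd (?h a) < snd (?h (next_idx a))" if "a \<in> simple_idx lam" for a
  proof -
    have aI: "a \<in> I lam" "next_idx a \<in> I lam" using that by (auto simp: simple_idx_def)
    have "?h a \<noteq> ?h (next_idx a)"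
      using G_D(6)[OF g, of a] G_D(6)[OF g, of "next_idx a"] next_idx_simps(3)[of a] by auto
    then have "?h a < ?h (next_idx a)" using nd[OF that] by (simp add: left_descent_def)
    then show ?thesis using G_D(8)[OF g] aI by (simp add: idx_less_iff)
  qed
  have up: "(i, Suc j) \<in> I lam \<Longrightarrow> snd (?h (i, Suc j)) \<ge> Suc j" for i j
  proof (induction j)
    case 0
    then show ?case using G_D(5)[OF g, of "(i, Suc 0)"] by (cases "?h (i, Suc 0)") (auto simp: I_def)
  next
    case (Suc j)
    then have "(i, Suc j) \<in> simple_idx lam" by (auto simp: simple_idx_def I_def next_idx_def)
    from mono[OF this] Suc show ?case by (force simp: I_def next_idx_def)
  qed
  have down: "(i, lam ! (i - 1) - t) \<in> I lam \<Longrightarrow> snd (?h (i, lam ! (i - 1) - t)) \<le> lam ! (i - 1) - t" for i t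
  proof (induction t)
    case 0
    then show ?case using G_D(5)[OF g, of "(i, lam ! (i - 1))"] G_D(8)[OF g, of "(i, lam ! (i - 1))"]
      by (cases "?h (i, lam ! (i - 1))") (auto simp: I_def)
  next
    case (Suc t)
    then have s: "(i, lam ! (i - 1) - Suc t) \<in> simple_idx lam" and eq: "Suc (lam ! (i - 1) - Suc t) = lam ! (i - 1) - t"
      by (auto simp: simple_idx_def I_def next_idx_def)
    then have "(i, lam ! (i - 1) - t) \<in> I lam" by (auto simp: simple_idx_def next_idx_def)
    from mono[OF s] Suc.IH[OF this] eq show ?case by (simp add: next_idx_def)
  qed
  have "?h a = a" if "a \<in> I lam" for a
  proof -
    obtain i k where ik: "a = (i, k)" by (cases a)
    moreover from this have "k \<noteq> 0" using that by (auto simp: I_def)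
    ultimately obtain j where a: "a = (i, Suc j)" by (cases k) auto
    have "Suc j \<le> lam ! (i - 1)" using that a by (simp add: I_def)
    then have "snd (?h a) = Suc j"
      using up[of i j] down[of i "lam ! (i - 1) - Suc j"] that a by simp
    moreover have "fst (?h a) = i" using G_D(8)[OF g that] a by simp
    ultimately have "?h a = (i, Suc j)" by (intro prod_eqI) simp_all
    then show ?thesis by (simp only: a)
  qed
  moreover have "?h a = a" if "a \<notin> I lam" for a
    using permutes_inv[OF G_D(1)[OF g]] that by (simp add: permutes_not_in)
  ultimately have "?h a = a" for a by blast
  then have "g a = a" for a using G_D(6)[OF g, of a] by simp
  then show ?thesis by (simp add: fun_eq_iff)
qed

text \<open>The words whose length is the number of inversions of their permutation are the reduced ones.\<close>

definition red_word :: "nat list \<Rightarrow> idx list \<Rightarrow> bool" where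
  "red_word lam as \<longleftrightarrow> set as \<subseteq> simple_idx lam \<and> length as = card (inversions lam (word_perm as))"

lemma red_word_ex:
  "g \<in> G lam \<Longrightarrow> \<exists>as. red_word lam as \<and> word_perm as = g"
proof (induction "card (inversions lam g)" arbitrary: g rule: less_induct)
  case less
  show ?case
  proof (cases "g = id")
    case True
    then show ?thesis by (intro exI[of _ "[]"]) (simp add: red_word_def card_inversions_id)
  next
    case False
    then obtain a where a: "a \<in> simple_idx lam" "left_descent g a"
      using no_left_descent_id less.prems by blast
    note step = card_inversions_step(1)[OF less.prems a]
    obtain as where as: "red_word lam as" "word_perm as = simple_refl a \<circ> g"
      using less.hyps[of "simple_refl a \<circ> g"] step G_comp[OF simple_refl_G[OF a(1)] less.prems] by auto
    have "word_perm (a # as) = g" using as by (simp add: o_assoc)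
    moreover from this have "red_word lam (a # as)" using as a step by (simp add: red_word_def)
    ultimately show ?thesis by blast
  qed
qed

lemma reduced_word_iff:
  "reduced_word lam w as \<longleftrightarrow> red_word lam as \<and> word_perm as = w"
proof
  assume r: "reduced_word lam w as"
  then have as: "set as \<subseteq> simple_idx lam" "word_perm as = w" by (auto simp: reduced_word_def)
  obtain bs where bs: "red_word lam bs" "word_perm bs = w" using red_word_ex[OF word_perm_G[OF as(1)]] as by blast
  have "length as \<le> length bs" using r bs unfolding reduced_word_def red_word_def by blast
  then show "red_word lam as \<and> word_perm as = w"
    using bs as card_inversions_le_length[OF as(1)] by (auto simp: red_word_def)
next
  assume "red_word lam as \<and> word_perm as = w"
  then show "reduced_word lam w as"
    unfolding red_word_def reduced_word_def
    using card_inversions_le_length[of _ lam] by metis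
qed

lemma red_word_Cons:
  assumes "red_word lam (a # as)"
  shows "a \<in> simple_idx lam" "red_word lam as" "left_descent (word_perm (a # as)) a"
    "simple_refl a \<circ> word_perm (a # as) = word_perm as"
proof -
  show a: "a \<in> simple_idx lam" and "simple_refl a \<circ> word_perm (a # as) = word_perm as"
    using assms by (auto simp: red_word_def o_assoc)
  have as: "set as \<subseteq> simple_idx lam" using assms by (simp add: red_word_def)
  note le = card_inversions_le_length[OF as]
  note step = card_inversions_step[OF word_perm_G[of "a # as" lam] a]
  have eq: "simple_refl a \<circ> word_perm (a # as) = word_perm as" by (simp add: o_assoc)
  show ld: "left_descent (word_perm (a # as)) a"
    using step(2) le assms as a unfolding eq by (auto simp: red_word_def)
  show "red_word lam as"
    using step(1)[OF _ ld] assms as a unfolding eq by (simp add: red_word_def)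
qed

lemma red_word_ConsI:
  assumes g: "g \<in> G lam" and a: "a \<in> simple_idx lam" "left_descent g a"
    and as: "red_word lam as" "word_perm as = simple_refl a \<circ> g"
  shows "red_word lam (a # as)" "word_perm (a # as) = g"
proof -
  show eq: "word_perm (a # as) = g" using as by (simp add: o_assoc)
  show "red_word lam (a # as)"
    using card_inversions_step(1)[OF g a] as a eq by (simp add: red_word_def)
qed

lemma left_descent_comp:
  "g \<in> G lam \<Longrightarrow> left_descent (simple_refl a \<circ> g) b
    \<longleftrightarrow> inv g (simple_refl a (next_idx b)) < inv g (simple_refl a b)"
  by (simp add: left_descent_def o_inv_distrib G_D(2))

text \<open>Matsumoto's argument: two reduced words of the same permutation that begin with different letters
  both can be replaced by words that begin with the two sides of the braid relation of these letters.\<close>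

lemma dd_reduced_unique:
  "red_word lam as \<Longrightarrow> red_word lam bs \<Longrightarrow> word_perm as = word_perm bs \<Longrightarrow> dd as = dd bs"
proof (induction "length as" arbitrary: as bs rule: less_induct)
  case less
  have len: "length as = length bs" using less.prems by (simp add: red_word_def)
  show ?case
  proof (cases as)
    case Nil
    then show ?thesis using len by simp
  next
    case as: (Cons a as')
    then obtain b bs' where bs: "bs = b # bs'" using len by (cases bs) auto
    define w where "w = word_perm as"
    have w: "w \<in> G lam" unfolding w_def using less.prems by (auto simp: red_word_def intro: word_perm_G)
    have ra: "a \<in> simple_idx lam" "red_word lam as'" "left_descent w a" "word_perm as' = simple_refl a \<circ> w"
      using red_word_Cons[of lam a as'] less.prems as unfolding w_def by auto
    have rb: "b \<in> simple_idx lam" "red_word lam bs'" "left_descent w b" "word_perm bs' = simple_refl b \<circ> w"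
      using red_word_Cons[of lam b bs'] less.prems bs unfolding w_def by auto
    have IHa: "dd as' = dd cs" if "red_word lam cs" "word_perm cs = simple_refl a \<circ> w" for cs
      using less.hyps[of as' cs] ra that as by simp
    have IHb: "dd bs' = dd cs" if "red_word lam cs" "word_perm cs = simple_refl b \<circ> w" for cs
      using less.hyps[of bs' cs] rb that bs len as by simp
    have wa: "simple_refl a \<circ> w \<in> G lam" and wb: "simple_refl b \<circ> w \<in> G lam"
      using w ra rb by (auto intro!: G_comp simple_refl_G)
    have braid: "dd as = dd bs" if n: "next_idx x = y" and
      xy: "x = a \<and> y = b \<or> x = b \<and> y = a" for x y
    proof -
      have sx: "x \<in> simple_idx lam" "left_descent w x" and sy: "y \<in> simple_idx lam" "left_descent w y"
        using xy ra rb by auto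
      have wx: "simple_refl x \<circ> w \<in> G lam" and wy: "simple_refl y \<circ> w \<in> G lam"
        using w sx sy by (auto intro!: G_comp simple_refl_G)
      define z where "z = next_idx y"
      have ne: "x \<noteq> y" "y \<noteq> z" "x \<noteq> z" "z \<noteq> x" by (auto simp: n[symmetric] z_def next_idx_def prod_eq_iff)
      have rx: "simple_refl x x = y" "simple_refl x y = x" "simple_refl x z = z"
        using ne n by auto
      have ry: "simple_refl y y = z" "simple_refl y z = y" "simple_refl y x = x"
        using ne z_def by auto
      have ord: "inv w z < inv w y" "inv w y < inv w x"
        using sx sy n by (auto simp: left_descent_def z_def)
      define u where "u = simple_refl x \<circ> (simple_refl y \<circ> (simple_refl x \<circ> w))"
      have perm: "simple_refl x \<circ> (simple_refl y \<circ> simple_refl x) = simple_refl y \<circ> (simple_refl x \<circ> simple_refl y)"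
      proof
        fix t show "(simple_refl x \<circ> (simple_refl y \<circ> simple_refl x)) t = (simple_refl y \<circ> (simple_refl x \<circ> simple_refl y)) t"
          using ne rx ry n z_def by (cases "t = x"; cases "t = y"; cases "t = z") auto
      qed
      have u': "u = simple_refl y \<circ> (simple_refl x \<circ> (simple_refl y \<circ> w))"
        using arg_cong[OF perm, of "\<lambda>h. h \<circ> w"] by (simp add: u_def o_assoc)
      have G1: "simple_refl y \<circ> (simple_refl x \<circ> w) \<in> G lam" "simple_refl x \<circ> (simple_refl y \<circ> w) \<in> G lam"
        using wx wy sx sy by (auto intro!: G_comp simple_refl_G)
      have "u \<in> G lam" unfolding u_def using G1 sx by (auto intro!: G_comp simple_refl_G)
      then obtain cs where cs: "red_word lam cs" "word_perm cs = u" using red_word_ex by blast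
      have d1: "left_descent (simple_refl x \<circ> w) y"
        unfolding left_descent_comp[OF w] using ord rx ne by (auto simp: z_def[symmetric])
      have d2: "left_descent (simple_refl y \<circ> (simple_refl x \<circ> w)) x"
        unfolding left_descent_comp[OF wx] using ord rx ry n w sx
        by (auto simp: o_inv_distrib G_D(2))
      have e1: "left_descent (simple_refl y \<circ> w) x"
        unfolding left_descent_comp[OF w] using ord ry ne n by auto
      have e2: "left_descent (simple_refl x \<circ> (simple_refl y \<circ> w)) y"
        unfolding left_descent_comp[OF wy] using ord rx ry n w
        by (auto simp: o_inv_distrib G_D(2) z_def[symmetric])
      have r1: "red_word lam (x # cs)" "word_perm (x # cs) = simple_refl y \<circ> (simple_refl x \<circ> w)"
        by (rule red_word_ConsI[OF G1(1) sx(1) d2 cs(1)]; simp add: cs u_def)+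
      have r2: "red_word lam (y # x # cs)" "word_perm (y # x # cs) = simple_refl x \<circ> w"
        by (rule red_word_ConsI[OF wx sy(1) d1 r1(1)]; use r1 in simp)+
      have q1: "red_word lam (y # cs)" "word_perm (y # cs) = simple_refl x \<circ> (simple_refl y \<circ> w)"
        by (rule red_word_ConsI[OF G1(2) sy(1) e2 cs(1)]; simp add: cs u')+
      have q2: "red_word lam (x # y # cs)" "word_perm (x # y # cs) = simple_refl y \<circ> w"
        by (rule red_word_ConsI[OF wy sx(1) e1 q1(1)]; use q1 in simp)+
      have "dd (x # y # x # cs) = dd (y # x # y # cs)"
        by (rule ext) (simp add: D_braid[OF n[symmetric]])
      moreover have "dd as = dd (a # as')" "dd bs = dd (b # bs')" by (simp_all add: as bs)
      moreover have "dd (a # as') = dd (x # y # x # cs) \<and> dd (b # bs') = dd (y # x # y # cs)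
          \<or> dd (a # as') = dd (y # x # y # cs) \<and> dd (b # bs') = dd (x # y # x # cs)"
        using xy IHa IHb r2 q2 by (auto simp: fun_eq_iff)
      ultimately show ?thesis by auto
    qed
    consider "a = b" | "next_idx a = b" | "next_idx b = a"
      | "a \<noteq> b" "next_idx a \<noteq> b" "next_idx b \<noteq> a" by blast
    then show ?thesis
    proof cases
      case 1
      then have "dd as' = dd bs'" using IHa[OF rb(2)] rb by simp
      then show ?thesis using as bs 1 by (simp add: fun_eq_iff)
    next
      case 2
      then show ?thesis by (rule braid) simp
    next
      case 3
      then show ?thesis by (rule braid) simp
    next
      case 4
      have ab: "simple_refl a b = b" "simple_refl a (next_idx b) = next_idx b"
        "simple_refl b a = a" "simple_refl b (next_idx a) = next_idx a"
        using 4 by auto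
      define u where "u = simple_refl a \<circ> (simple_refl b \<circ> w)"
      have u': "u = simple_refl b \<circ> (simple_refl a \<circ> w)"
      proof
        fix t
        show "u t = (simple_refl b \<circ> (simple_refl a \<circ> w)) t"
          using ab by (cases "w t = a"; cases "w t = next_idx a"; cases "w t = b"; cases "w t = next_idx b")
            (auto simp: u_def)
      qed
      have "u \<in> G lam" unfolding u_def using wb ra by (auto intro!: G_comp simple_refl_G)
      then obtain cs where cs: "red_word lam cs" "word_perm cs = u" using red_word_ex by blast
      have d: "left_descent (simple_refl a \<circ> w) b" "left_descent (simple_refl b \<circ> w) a"
        unfolding left_descent_comp[OF w] using ra rb ab by (auto simp: left_descent_def)
      have r: "red_word lam (b # cs)" "word_perm (b # cs) = simple_refl a \<circ> w"
        by (rule red_word_ConsI[OF wa rb(1) d(1) cs(1)]; simp add: cs u')+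
      have q: "red_word lam (a # cs)" "word_perm (a # cs) = simple_refl b \<circ> w"
        by (rule red_word_ConsI[OF wb ra(1) d(2) cs(1)]; simp add: cs u_def)+
      show ?thesis using IHa[OF r] IHb[OF q] as bs D_commute[OF 4] by (simp add: fun_eq_iff)
    qed
  qed
qed

text \<open>Where a word first fails to be reduced (read from the right), its next letter is a descent of the
  reduced word behind it, which may be rewritten to begin with that letter; and \<open>D a \<circ> D a\<close> vanishes.\<close>

lemma dd_nonreduced:
  "set as \<subseteq> simple_idx lam \<Longrightarrow> \<not> red_word lam as \<Longrightarrow> dd as f = 0"
proof (induction as)
  case Nil
  then show ?case by (simp add: red_word_def card_inversions_id)
next
  case (Cons a as)
  show ?case
  proof (cases "red_word lam as")
    case False
    then show ?thesis using Cons by simp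
  next
    case True
    have a: "a \<in> simple_idx lam" and w: "word_perm as \<in> G lam" using Cons by (auto intro: word_perm_G)
    have d: "left_descent (word_perm as) a"
      using card_inversions_step(2)[OF w a] Cons.prems True by (auto simp: red_word_def)
    obtain cs where cs: "red_word lam cs" "word_perm cs = simple_refl a \<circ> word_perm as"
      using red_word_ex G_comp[OF simple_refl_G[OF a] w] by blast
    have "dd as = dd (a # cs)"
      using red_word_ConsI[OF w a d cs] by (intro dd_reduced_unique[OF True]) auto
    then show ?thesis by simp
  qed
qed

lemma div_diff_eq_dd:
  assumes "red_word lam as" shows "div_diff lam (word_perm as) = dd as"
proof -
  have "reduced_word lam (word_perm as) as" using assms by (simp add: reduced_word_iff)
  then have "reduced_word lam (word_perm as) (SOME bs. reduced_word lam (word_perm as) bs)"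
    by (rule someI)
  then have "dd (SOME bs. reduced_word lam (word_perm as) bs) = dd as"
    using assms by (intro dd_reduced_unique) (auto simp: reduced_word_iff)
  then show ?thesis by (simp add: div_diff_def dd_def)
qed


section \<open>Symmetric polynomials and the algebra\<close>

lemma RG_R: "f \<in> RG lam \<Longrightarrow> f \<in> R lam"
  by (simp add: RG_def)

lemma RG_perm: "f \<in> RG lam \<Longrightarrow> g \<in> G lam \<Longrightarrow> perm_act g f = f"
  by (simp add: RG_def)

lemma RG_I: "f \<in> R lam \<Longrightarrow> (\<And>g. g \<in> G lam \<Longrightarrow> perm_act g f = f) \<Longrightarrow> f \<in> RG lam"
  by (simp add: RG_def)

lemma RG_const [intro, simp]: "const c \<in> RG lam"
  by (rule RG_I) (simp_all add: perm_act_simps[OF G_D(2)])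

lemma RG_0 [simp]: "0 \<in> RG lam" and RG_1 [simp]: "1 \<in> RG lam"
  using RG_const[of 0 lam] RG_const[of 1 lam] by (simp_all add: const_simps)

lemma RG_add [intro]: "f \<in> RG lam \<Longrightarrow> g \<in> RG lam \<Longrightarrow> f + g \<in> RG lam"
  by (rule RG_I) (auto simp: perm_act_simps[OF G_D(2)] RG_perm RG_R)

lemma RG_mult [intro]: "f \<in> RG lam \<Longrightarrow> g \<in> RG lam \<Longrightarrow> f * g \<in> RG lam"
  by (rule RG_I) (auto simp: perm_act_simps[OF G_D(2)] RG_perm RG_R)

lemma row_subset: "row lam i \<subseteq> I lam"
  by (auto simp: row_def)

lemma finite_row [simp]: "finite (row lam i)"
  by (rule finite_subset[OF row_subset finite_I])

lemma G_row: "g \<in> G lam \<Longrightarrow> g ` row lam i = row lam i"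
proof (rule set_eqI)
  fix a assume g: "g \<in> G lam"
  show "a \<in> g ` row lam i \<longleftrightarrow> a \<in> row lam i"
  proof
    assume "a \<in> row lam i"
    then have "inv g a \<in> row lam i" using G_D(5,8)[OF g, of a] by (auto simp: row_def)
    then show "a \<in> g ` row lam i" using G_D(6)[OF g, of a] by (auto intro: image_eqI[of _ _ "inv g a"])
  next
    assume "a \<in> g ` row lam i"
    then show "a \<in> row lam i" using G_D(3,4)[OF g] by (auto simp: row_def)
  qed
qed

lemma G_bij_row: "g \<in> G lam \<Longrightarrow> bij_betw g (row lam i) (row lam i)"
  unfolding bij_betw_def by (intro conjI G_row inj_on_subset[OF bij_is_inj[OF G_D(2)]]) auto

lemma G_sum_row: "g \<in> G lam \<Longrightarrow> (\<Sum>b\<in>row lam i. h (g b)) = (\<Sum>b\<in>row lam i. h b)"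
  by (rule sum.reindex_bij_betw[OF G_bij_row])

lemma G_prod_row: "g \<in> G lam \<Longrightarrow> (\<Prod>b\<in>row lam i. h (g b)) = (\<Prod>b\<in>row lam i. h b)"
  by (rule prod.reindex_bij_betw[OF G_bij_row])

lemma row_sum_RG:
  assumes R: "\<And>b. b \<in> row lam i \<Longrightarrow> h b \<in> R lam"
    and sym: "\<And>g b. g \<in> G lam \<Longrightarrow> b \<in> row lam i \<Longrightarrow> perm_act g (h b) = h (g b)"
  shows "(\<Sum>b\<in>row lam i. h b) \<in> RG lam"
proof (rule RG_I)
  show "(\<Sum>b\<in>row lam i. h b) \<in> R lam" using R by auto
next
  fix g assume g: "g \<in> G lam"
  have "perm_act g (\<Sum>b\<in>row lam i. h b) = (\<Sum>b\<in>row lam i. h (g b))"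
    by (simp add: perm_act_simps[OF G_D(2)[OF g]] sym[OF g])
  then show "perm_act g (\<Sum>b\<in>row lam i. h b) = (\<Sum>b\<in>row lam i. h b)"
    by (simp add: G_sum_row[OF g])
qed

definition mulop :: "nat list \<Rightarrow> mrat \<Rightarrow> mrat \<Rightarrow> mrat" where
  "mulop lam q = on_set (Omega lam) (\<lambda>f. q * f)"

text \<open>The polynomials whose multiplication operators lie in the algebra form a ring. It contains the
  elementary symmetric polynomials of the rows; the aim is that it contains all invariants.\<close>

definition symalg :: "nat list \<Rightarrow> mrat set" where
  "symalg lam = {q \<in> R lam. mulop lam q \<in> U lam}"

lemma symalg_const: "const c \<in> symalg lam"
proof -
  have "(\<lambda>f. const c * on_set (Omega lam) id f) \<in> U lam" by (intro U_scale U_one)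
  moreover have "(\<lambda>f. const c * on_set (Omega lam) id f) = mulop lam (const c)"
    by (auto simp: mulop_def on_set_def)
  ultimately show ?thesis by (simp add: symalg_def)
qed

lemma symalg_add:
  assumes "p \<in> symalg lam" "q \<in> symalg lam" shows "p + q \<in> symalg lam"
proof -
  have "(\<lambda>f. mulop lam p f + mulop lam q f) \<in> U lam" using assms by (auto simp: symalg_def intro: U_add)
  moreover have "(\<lambda>f. mulop lam p f + mulop lam q f) = mulop lam (p + q)"
    by (auto simp: mulop_def on_set_def distrib_right)
  ultimately show ?thesis using assms by (auto simp: symalg_def)
qed

lemma symalg_mult:
  assumes "p \<in> symalg lam" "q \<in> symalg lam" shows "p * q \<in> symalg lam"
proof -
  have "mulop lam p \<circ> mulop lam q \<in> U lam" using assms by (auto simp: symalg_def intro: U_mult)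
  moreover have "mulop lam p \<circ> mulop lam q = mulop lam (p * q)"
    using assms by (auto simp: mulop_def on_set_def symalg_def Omega_mult_R)
  ultimately show ?thesis using assms by (auto simp: symalg_def)
qed

lemma symalg_0: "0 \<in> symalg lam" and symalg_1: "1 \<in> symalg lam"
  using symalg_const[of 0 lam] symalg_const[of 1 lam] by (simp_all add: const_simps)

lemma symalg_diff: "p \<in> symalg lam \<Longrightarrow> q \<in> symalg lam \<Longrightarrow> p - q \<in> symalg lam"
  using symalg_add[of p lam "const (-1) * q"] symalg_mult[OF symalg_const[of "-1" lam], of q]
  by (simp add: const_simps)

lemma symalg_sum: "(\<And>a. a \<in> A \<Longrightarrow> f a \<in> symalg lam) \<Longrightarrow> sum f A \<in> symalg lam"
  by (induction A rule: infinite_finite_induct) (auto intro: symalg_0 symalg_add)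

lemma elem_sym_0: "finite A \<Longrightarrow> elem_sym 0 A = 1"
proof -
  assume "finite A"
  then have "{S. S \<subseteq> A \<and> card S = 0} = {{}}"
    using finite_subset[of _ A] by (intro set_eqI) (force simp: card_eq_0_iff)
  then show ?thesis by (simp add: elem_sym_def)
qed

lemma elem_sym_large: "finite A \<Longrightarrow> card A < j \<Longrightarrow> elem_sym j A = 0"
proof -
  assume "finite A" "card A < j"
  then have "{S. S \<subseteq> A \<and> card S = j} = {}" using card_mono[of A] by (auto simp flip: not_le)
  then show ?thesis unfolding elem_sym_def by (simp only: sum.empty)
qed

lemma elem_sym_Suc:
  assumes "finite A" "a \<in> A"
  shows "elem_sym (Suc j) A = elem_sym (Suc j) (A - {a}) + X a * elem_sym j (A - {a})"
proof -
  let ?T = "{S. S \<subseteq> A - {a} \<and> card S = j}"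
  have fin: "finite {S. S \<subseteq> B \<and> card S = k}" if "finite B" for B :: "idx set" and k
    using that by (rule finite_subset[rotated, OF finite_Pow_iff[THEN iffD2]]) auto
  have split: "{S. S \<subseteq> A \<and> card S = Suc j} = {S. S \<subseteq> A - {a} \<and> card S = Suc j} \<union> insert a ` ?T"
  proof (intro set_eqI iffI)
    fix S assume S: "S \<in> {S. S \<subseteq> A \<and> card S = Suc j}"
    then have fS: "finite S" using assms finite_subset by auto
    show "S \<in> {S. S \<subseteq> A - {a} \<and> card S = Suc j} \<union> insert a ` ?T"
    proof (cases "a \<in> S")
      case True
      then have "S = insert a (S - {a})" "S - {a} \<in> ?T" using S fS by (auto simp: card_Diff_singleton)
      then show ?thesis by blast
    qed (use S in auto)
  next
    fix S assume "S \<in> {S. S \<subseteq> A - {a} \<and> card S = Suc j} \<union> insert a ` ?T"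
    then show "S \<in> {S. S \<subseteq> A \<and> card S = Suc j}"
    proof
      assume "S \<in> insert a ` ?T"
      then obtain T where T: "S = insert a T" "T \<subseteq> A - {a}" "card T = j" by auto
      then have "finite T" "a \<notin> T" using assms finite_subset by auto
      then show ?thesis using T assms by auto
    qed auto
  qed
  have "elem_sym (Suc j) A = elem_sym (Suc j) (A - {a}) + (\<Sum>S\<in>insert a ` ?T. \<Prod>b\<in>S. X b)"
    unfolding elem_sym_def split by (rule sum.union_disjoint) (auto simp: fin assms)
  also have "(\<Sum>S\<in>insert a ` ?T. \<Prod>b\<in>S. X b) = (\<Sum>S\<in>?T. \<Prod>b\<in>insert a S. X b)"
    by (rule sum.reindex[unfolded comp_def]) (auto simp: inj_on_def)
  also have "\<dots> = (\<Sum>S\<in>?T. X a * (\<Prod>b\<in>S. X b))"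
  proof (rule sum.cong[OF refl])
    fix S assume "S \<in> ?T"
    then have "finite S" "a \<notin> S" using assms finite_subset by auto
    then show "(\<Prod>b\<in>insert a S. X b) = X a * (\<Prod>b\<in>S. X b)" by simp
  qed
  finally show ?thesis by (simp add: elem_sym_def sum_distrib_left)
qed

text \<open>Every subset with \<open>j + 1\<close> elements arises once for each of its elements.\<close>

lemma elem_sym_euler:
  assumes "finite A"
  shows "(\<Sum>a\<in>A. X a * elem_sym j (A - {a})) = const (of_nat (Suc j)) * elem_sym (Suc j) A"
proof -
  let ?T = "\<lambda>B. {S. S \<subseteq> B \<and> card S = Suc j}"
  have fin: "finite (?T B)" if "finite B" for B :: "idx set"
    using that by (rule finite_subset[rotated, OF finite_Pow_iff[THEN iffD2]]) auto
  have "(\<Sum>a\<in>A. X a * elem_sym j (A - {a})) = (\<Sum>a\<in>A. \<Sum>S\<in>?T A. if a \<in> S then \<Prod>b\<in>S. X b else 0)"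
  proof (rule sum.cong[OF refl])
    fix a assume a: "a \<in> A"
    have "X a * elem_sym j (A - {a}) = elem_sym (Suc j) A - elem_sym (Suc j) (A - {a})"
      by (simp add: elem_sym_Suc[OF assms a, of j])
    also have "\<dots> = (\<Sum>S\<in>?T A - ?T (A - {a}). \<Prod>b\<in>S. X b)"
      unfolding elem_sym_def by (rule sum_diff[symmetric]) (auto simp: fin assms)
    also have "\<dots> = (\<Sum>S\<in>?T A. if a \<in> S then \<Prod>b\<in>S. X b else 0)"
      by (rule sum.mono_neutral_cong_left) (auto simp: fin assms)
    finally show "X a * elem_sym j (A - {a}) = (\<Sum>S\<in>?T A. if a \<in> S then \<Prod>b\<in>S. X b else 0)" .
  qed
  also have "\<dots> = (\<Sum>S\<in>?T A. \<Sum>a\<in>A. if a \<in> S then \<Prod>b\<in>S. X b else 0)"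
    by (rule sum.swap)
  also have "\<dots> = (\<Sum>S\<in>?T A. const (of_nat (Suc j)) * (\<Prod>b\<in>S. X b))"
  proof (rule sum.cong[OF refl])
    fix S assume S: "S \<in> ?T A"
    have of_nat: "const (of_nat n) = of_nat n" for n
      by (induction n) (simp_all add: const_simps)
    have "(\<Sum>a\<in>A. if a \<in> S then \<Prod>b\<in>S. X b else 0) = (\<Sum>a\<in>S. \<Prod>b\<in>S. X b)"
      using S assms by (intro sum.mono_neutral_cong_right) auto
    then show "(\<Sum>a\<in>A. if a \<in> S then \<Prod>b\<in>S. X b else 0) = const (of_nat (Suc j)) * (\<Prod>b\<in>S. X b)"
      using S unfolding of_nat by simp
  qed
  finally show ?thesis by (simp add: elem_sym_def sum_distrib_left)
qed

lemma card_row: "1 \<le> i \<Longrightarrow> i \<le> length lam \<Longrightarrow> card (row lam i) = lam ! (i - 1)"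
proof -
  assume i: "1 \<le> i" "i \<le> length lam"
  have "row lam i = (\<lambda>j. (i, j)) ` {1..lam ! (i - 1)}" using i by (auto simp: row_def I_def)
  then show ?thesis by (simp add: card_image inj_on_def)
qed

lemma symalg_elem_sym: "elem_sym j (row lam i) \<in> symalg lam"
proof -
  consider "j = 0" | "card (row lam i) < j" | "0 < j" "j \<le> card (row lam i)" by linarith
  then show ?thesis
  proof cases
    case 3
    then have "row lam i \<noteq> {}" by auto
    then have i: "1 \<le> i" "i \<le> length lam" by (auto simp: row_def I_def)
    then have "(i, j) \<in> I lam" using 3 by (auto simp: card_row I_def)
    then have "gamma_op lam (i, j) \<in> U lam" by (rule U_gamma)
    moreover have "elem_sym j (row lam i) \<in> R lam"
      unfolding elem_sym_def using row_subset by (intro R_sum R_prod R_X) auto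
    ultimately show ?thesis by (simp add: symalg_def mulop_def gamma_op_def)
  qed (simp_all add: elem_sym_0 elem_sym_large symalg_0 symalg_1)
qed

text \<open>Newton's identities, in the form of a recursion for the mixed sums that interpolate between power
  sums and elementary symmetric polynomials.\<close>

lemma symalg_mixed_sum:
  "(\<Sum>a\<in>row lam i. X a ^ Suc s * elem_sym j (row lam i - {a})) \<in> symalg lam"
proof (induction s arbitrary: j)
  case 0
  show ?case
    using symalg_mult[OF symalg_const symalg_elem_sym] by (simp add: elem_sym_euler)
next
  case (Suc s)
  let ?A = "row lam i"
  have p: "(\<Sum>a\<in>?A. X a ^ Suc s) \<in> symalg lam" using Suc[of 0] by (simp add: elem_sym_0)
  have "(\<Sum>a\<in>?A. X a ^ Suc (Suc s) * elem_sym j (?A - {a}))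
      = (\<Sum>a\<in>?A. X a ^ Suc s * (elem_sym (Suc j) ?A - elem_sym (Suc j) (?A - {a})))"
    by (intro sum.cong refl) (simp add: elem_sym_Suc[of ?A _ j] mult_ac)
  also have "\<dots> = (\<Sum>a\<in>?A. X a ^ Suc s) * elem_sym (Suc j) ?A - (\<Sum>a\<in>?A. X a ^ Suc s * elem_sym (Suc j) (?A - {a}))"
    by (simp add: right_diff_distrib sum_subtractf sum_distrib_right)
  finally show ?case
    using symalg_diff[OF symalg_mult[OF p symalg_elem_sym[of "Suc j" lam i]] Suc[of "Suc j"]] by simp
qed

lemma symalg_power_sum: "(\<Sum>a\<in>row lam i. X a ^ s) \<in> symalg lam"
proof (cases s)
  case 0
  then show ?thesis by (auto intro!: symalg_sum symalg_1 simp del: sum_constant)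
next
  case (Suc t)
  then show ?thesis using symalg_mixed_sum[where s = t and j = 0] by (simp add: elem_sym_0)
qed

text \<open>Multiplying the orbit sum of a monomial by a power sum adds a variable to the monomial or raises the
  exponent of one that is present; so orbit sums are built from power sums by induction on the number of
  variables.\<close>

lemma symalg_orbit_sum:
  assumes "finite T" "T \<subseteq> I lam"
  shows "(\<Sum>g\<in>G lam. perm_act g (\<Prod>a\<in>T. X a ^ k a)) \<in> symalg lam"
  using assms
proof (induction T arbitrary: k)
  case empty
  then show ?case
    by (auto intro!: symalg_sum simp: perm_act_simps[OF G_D(2)] symalg_1 simp del: sum_constant)
next
  case (insert a T)
  let ?sym = "\<lambda>m. \<Sum>g\<in>G lam. perm_act g m"
  let ?A = "row lam (fst a)"
  define m where "m = (\<Prod>b\<in>T. X b ^ k b)"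
  have aA: "a \<in> ?A" using insert by (simp add: row_def)
  have target: "(\<Prod>b\<in>insert a T. X b ^ k b) = m * X a ^ k a"
    using insert by (simp add: m_def mult.commute)
  have old: "?sym (m * X b ^ k a) \<in> symalg lam" if b: "b \<in> T" for b
  proof -
    have "(\<Prod>c\<in>T. X c ^ (k(b := k b + k a)) c) = X b ^ (k b + k a) * (\<Prod>c\<in>T - {b}. X c ^ k c)"
      using prod.remove[OF insert.hyps(1) b, of "\<lambda>c. X c ^ (k(b := k b + k a)) c"] by simp
    moreover have "m = X b ^ k b * (\<Prod>c\<in>T - {b}. X c ^ k c)"
      unfolding m_def by (rule prod.remove[OF insert.hyps(1) b])
    ultimately have "m * X b ^ k a = (\<Prod>c\<in>T. X c ^ (k(b := k b + k a)) c)"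
      by (simp add: power_add mult_ac)
    then show ?thesis using insert.IH[of "k(b := k b + k a)"] insert.prems by simp
  qed
  have new: "?sym (m * X b ^ k a) = ?sym (m * X a ^ k a)" if b: "b \<in> ?A - T" for b
  proof -
    define h where "h = Transposition.transpose a b"
    have ab: "a \<in> I lam" "b \<in> I lam" "fst a = fst b" using b insert.prems by (auto simp: row_def)
    then have h: "h \<in> G lam"
      by (auto simp: G_def h_def transpose_def intro!: permutes_swap_id[unfolded h_def])
    have hm: "perm_act h (m * X a ^ k a) = m * X b ^ k a"
    proof -
      have "h c = c" if "c \<in> T" for c using that insert.hyps b by (auto simp: h_def transpose_def)
      then have "perm_act h m = m"
        unfolding m_def by (simp add: perm_act_simps[OF G_D(2)[OF h]] perm_act_X[OF G_D(2)[OF h]])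
      moreover have "h a = b" by (simp add: h_def)
      ultimately show ?thesis
        by (simp add: perm_act_simps[OF G_D(2)[OF h]] perm_act_X[OF G_D(2)[OF h]])
    qed
    have "?sym (m * X b ^ k a) = (\<Sum>g\<in>G lam. perm_act (g \<circ> h) (m * X a ^ k a))"
      unfolding hm[symmetric] by (intro sum.cong refl) (simp add: perm_act_comp G_D(2)[OF h] G_D(2))
    also have "\<dots> = ?sym (m * X a ^ k a)"
    proof (rule sum.reindex_bij_betw)
      have hh: "h \<circ> h = id" by (simp add: h_def)
      show "bij_betw (\<lambda>g. g \<circ> h) (G lam) (G lam)"
        by (rule bij_betw_byWitness[where f' = "\<lambda>g. g \<circ> h"]) (auto simp: G_comp h hh comp_assoc)
    qed
    finally show ?thesis .
  qed
  have inv: "perm_act g (\<Sum>b\<in>?A. X b ^ k a) = (\<Sum>b\<in>?A. X b ^ k a)" if g: "g \<in> G lam" for g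
    using G_sum_row[OF g, of "\<lambda>b. X b ^ k a" "fst a"]
    by (simp add: perm_act_simps[OF G_D(2)[OF g]] perm_act_X[OF G_D(2)[OF g]])
  have "?sym m * (\<Sum>b\<in>?A. X b ^ k a) = ?sym (m * (\<Sum>b\<in>?A. X b ^ k a))"
    by (simp add: sum_distrib_right perm_act_simps(3)[OF G_D(2)] inv)
  also have "\<dots> = (\<Sum>b\<in>?A. ?sym (m * X b ^ k a))"
    by (simp add: sum_distrib_left perm_act_simps(6)[OF G_D(2)] sum.swap[of _ "G lam"])
  also have "\<dots> = (\<Sum>b\<in>?A \<inter> T. ?sym (m * X b ^ k a)) + (\<Sum>b\<in>?A - T. ?sym (m * X b ^ k a))"
    by (rule sum.Int_Diff) simp
  also have "(\<Sum>b\<in>?A - T. ?sym (m * X b ^ k a)) = const (of_nat (card (?A - T))) * ?sym (m * X a ^ k a)"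
  proof -
    have of_nat: "const (of_nat n) = of_nat n" for n
      by (induction n) (simp_all add: const_simps)
    show ?thesis by (simp add: new of_nat)
  qed
  finally have eq: "const (of_nat (card (?A - T))) * ?sym (m * X a ^ k a)
      = ?sym m * (\<Sum>b\<in>?A. X b ^ k a) - (\<Sum>b\<in>?A \<inter> T. ?sym (m * X b ^ k a))"
    by (simp add: algebra_simps)
  have "?sym m \<in> symalg lam" unfolding m_def using insert by auto
  then have "?sym m * (\<Sum>b\<in>?A. X b ^ k a) \<in> symalg lam"
    by (rule symalg_mult[OF _ symalg_power_sum])
  moreover have "(\<Sum>b\<in>?A \<inter> T. ?sym (m * X b ^ k a)) \<in> symalg lam"
    by (rule symalg_sum, rule old) simp
  ultimately have "const (of_nat (card (?A - T))) * ?sym (m * X a ^ k a) \<in> symalg lam"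
    unfolding eq by (rule symalg_diff)
  then have A: "const (1 / of_nat (card (?A - T))) * (const (of_nat (card (?A - T))) * ?sym (m * X a ^ k a)) \<in> symalg lam"
    by (rule symalg_mult[OF symalg_const])
  have "card (?A - T) \<noteq> 0" using aA insert.hyps by auto
  then have E: "const (1 / of_nat (card (?A - T))) * (const (of_nat (card (?A - T))) * f) = f" for f
    by (simp add: mult.assoc[symmetric] const_simps(1) flip: const_simps(3))
  from A show ?case unfolding E target .
qed

text \<open>An invariant is the average of its orbit, hence a combination of orbit sums of monomials.\<close>

theorem mulop_RG:
  assumes f: "f \<in> RG lam" shows "mulop lam f \<in> U lam"
proof -
  obtain p where p: "p \<in> polys lam" and fp: "f = mpoly_eval const X p"
    using RG_R[OF f] by (auto simp: R_emb emb_eval)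
  let ?n = "of_nat (card (G lam)) :: complex"
  let ?M = "\<lambda>m. \<Prod>a\<in>Poly_Mapping.keys m. X a ^ Poly_Mapping.lookup m a"
  have of_nat: "const (of_nat n) = of_nat n" for n
    by (induction n) (simp_all add: const_simps)
  have "const ?n * f = (\<Sum>g\<in>G lam. perm_act g f)"
    by (simp add: RG_perm[OF f] of_nat)
  also have "\<dots> = (\<Sum>g\<in>G lam. \<Sum>m\<in>Poly_Mapping.keys p. const (Poly_Mapping.lookup p m) * perm_act g (?M m))"
    unfolding fp mpoly_eval_def
    by (intro sum.cong refl) (simp only: perm_act_simps(6,3,10)[OF G_D(2)])
  also have "\<dots> = (\<Sum>m\<in>Poly_Mapping.keys p. const (Poly_Mapping.lookup p m) * (\<Sum>g\<in>G lam. perm_act g (?M m)))"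
    by (simp add: sum.swap[of _ "G lam"] sum_distrib_left)
  also have "\<dots> \<in> symalg lam"
    by (intro symalg_sum symalg_mult symalg_const symalg_orbit_sum) (use p in \<open>auto simp: polys_def\<close>)
  finally have A: "const (1 / ?n) * (const ?n * f) \<in> symalg lam"
    by (rule symalg_mult[OF symalg_const])
  have "card (G lam) \<noteq> 0" using G_id[of lam] finite_G[of lam] by auto
  then have E: "const (1 / ?n) * (const ?n * f) = f"
    by (simp add: mult.assoc[symmetric] const_simps(1) flip: const_simps(3))
  from A have "f \<in> symalg lam" unfolding E .
  then show ?thesis by (simp add: symalg_def)
qed

definition delta :: "idx \<Rightarrow> int \<Rightarrow> idx \<Rightarrow> int" where
  "delta c s = (\<lambda>b. if b = c then s else 0)"

definition gz_num :: "nat list \<Rightarrow> nat \<Rightarrow> int \<Rightarrow> mrat \<Rightarrow> idx \<Rightarrow> mrat" where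
  "gz_num lam i' s f c = (\<Prod>a\<in>row lam i'. X c - X a) * shift (delta c s) f"

text \<open>The operators \<open>E_op\<close> (with \<open>i' = i + 1\<close>, \<open>s = 1\<close>) and \<open>F_op\<close> (with \<open>i' = i - 1\<close>, \<open>s = - 1\<close>) have one common
  form, which lets them be treated together.\<close>

definition gz_op :: "nat list \<Rightarrow> nat \<Rightarrow> nat \<Rightarrow> int \<Rightarrow> mrat \<Rightarrow> mrat" where
  "gz_op lam i i' s f = (\<Sum>c\<in>row lam i. gz_num lam i' s f c / (\<Prod>b\<in>row lam i - {c}. X c - X b))"

lemma phi_Omega: "f \<in> Omega lam \<Longrightarrow> phi lam a f = shift (delta a 1) f"
  by (simp add: phi_def on_set_def shift_phi delta_def)

lemma phi_inv_Omega:
  assumes "f \<in> Omega lam" shows "phi_inv lam a f = shift (delta a (- 1)) f"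
proof -
  have s: "shift (delta a s) (shift (delta a (- s)) g) = g" for s g
  proof -
    have "(\<lambda>b. delta a s b + delta a (- s) b) = (\<lambda>b. 0)" by (auto simp: delta_def)
    then show ?thesis using shift_0[of g] by (simp add: shift_shift)
  qed
  have "inj_on (phi lam a) (Omega lam)"
  proof (rule inj_onI)
    fix g h assume gh: "g \<in> Omega lam" "h \<in> Omega lam" "phi lam a g = phi lam a h"
    then have "shift (delta a (- 1)) (shift (delta a 1) g) = shift (delta a (- 1)) (shift (delta a 1) h)"
      by (simp add: phi_Omega)
    then show "g = h" using s[of "- 1" g] s[of "- 1" h] by simp
  qed
  moreover have "phi lam a (shift (delta a (- 1)) f) = f"
    using s[of 1 f] assms by (simp add: phi_Omega shift_Omega)
  ultimately show ?thesis
    using assms inv_into_f_f[of "phi lam a" "Omega lam" "shift (delta a (- 1)) f"]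
    by (simp add: phi_inv_def on_set_def shift_Omega)
qed

lemma E_op_Omega: "f \<in> Omega lam \<Longrightarrow> E_op lam i f = gz_op lam i (i + 1) 1 f"
  by (simp add: E_op_def on_set_def gz_op_def gz_num_def phi_Omega)

lemma F_op_Omega: "f \<in> Omega lam \<Longrightarrow> F_op lam i f = gz_op lam i (i - 1) (- 1) f"
  by (simp add: F_op_def on_set_def gz_op_def gz_num_def phi_inv_Omega)

lemma delta_inv: "bij g \<Longrightarrow> delta c s \<circ> inv g = delta (g c) s"
proof
  fix b assume g: "bij g"
  have "inv g b = c \<longleftrightarrow> b = g c" using bij_inv_eq_iff[OF g, of c b] by auto
  then show "(delta c s \<circ> inv g) b = delta (g c) s b" by (simp add: delta_def)
qed

lemma gz_num_perm:
  assumes g: "g \<in> G lam" and f: "f \<in> RG lam"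
  shows "perm_act g (gz_num lam i' s f c) = gz_num lam i' s f (g c)"
  using G_prod_row[OF g, of "\<lambda>a. X (g c) - X a" i']
  by (simp add: gz_num_def perm_act_simps[OF G_D(2)[OF g]] perm_act_X[OF G_D(2)[OF g]]
      perm_act_shift[OF G_D(2)[OF g]] delta_inv[OF G_D(2)[OF g]] RG_perm[OF f g])

lemma gz_num_R: "c \<in> I lam \<Longrightarrow> f \<in> R lam \<Longrightarrow> gz_num lam i' s f c \<in> R lam"
  unfolding gz_num_def using row_subset by (intro R_mult R_prod R_diff R_X shift_R) auto

lemma symmetrized_fraction_interval:
  fixes i p m :: nat and F :: "idx \<Rightarrow> mrat"
  defines "A \<equiv> (\<lambda>l. (i, p + l)) ` {..m}"
  assumes step: "\<And>j c. j < m \<Longrightarrow> c \<in> A \<Longrightarrow> s_act (i, p + j) (F c) = F (simple_refl (i, p + j) c)"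
  shows "(\<Sum>c\<in>A. F c / (\<Prod>b\<in>A - {c}. X c - X b)) = dd (rev (map (\<lambda>j. (i, p + j)) [0..<m])) (F (i, p))"
proof -
  have inj: "inj_on (\<lambda>l. (i, p + l)) B" for B by (auto simp: inj_on_def)
  have "A - {(i, p + l)} = (\<lambda>l. (i, p + l)) ` ({..m} - {l})" for l
    unfolding A_def by auto
  then have "(\<Sum>c\<in>A. F c / (\<Prod>b\<in>A - {c}. X c - X b))
      = (\<Sum>l\<le>m. F (i, p + l) / (\<Prod>l'\<in>{..m} - {l}. X (i, p + l) - X (i, p + l')))"
    by (simp add: A_def sum.reindex inj prod.reindex)
  also have "\<dots> = dd (rev (map (\<lambda>j. (i, p + j)) [0..<m])) (F (i, p + 0))"
    by (rule symmetrized_fraction_eq_dd) (auto simp: step A_def next_idx_def)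
  finally show ?thesis by simp
qed

lemma row_interval: "row lam i \<noteq> {} \<Longrightarrow> row lam i = (\<lambda>l. (i, 1 + l)) ` {..lam ! (i - 1) - 1}"
proof (intro set_eqI iffI)
  fix a assume "a \<in> row lam i"
  then show "a \<in> (\<lambda>l. (i, 1 + l)) ` {..lam ! (i - 1) - 1}"
    by (cases a) (auto simp: row_def I_def intro!: image_eqI[of _ _ "snd a - 1"])
qed (auto simp: row_def I_def)

text \<open>Permutations only permute the summands. The poles cancel because the sum is a divided difference.\<close>

lemma gz_op_RG:
  assumes f: "f \<in> RG lam" shows "gz_op lam i i' s f \<in> RG lam"
proof (rule RG_I)
  show "gz_op lam i i' s f \<in> R lam"
  proof (cases "row lam i = {}")
    case True
    then show ?thesis by (simp add: gz_op_def)
  next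
    case False
    let ?m = "lam ! (i - 1) - 1"
    note row = row_interval[OF False]
    have i: "(i, 1) \<in> I lam" and s: "(i, 1 + j) \<in> simple_idx lam" if "j < ?m" for j
      using False that by (auto simp: row_def I_def simple_idx_def next_idx_def)
    have i1: "(i, 1) \<in> I lam" using False by (auto simp: row_def I_def)
    have "gz_op lam i i' s f = dd (rev (map (\<lambda>j. (i, 1 + j)) [0..<?m])) (gz_num lam i' s f (i, 1))"
      unfolding gz_op_def row
      by (rule symmetrized_fraction_interval) (use s in \<open>simp add: gz_num_perm[OF simple_refl_G f]\<close>)
    also have "\<dots> \<in> R lam"
      by (intro dd_R gz_num_R RG_R[OF f] i1) (use s in auto)
    finally show ?thesis .
  qed
next
  fix g assume g: "g \<in> G lam"
  have "perm_act g (gz_op lam i i' s f)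
      = (\<Sum>c\<in>row lam i. gz_num lam i' s f (g c) / (\<Prod>b\<in>row lam i - {c}. X (g c) - X (g b)))"
    by (simp add: gz_op_def perm_act_simps[OF G_D(2)[OF g]] gz_num_perm[OF g f] perm_act_X[OF G_D(2)[OF g]])
  also have "\<dots> = (\<Sum>c\<in>row lam i. gz_num lam i' s f (g c) / (\<Prod>b\<in>row lam i - {g c}. X (g c) - X b))"
  proof (intro sum.cong refl arg_cong2[of _ _ _ _ "(/)"])
    fix c assume c: "c \<in> row lam i"
    have inj: "inj g" using G_D(2)[OF g] by (simp add: bij_is_inj)
    have "bij_betw g (row lam i - {c}) (row lam i - {g c})"
      using G_row[OF g, of i] inj by (auto simp: bij_betw_def inj_on_def image_set_diff dest: injD)
    from prod.reindex_bij_betw[OF this, of "\<lambda>b. X (g c) - X b"]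
    show "(\<Prod>b\<in>row lam i - {c}. X (g c) - X (g b)) = (\<Prod>b\<in>row lam i - {g c}. X (g c) - X b)" .
  qed
  also have "\<dots> = gz_op lam i i' s f"
    unfolding gz_op_def by (rule G_sum_row[OF g])
  finally show "perm_act g (gz_op lam i i' s f) = gz_op lam i i' s f" .
qed

text \<open>On the invariants the algebra is generated by operators of two kinds.\<close>

lemma U_generic_induct [consumes 1, case_names one op mul add scale comp]:
  assumes u: "u \<in> U lam"
    and one: "Q (on_set (Omega lam) id)"
    and op: "\<And>u i i' s. 1 \<le> i \<Longrightarrow> i < length lam \<Longrightarrow> i' = i + 1 \<or> i' = i - 1 \<Longrightarrow> u \<in> U lam \<Longrightarrow>
      (\<And>f. f \<in> RG lam \<Longrightarrow> u f = gz_op lam i i' s f) \<Longrightarrow> Q u"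
    and mul: "\<And>u q. q \<in> RG lam \<Longrightarrow> u \<in> U lam \<Longrightarrow> (\<And>f. f \<in> RG lam \<Longrightarrow> u f = q * f) \<Longrightarrow> Q u"
    and add: "\<And>u u'. u \<in> U lam \<Longrightarrow> u' \<in> U lam \<Longrightarrow> Q u \<Longrightarrow> Q u' \<Longrightarrow> Q (\<lambda>f. u f + u' f)"
    and scale: "\<And>u c. u \<in> U lam \<Longrightarrow> Q u \<Longrightarrow> Q (\<lambda>f. const c * u f)"
    and comp: "\<And>u u'. u \<in> U lam \<Longrightarrow> u' \<in> U lam \<Longrightarrow> Q u \<Longrightarrow> Q u' \<Longrightarrow> Q (u \<circ> u')"
  shows "Q u"
  using u
proof induction
  case (U_E i)
  show ?case
    by (rule op[OF U_E, of "i + 1" _ 1]) (simp_all add: E_op_Omega R_subset_Omega RG_R U.U_E[OF U_E])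
next
  case (U_F i)
  show ?case
    by (rule op[OF U_F, of "i - 1" _ "- 1"]) (simp_all add: F_op_Omega R_subset_Omega RG_R U.U_F[OF U_F])
next
  case (U_gamma a)
  have "elem_sym (snd a) (row lam (fst a)) \<in> RG lam"
  proof (rule RG_I)
    show "elem_sym (snd a) (row lam (fst a)) \<in> R lam"
      unfolding elem_sym_def using row_subset by (intro R_sum R_prod R_X) auto
    fix g assume g: "g \<in> G lam"
    have inj: "inj g" using G_D(2)[OF g] by (simp add: bij_is_inj)
    let ?T = "{S. S \<subseteq> row lam (fst a) \<and> card S = snd a}"
    have "bij_betw ((`) g) ?T ?T"
    proof (rule bij_betw_byWitness[where f' = "(`) (inv g)"])
      show "(`) g ` ?T \<subseteq> ?T"
        using G_row[OF g] by (auto simp: card_image inj_on_subset[OF inj]; blast)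
      have i: "inv g \<in> G lam" "inj (inv g)" using G_inv[OF g] G_D(2)[OF G_inv[OF g]] by (auto simp: bij_is_inj)
      show "(`) (inv g) ` ?T \<subseteq> ?T"
        using G_row[OF i(1)] by (auto simp: card_image inj_on_subset[OF i(2)]; blast)
    qed (use inj G_D(6,7)[OF g] in \<open>auto simp: image_image\<close>)
    from sum.reindex_bij_betw[OF this, of "\<lambda>S. \<Prod>b\<in>S. X b"]
    show "perm_act g (elem_sym (snd a) (row lam (fst a))) = elem_sym (snd a) (row lam (fst a))"
      by (simp add: elem_sym_def perm_act_simps[OF G_D(2)[OF g]] perm_act_X[OF G_D(2)[OF g]]
          prod.reindex inj_on_subset[OF inj])
  qed
  then show ?case
    by (rule mul) (rule U.U_gamma[OF U_gamma], simp add: gamma_op_def on_set_def R_subset_Omega RG_R)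
next
  case (U_mult u u')
  then show ?case by (intro comp)
qed (use one add scale in auto)

lemma U_RG:
  assumes "u \<in> U lam" "f \<in> RG lam" shows "u f \<in> RG lam"
proof -
  have "\<forall>f\<in>RG lam. u f \<in> RG lam"
    using assms(1)
    by (induction rule: U_generic_induct) (auto simp: on_set_def gz_op_RG RG_R R_subset_Omega)
  then show ?thesis using assms by blast
qed


section \<open>Integer shifts of a point\<close>

definition shifts :: "nat list \<Rightarrow> (idx \<Rightarrow> int) set" where
  "shifts lam = {d. \<forall>a. d a \<noteq> 0 \<longrightarrow> a \<in> I lam \<and> fst a < length lam}"

lemma shifts_0: "(\<lambda>a. 0) \<in> shifts lam"
  by (simp add: shifts_def)

lemma shifts_add: "d \<in> shifts lam \<Longrightarrow> e \<in> shifts lam \<Longrightarrow> (\<lambda>a. d a + e a) \<in> shifts lam"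
  unfolding shifts_def by (simp, metis add.left_neutral)

lemma shifts_delta: "a \<in> I lam \<Longrightarrow> fst a < length lam \<Longrightarrow> delta a s \<in> shifts lam"
  by (auto simp: shifts_def delta_def split: if_splits)

lemma shift_Omega_comp:
  assumes "\<And>f. f \<in> Omega lam \<Longrightarrow> \<phi> f = shift e f" "\<phi> 0 = 0"
  shows "\<phi> \<circ> on_set (Omega lam) (shift d) = on_set (Omega lam) (shift (\<lambda>a. e a + d a))"
  using assms by (auto simp: on_set_def shift_Omega shift_shift fun_eq_iff)

lemma gimel_shift: "\<xi> \<in> gimel lam \<Longrightarrow> \<exists>d\<in>shifts lam. \<xi> = on_set (Omega lam) (shift d)"
proof (induction rule: gimel.induct)
  case gimel_id
  have "on_set (Omega lam) id = on_set (Omega lam) (shift (\<lambda>a. 0))"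
    by (simp add: on_set_def shift_0 fun_eq_iff)
  then show ?case using shifts_0 by blast
next
  case (gimel_phi i j \<xi>)
  then obtain d where d: "d \<in> shifts lam" "\<xi> = on_set (Omega lam) (shift d)" by blast
  have "phi lam (i, j) \<circ> \<xi> = on_set (Omega lam) (shift (\<lambda>a. delta (i, j) 1 a + d a))"
    unfolding d(2) by (rule shift_Omega_comp) (simp_all add: phi_Omega R_subset_Omega shift_simps)
  then show ?case using shifts_add[OF shifts_delta[of "(i, j)" lam 1] d(1)] gimel_phi by fastforce
next
  case (gimel_phi_inv i j \<xi>)
  then obtain d where d: "d \<in> shifts lam" "\<xi> = on_set (Omega lam) (shift d)" by blast
  have "phi_inv lam (i, j) \<circ> \<xi> = on_set (Omega lam) (shift (\<lambda>a. delta (i, j) (- 1) a + d a))"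
    unfolding d(2) by (rule shift_Omega_comp) (simp_all add: phi_inv_Omega R_subset_Omega shift_simps)
  then show ?case using shifts_add[OF shifts_delta[of "(i, j)" lam "- 1"] d(1)] gimel_phi_inv by fastforce
qed

lemma shift_gimel: "d \<in> shifts lam \<Longrightarrow> on_set (Omega lam) (shift d) \<in> gimel lam"
proof (induction "nat (\<Sum>a\<in>I lam. \<bar>d a\<bar>)" arbitrary: d rule: less_induct)
  case less
  show ?case
  proof (cases "\<forall>a. d a = 0")
    case True
    then have d0: "d = (\<lambda>a. 0)" by auto
    have "on_set (Omega lam) (shift (\<lambda>a. 0)) = on_set (Omega lam) id"
      by (simp add: on_set_def shift_0 fun_eq_iff)
    then show ?thesis unfolding d0 by (simp add: gimel.gimel_id)
  next
    case False
    then obtain a where "d a \<noteq> 0" by blast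
    with less.prems have a: "a \<in> I lam" "fst a < length lam" unfolding shifts_def by blast+
    define s where "s = sgn (d a)"
    define e where "e = (\<lambda>b. delta a (- s) b + d b)"
    have e: "e \<in> shifts lam" unfolding e_def by (intro shifts_add shifts_delta a less.prems)
    have "(\<Sum>b\<in>I lam. \<bar>e b\<bar>) < (\<Sum>b\<in>I lam. \<bar>d b\<bar>)"
    proof (rule sum_strict_mono_ex1[OF finite_I])
      show "\<forall>b\<in>I lam. \<bar>e b\<bar> \<le> \<bar>d b\<bar>" using \<open>d a \<noteq> 0\<close> by (auto simp: e_def s_def delta_def sgn_if)
      show "\<exists>b\<in>I lam. \<bar>e b\<bar> < \<bar>d b\<bar>"
        using \<open>d a \<noteq> 0\<close> a by (intro bexI[of _ a]) (auto simp: e_def s_def delta_def sgn_if)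
    qed
    moreover have "0 \<le> (\<Sum>b\<in>I lam. \<bar>e b\<bar>)" by (simp add: sum_nonneg)
    ultimately have IH: "on_set (Omega lam) (shift e) \<in> gimel lam"
      by (intro less.hyps e) linarith
    have d: "d = (\<lambda>b. delta a s b + e b)" by (auto simp: e_def delta_def fun_eq_iff)
    have "s = 1 \<or> s = - 1" using \<open>d a \<noteq> 0\<close> by (auto simp: s_def sgn_if)
    then show ?thesis
    proof
      assume s: "s = 1"
      have "phi lam a \<circ> on_set (Omega lam) (shift e) = on_set (Omega lam) (shift d)"
        unfolding d s by (rule shift_Omega_comp) (simp_all add: phi_Omega R_subset_Omega shift_simps)
      moreover have "phi lam a \<circ> on_set (Omega lam) (shift e) \<in> gimel lam"
        using gimel.gimel_phi[OF _ _ IH, of "fst a" "snd a"] a by simp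
      ultimately show ?thesis by simp
    next
      assume s: "s = - 1"
      have "phi_inv lam a \<circ> on_set (Omega lam) (shift e) = on_set (Omega lam) (shift d)"
        unfolding d s by (rule shift_Omega_comp) (simp_all add: phi_inv_Omega R_subset_Omega shift_simps)
      moreover have "phi_inv lam a \<circ> on_set (Omega lam) (shift e) \<in> gimel lam"
        using gimel.gimel_phi_inv[OF _ _ IH, of "fst a" "snd a"] a by simp
      ultimately show ?thesis by simp
    qed
  qed
qed

definition add_shift :: "(idx \<Rightarrow> complex) \<Rightarrow> (idx \<Rightarrow> int) \<Rightarrow> idx \<Rightarrow> complex" where
  "add_shift v d = (\<lambda>a. v a + of_int (d a))"

lemma add_shift_inj: "add_shift v d = add_shift v e \<longleftrightarrow> d = e"
  by (auto simp: add_shift_def fun_eq_iff)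

lemma ev_shift': "f \<in> R lam \<Longrightarrow> ev v (shift d f) = ev (add_shift v d) f"
  by (simp add: ev_shift add_shift_def)

lemma add_shift_V_dual: "v \<in> V_dual lam \<Longrightarrow> d \<in> shifts lam \<Longrightarrow> add_shift v d \<in> V_dual lam"
  by (auto simp: V_dual_def shifts_def add_shift_def)

lemma V_dual_eqI:
  assumes "w \<in> V_dual lam" "w' \<in> V_dual lam" "\<And>f. f \<in> R lam \<Longrightarrow> ev w f = ev w' f"
  shows "w = w'"
proof
  fix a show "w a = w' a"
  proof (cases "a \<in> I lam")
    case True
    then show ?thesis using assms(3)[OF R_X[OF True]] by simp
  qed (use assms(1,2) in \<open>cases a; simp add: V_dual_def\<close>)
qed

lemma gimel_orbit_eq:
  assumes v: "v \<in> V_dual lam" shows "gimel_orbit lam v = add_shift v ` shifts lam"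
proof (intro set_eqI iffI)
  fix w assume "w \<in> gimel_orbit lam v"
  then obtain \<xi> where w: "w \<in> V_dual lam" "\<xi> \<in> gimel lam" "\<forall>f\<in>R lam. ev w f = ev v (\<xi> f)"
    by (auto simp: gimel_orbit_def)
  then obtain d where d: "d \<in> shifts lam" "\<xi> = on_set (Omega lam) (shift d)" using gimel_shift by blast
  have "w = add_shift v d"
    by (rule V_dual_eqI[OF w(1) add_shift_V_dual[OF v d(1)]])
      (use w(3) d(2) in \<open>simp add: on_set_def R_subset_Omega ev_shift'\<close>)
  then show "w \<in> add_shift v ` shifts lam" using d by blast
next
  fix w assume "w \<in> add_shift v ` shifts lam"
  then obtain d where d: "d \<in> shifts lam" "w = add_shift v d" by blast
  then show "w \<in> gimel_orbit lam v"
    using add_shift_V_dual[OF v d(1)] shift_gimel[OF d(1)]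
    by (auto simp: gimel_orbit_def on_set_def R_subset_Omega ev_shift' intro!: bexI[of _ "on_set (Omega lam) (shift d)"])
qed

locale gz_point =
  fixes lam :: "nat list" and v :: "idx \<Rightarrow> complex"
  assumes v: "v \<in> V_dual lam"
    and stab_max: "\<And>w. w \<in> gimel_orbit lam v \<Longrightarrow> stab lam w \<subseteq> stab lam v"
    and stab_intervals: "\<And>i a. 1 \<le> i \<Longrightarrow> i \<le> length lam \<Longrightarrow> a \<in> row lam i \<Longrightarrow>
           \<exists>p q. idx_orbit (stab lam v) a = {(i, r) | r. p \<le> r \<and> r \<le> p + q}"
    and generic: "\<And>i a b. 1 \<le> i \<Longrightarrow> i < length lam \<Longrightarrow> a \<in> row lam i \<Longrightarrow> b \<in> row lam (i + 1) \<Longrightarrow>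
           v a - v b \<notin> \<int>"
begin

text \<open>Lying in the same orbit of the stabilizer, expressed through the coordinates.\<close>

definition blk :: "idx \<Rightarrow> idx \<Rightarrow> bool" where
  "blk a b \<longleftrightarrow> a \<in> I lam \<and> b \<in> I lam \<and> fst a = fst b \<and> (a = b \<or> fst a < length lam \<and> v a = v b)"

lemma blk_self: "a \<in> I lam \<Longrightarrow> blk a a"
  and blk_sym: "blk a b \<Longrightarrow> blk b a"
  and blk_trans: "blk a b \<Longrightarrow> blk b c \<Longrightarrow> blk a c"
  by (auto simp: blk_def)

lemma blk_v: "blk a b \<Longrightarrow> v a = v b" and blk_fst: "blk a b \<Longrightarrow> fst a = fst b"
  and blk_I: "blk a b \<Longrightarrow> a \<in> I lam" "blk a b \<Longrightarrow> b \<in> I lam"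
  by (auto simp: blk_def)

lemma stab_eq: "stab lam v = {g \<in> G lam. \<forall>a\<in>I lam. blk a (g a)}"
proof (intro set_eqI iffI)
  fix g assume "g \<in> stab lam v"
  then have g: "g \<in> G lam" and k: "\<And>a. a \<in> row lam (length lam) \<Longrightarrow> g a = a" and d: "\<And>a. v (inv g a) = v a"
    by (auto simp: stab_def Gbar_def dual_act_def fun_eq_iff)
  have "blk a (g a)" if a: "a \<in> I lam" for a
  proof -
    have "v (g a) = v a" using d[of "g a"] G_D(7)[OF g, of a] by simp
    show ?thesis
    proof (cases "fst a = length lam")
      case True
      then have "g a = a" using a k[of a] by (simp add: row_def)
      then show ?thesis using a by (simp add: blk_def)
    next
      case False
      then have "fst a < length lam" using a by (auto simp: I_def)
      then show ?thesis using a \<open>v (g a) = v a\<close> G_D(3,4)[OF g a] by (simp add: blk_def)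
    qed
  qed
  then show "g \<in> {g \<in> G lam. \<forall>a\<in>I lam. blk a (g a)}" using g by blast
next
  fix g assume g: "g \<in> {g \<in> G lam. \<forall>a\<in>I lam. blk a (g a)}"
  then have gG: "g \<in> G lam" and b: "\<And>a. a \<in> I lam \<Longrightarrow> blk a (g a)" by auto
  have "v (inv g a) = v a" for a
  proof (cases "a \<in> I lam")
    case True
    then show ?thesis using blk_v[OF b[OF G_D(5)[OF gG True]]] G_D(6)[OF gG, of a] by simp
  next
    case False
    then have "inv g a = a" using permutes_not_in[OF permutes_inv[OF G_D(1)[OF gG]]] by blast
    then show ?thesis by simp
  qed
  moreover have "g a = a" if "a \<in> row lam (length lam)" for a
    using b[of a] that by (auto simp: row_def blk_def)
  ultimately show "g \<in> stab lam v"
    using gG by (auto simp: stab_def Gbar_def dual_act_def fun_eq_iff)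
qed

lemma stab_G: "g \<in> stab lam v \<Longrightarrow> g \<in> G lam" and stab_blk: "g \<in> stab lam v \<Longrightarrow> a \<in> I lam \<Longrightarrow> blk a (g a)"
  by (auto simp: stab_eq)

lemma stab_id: "id \<in> stab lam v"
  by (auto simp: stab_eq G_id blk_self)

lemma stab_comp: "g \<in> stab lam v \<Longrightarrow> h \<in> stab lam v \<Longrightarrow> g \<circ> h \<in> stab lam v"
  unfolding stab_eq using G_D(3) by (auto intro!: G_comp) (metis blk_trans G_D(3))

lemma stab_inv: "g \<in> stab lam v \<Longrightarrow> inv g \<in> stab lam v"
proof -
  assume g: "g \<in> stab lam v"
  then have gG: "g \<in> G lam" by (rule stab_G)
  have "blk a (inv g a)" if "a \<in> I lam" for a
    using stab_blk[OF g G_D(5)[OF gG that]] G_D(6)[OF gG, of a] by (simp add: blk_sym)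
  then show ?thesis using G_inv[OF gG] by (simp add: stab_eq)
qed

lemma transpose_G:
  "a \<in> I lam \<Longrightarrow> b \<in> I lam \<Longrightarrow> fst a = fst b \<Longrightarrow> Transposition.transpose a b \<in> G lam"
  using permutes_swap_id[of a "I lam" b] unfolding G_def by (auto simp: transpose_def)

lemma transpose_stab: "blk a b \<Longrightarrow> Transposition.transpose a b \<in> stab lam v"
  using transpose_G[of a b] unfolding stab_eq
  by (auto simp: blk_self blk_I blk_fst transpose_def intro: blk_sym)

lemma idx_orbit_eq: "a \<in> I lam \<Longrightarrow> idx_orbit (stab lam v) a = {b. blk a b}"
proof (intro set_eqI iffI)
  fix b assume "b \<in> {b. blk a b}"
  then have "Transposition.transpose a b \<in> stab lam v" "b = Transposition.transpose a b a"
    by (auto intro: transpose_stab)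
  then show "b \<in> idx_orbit (stab lam v) a" unfolding idx_orbit_def by blast
qed (auto simp: idx_orbit_def stab_blk)

lemma blk_convex:
  assumes "blk a c" "fst b = fst a" "snd a \<le> snd b" "snd b \<le> snd c"
  shows "blk a b"
proof -
  have a: "a \<in> I lam" "a \<in> row lam (fst a)" using assms by (auto simp: blk_def row_def)
  then obtain p q where pq: "{b. blk a b} = {(fst a, r) | r. p \<le> r \<and> r \<le> p + q}"
    using stab_intervals[of "fst a" a] idx_orbit_eq[OF a(1)] by (auto simp: I_def)
  have "a \<in> {b. blk a b}" "c \<in> {b. blk a b}" using assms a by (auto intro: blk_self)
  then have "b \<in> {b. blk a b}" unfolding pq using assms(2-4) by (cases a; cases b; cases c) auto
  then show ?thesis by simp
qed

text \<open>Entries of a row other than the last that differ by an integer can be shifted onto each other; the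
  maximality of the stabilizer forces them to be equal.\<close>

lemma v_diff_Ints:
  assumes "a \<in> I lam" "b \<in> I lam" "fst a = fst b" "fst a < length lam" "v a - v b \<in> \<int>"
  shows "blk a b"
proof (cases "a = b")
  case False
  obtain n where n: "v a - v b = of_int n" using assms(5) by (auto simp: Ints_def)
  define w where "w = add_shift v (delta b n)"
  have "w \<in> gimel_orbit lam v"
    unfolding gimel_orbit_eq[OF v] w_def using assms by (intro imageI shifts_delta) auto
  then have sub: "stab lam w \<subseteq> stab lam v" by (rule stab_max)
  let ?t = "Transposition.transpose a b"
  have "w a = w b" using n False by (simp add: w_def add_shift_def delta_def algebra_simps)
  then have "dual_act ?t w = w" by (auto simp: dual_act_def transpose_def fun_eq_iff)
  moreover have "?t \<in> Gbar lam" using transpose_G[OF assms(1-3)] assms by (auto simp: Gbar_def row_def transpose_def)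
  ultimately have "?t \<in> stab lam v" using sub by (auto simp: stab_def)
  from stab_blk[OF this assms(1)] show ?thesis by simp
qed (use assms in \<open>simp add: blk_self\<close>)


section \<open>Functionals supported at the point\<close>

definition blk_refl :: "idx set" where
  "blk_refl = {a \<in> simple_idx lam. blk a (next_idx a)}"

lemma blk_refl_simple: "a \<in> blk_refl \<Longrightarrow> a \<in> simple_idx lam" and blk_refl_blk: "a \<in> blk_refl \<Longrightarrow> blk a (next_idx a)"
  by (auto simp: blk_refl_def)

lemma blk_refl_stab: "a \<in> blk_refl \<Longrightarrow> simple_refl a \<in> stab lam v"
  unfolding simple_refl_def by (rule transpose_stab[OF blk_refl_blk])

lemma ev_stab:
  assumes g: "g \<in> stab lam v" and f: "f \<in> R lam" shows "ev v (perm_act g f) = ev v f"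
proof -
  have "ev (v \<circ> g) f = ev v f"
    by (rule ev_cong[OF f]) (use blk_v[OF stab_blk[OF g]] in simp)
  then show ?thesis using ev_perm_act[OF G_D(1)[OF stab_G[OF g]] f] by simp
qed

text \<open>The functionals \<open>ev v \<circ> dd as\<close> given by words of length below \<open>n\<close> in the simple reflections of the
  stabilizer, and their linear combinations. Only values on \<open>R lam\<close> matter, so the set is closed under
  changes elsewhere, which saves restricting each composite with multiplications and divided differences to \<open>R lam\<close>.\<close>

inductive_set local_fun :: "nat \<Rightarrow> (mrat \<Rightarrow> complex) set" for n :: nat where
  local_fun_word: "set as \<subseteq> blk_refl \<Longrightarrow> length as < n \<Longrightarrow> (\<lambda>f. ev v (dd as f)) \<in> local_fun n"
| local_fun_zero: "(\<lambda>f. 0) \<in> local_fun n"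
| local_fun_add: "L \<in> local_fun n \<Longrightarrow> L' \<in> local_fun n \<Longrightarrow> (\<lambda>f. L f + L' f) \<in> local_fun n"
| local_fun_scale: "L \<in> local_fun n \<Longrightarrow> (\<lambda>f. c * L f) \<in> local_fun n"
| local_fun_cong: "L \<in> local_fun n \<Longrightarrow> (\<And>f. f \<in> R lam \<Longrightarrow> L' f = L f) \<Longrightarrow> L' \<in> local_fun n"

lemma words_R: "set as \<subseteq> blk_refl \<Longrightarrow> f \<in> R lam \<Longrightarrow> dd as f \<in> R lam"
  by (rule dd_R) (auto simp: blk_refl_def)

lemma local_fun_linear:
  assumes "L \<in> local_fun n"
  shows "f \<in> R lam \<Longrightarrow> g \<in> R lam \<Longrightarrow> L (f + g) = L f + L g"
    and "f \<in> R lam \<Longrightarrow> L (const c * f) = c * L f"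
proof -
  have "(\<forall>f\<in>R lam. \<forall>g\<in>R lam. L (f + g) = L f + L g) \<and> (\<forall>c. \<forall>f\<in>R lam. L (const c * f) = c * L f)"
    using assms
  proof induction
    case (local_fun_word as)
    have "\<And>f. f \<in> R lam \<Longrightarrow> dd as f \<in> R lam" using words_R[OF local_fun_word(1)] .
    then show ?case
      by (simp add: dd_add dd_const_mult ev_add[where lam = lam] ev_mult[where lam = lam])
  next
    case (local_fun_cong L L')
    then show ?case by (auto simp: R_add R_mult)
  qed (auto simp: algebra_simps)
  then show "f \<in> R lam \<Longrightarrow> g \<in> R lam \<Longrightarrow> L (f + g) = L f + L g"
    and "f \<in> R lam \<Longrightarrow> L (const c * f) = c * L f" by auto
qed

lemma local_fun_0: "L \<in> local_fun 0 \<Longrightarrow> f \<in> R lam \<Longrightarrow> L f = 0"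
  by (induction rule: local_fun.induct) auto

lemma local_fun_mono: "L \<in> local_fun n \<Longrightarrow> n \<le> m \<Longrightarrow> L \<in> local_fun m"
  by (induction rule: local_fun.induct) (auto intro: local_fun.intros)

lemma local_fun_D: "L \<in> local_fun n \<Longrightarrow> b \<in> blk_refl \<Longrightarrow> (\<lambda>f. L (D b f)) \<in> local_fun (Suc n)"
proof (induction rule: local_fun.induct)
  case (local_fun_word as)
  then have "(\<lambda>f. ev v (dd (as @ [b]) f)) \<in> local_fun (Suc n)" by (intro local_fun.local_fun_word) auto
  then show ?case by simp
next
  case (local_fun_cong L L')
  show ?case
    by (rule local_fun.local_fun_cong[OF local_fun_cong.IH[OF local_fun_cong.prems]])
      (rule local_fun_cong.hyps(2)[OF D_R[OF blk_refl_simple[OF local_fun_cong.prems]]])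
qed (auto intro: local_fun.intros)

text \<open>By the Leibniz rule a factor that vanishes at the point either moves on to the left, where evaluation
  kills it, or uses up a letter; its conjugates under the stabilizer vanish at the point as well.\<close>

lemma word_mult_vanishing:
  "set as \<subseteq> blk_refl \<Longrightarrow> r \<in> R lam \<Longrightarrow> ev v r = 0 \<Longrightarrow> (\<lambda>f. ev v (dd as (r * f))) \<in> local_fun (length as)"
proof (induction as arbitrary: r rule: rev_induct)
  case Nil
  then show ?case by (intro local_fun_cong[OF local_fun_zero]) (simp add: ev_mult[where lam = lam])
next
  case (snoc b as)
  then have b: "b \<in> blk_refl" "b \<in> simple_idx lam" and as: "set as \<subseteq> blk_refl" by (auto simp: blk_refl_simple)
  have Dr: "D b r \<in> R lam" and sr: "s_act b r \<in> R lam" using b snoc.prems by auto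
  define c where "c = ev v (D b r)"
  have r': "D b r - const c \<in> R lam" "ev v (D b r - const c) = 0"
    using Dr by (auto simp: ev_diff[OF Dr R_const] c_def)
  have "ev v (s_act b r) = 0" using snoc.prems ev_stab[OF blk_refl_stab[OF b(1)]] by simp
  from local_fun_D[OF snoc.IH[OF as sr this] b(1)]
  have 1: "(\<lambda>f. ev v (dd as (s_act b r * D b f))) \<in> local_fun (Suc (length as))" .
  have 2: "(\<lambda>f. ev v (dd as ((D b r - const c) * f))) \<in> local_fun (Suc (length as))"
    by (rule local_fun_mono[OF snoc.IH[OF as r']]) simp
  have 3: "(\<lambda>f. c * ev v (dd as f)) \<in> local_fun (Suc (length as))"
    by (intro local_fun_scale local_fun_word as) simp
  have 4: "(\<lambda>f. (ev v (dd as (s_act b r * D b f)) + ev v (dd as ((D b r - const c) * f))) + c * ev v (dd as f))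
      \<in> local_fun (Suc (length as))"
    by (intro local_fun_add 1 2 3)
  have "(\<lambda>f. ev v (dd (as @ [b]) (r * f))) \<in> local_fun (Suc (length as))"
  proof (rule local_fun_cong[OF 4])
    fix f assume f: "f \<in> R lam"
    have Df: "D b f \<in> R lam" using b f by auto
    note w = words_R[OF as]
    have "D b (r * f) = s_act b r * D b f + ((D b r - const c) * f + const c * f)"
      unfolding D_leibniz by (simp add: algebra_simps)
    then have "dd as (D b (r * f)) = dd as (s_act b r * D b f) + (dd as ((D b r - const c) * f) + const c * dd as f)"
      by (simp only: dd_add dd_const_mult)
    then have "ev v (dd as (D b (r * f)))
        = ev v (dd as (s_act b r * D b f)) + (ev v (dd as ((D b r - const c) * f)) + c * ev v (dd as f))"
      using ev_add[OF w R_add[OF w R_mult[OF R_const w]], of "s_act b r * D b f" "(D b r - const c) * f" f v c]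
        ev_add[OF w R_mult[OF R_const w], of "(D b r - const c) * f" f v c] ev_mult[OF R_const w, of f v c]
        f Df sr r' by auto
    then show "ev v (dd (as @ [b]) (r * f))
        = (ev v (dd as (s_act b r * D b f)) + ev v (dd as ((D b r - const c) * f))) + c * ev v (dd as f)"
      by (simp add: add.assoc)
  qed
  then show ?case by simp
qed

lemma local_fun_mult_vanishing:
  assumes L: "L \<in> local_fun (Suc n)" and r: "r \<in> R lam" "ev v r = 0"
  shows "(\<lambda>f. L (r * f)) \<in> local_fun n"
  using L
proof induction
  case (local_fun_word as)
  then show ?case using word_mult_vanishing[OF local_fun_word(1) r] local_fun_mono[of _ "length as" n] by simp
next
  case (local_fun_cong L L')
  show ?case by (rule local_fun.local_fun_cong[OF local_fun_cong.IH]) (rule local_fun_cong.hyps(2)[OF R_mult[OF r(1)]])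
qed (auto intro: local_fun.intros)

lemma local_fun_mult:
  assumes L: "L \<in> local_fun n" and r: "r \<in> R lam"
  shows "(\<lambda>f. L (r * f)) \<in> local_fun n"
proof (cases n)
  case 0
  show ?thesis by (rule local_fun_cong[OF local_fun_zero]) (use local_fun_0 L[unfolded 0] R_mult[OF r] in simp)
next
  case (Suc m)
  define c where "c = ev v r"
  have r': "r - const c \<in> R lam" "ev v (r - const c) = 0"
    using r by (auto simp: ev_diff[OF r R_const] c_def)
  have 1: "(\<lambda>f. L ((r - const c) * f)) \<in> local_fun n"
    using local_fun_mono[OF local_fun_mult_vanishing[OF L[unfolded Suc] r']] Suc by simp
  have 2: "(\<lambda>f. L ((r - const c) * f) + c * L f) \<in> local_fun n"
    by (intro local_fun_add 1 local_fun_scale L)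
  show ?thesis
  proof (rule local_fun_cong[OF 2])
    fix f assume f: "f \<in> R lam"
    have "r * f = (r - const c) * f + const c * f" by (simp add: algebra_simps)
    then show "L (r * f) = L ((r - const c) * f) + c * L f"
      using local_fun_linear(1)[OF L R_mult[OF r'(1) f] R_mult[OF R_const f], of c] local_fun_linear(2)[OF L f, of c] by simp
  qed
qed

text \<open>Reduced words have at most one letter for every pair of indices, and the other words act by zero.\<close>

definition maxlen :: nat where
  "maxlen = Suc (card (I lam \<times> I lam))"

lemma word_top:
  assumes "set as \<subseteq> blk_refl" shows "(\<lambda>f. ev v (dd as f)) \<in> local_fun maxlen"
proof (cases "red_word lam as")
  case True
  have "card (inversions lam (word_perm as)) \<le> card (I lam \<times> I lam)"
    by (rule card_mono) (auto simp: inversions_def finite_I)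
  then show ?thesis using True assms by (intro local_fun_word) (auto simp: red_word_def maxlen_def)
next
  case False
  have "set as \<subseteq> simple_idx lam" using assms blk_refl_simple by auto
  then show ?thesis using dd_nonreduced[OF _ False] local_fun_zero by simp
qed

lemma local_fun_top: "L \<in> local_fun n \<Longrightarrow> L \<in> local_fun maxlen"
  by (induction rule: local_fun.induct) (auto intro: local_fun.intros word_top)

lemma local_fun_D_top: "L \<in> local_fun maxlen \<Longrightarrow> b \<in> blk_refl \<Longrightarrow> (\<lambda>f. L (D b f)) \<in> local_fun maxlen"
  by (rule local_fun_top[OF local_fun_D])

lemma local_fun_dd_top: "L \<in> local_fun maxlen \<Longrightarrow> set as \<subseteq> blk_refl \<Longrightarrow> (\<lambda>f. L (dd as f)) \<in> local_fun maxlen"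
proof (induction as arbitrary: L)
  case (Cons a as)
  then show ?case using Cons.IH[OF local_fun_D_top[of L a]] by simp
qed simp

lemma ev_local_fun: "ev v \<in> local_fun maxlen"
  using word_top[of "[]"] by simp

lemma local_fun_s_act: "L \<in> local_fun maxlen \<Longrightarrow> b \<in> blk_refl \<Longrightarrow> (\<lambda>f. L (s_act b f)) \<in> local_fun maxlen"
proof -
  assume L: "L \<in> local_fun maxlen" and b: "b \<in> blk_refl"
  have bI: "b \<in> simple_idx lam" "b \<in> I lam" "next_idx b \<in> I lam" using b by (auto simp: blk_refl_def simple_idx_def)
  define r where "r = X (next_idx b) - X b"
  have r: "r \<in> R lam" using bI by (auto simp: r_def)
  have 1: "(\<lambda>f. L f + L (r * D b f)) \<in> local_fun maxlen"
    by (intro local_fun_add L local_fun_D_top[OF local_fun_mult[OF L r] b])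
  show ?thesis
  proof (rule local_fun_cong[OF 1])
    fix f assume f: "f \<in> R lam"
    have "s_act b f = f + r * D b f" by (simp add: s_act_eq_D[of b f] r_def algebra_simps)
    then show "L (s_act b f) = L f + L (r * D b f)"
      using local_fun_linear(1)[OF L f R_mult[OF r D_R[OF bI(1) f]]] by simp
  qed
qed

lemma local_fun_mult_invariant:
  assumes L: "L \<in> local_fun n" and r: "r \<in> R lam" "\<And>b. b \<in> blk_refl \<Longrightarrow> s_act b r = r" and f: "f \<in> R lam"
  shows "L (r * f) = ev v r * L f"
  using L f
proof (induction arbitrary: f)
  case (local_fun_word as)
  have "dd as (r * f) = r * dd as f" using local_fun_word r by (intro dd_mult_invariant) auto
  then show ?case using ev_mult[OF r(1) words_R[OF local_fun_word(1,3)]] by simp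
next
  case (local_fun_cong L L')
  then show ?case using r by (auto simp: R_mult)
qed (auto simp: algebra_simps)

text \<open>Modulo this ideal polynomials can be treated as jets at the point: it contains high powers of
  everything that vanishes there, and polynomials that do not vanish there become invertible.\<close>

definition ann :: "mrat set" where
  "ann = {r \<in> R lam. \<forall>L\<in>local_fun maxlen. L r = 0}"

lemma ann_R: "r \<in> ann \<Longrightarrow> r \<in> R lam" and annD: "r \<in> ann \<Longrightarrow> L \<in> local_fun maxlen \<Longrightarrow> L r = 0"
  by (auto simp: ann_def)

lemma ann_mult: "r \<in> ann \<Longrightarrow> p \<in> R lam \<Longrightarrow> p * r \<in> ann"
proof -
  assume r: "r \<in> ann" and p: "p \<in> R lam"
  have "L (p * r) = 0" if "L \<in> local_fun maxlen" for L
    using annD[OF r local_fun_mult[OF that p]] .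
  then show ?thesis using r p by (auto simp: ann_def)
qed

lemma ann_mult': "r \<in> ann \<Longrightarrow> p \<in> R lam \<Longrightarrow> r * p \<in> ann"
  using ann_mult[of r p] by (simp add: mult.commute)

lemma ann_add: "r \<in> ann \<Longrightarrow> p \<in> ann \<Longrightarrow> r + p \<in> ann"
  by (auto simp: ann_def local_fun_linear(1))

lemma ann_0: "0 \<in> ann"
proof -
  have "L 0 = 0" if "L \<in> local_fun maxlen" for L
    using local_fun_linear(2)[OF that, of 0 0] by simp
  then show ?thesis by (simp add: ann_def)
qed

lemma ann_sum: "(\<And>a. a \<in> A \<Longrightarrow> f a \<in> ann) \<Longrightarrow> sum f A \<in> ann"
  by (induction A rule: infinite_finite_induct) (auto intro: ann_0 ann_add)

lemma ann_uminus: "r \<in> ann \<Longrightarrow> - r \<in> ann"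
proof -
  assume "r \<in> ann"
  then have "const (- 1) * r \<in> ann" by (rule ann_mult) (rule R_const)
  then show ?thesis by (simp add: const_simps)
qed

lemma local_fun_mult_power:
  assumes "L \<in> local_fun n" "r \<in> R lam" "ev v r = 0" shows "(\<lambda>f. L (r ^ k * f)) \<in> local_fun (n - k)"
proof (induction k)
  case 0
  show ?case using assms by simp
next
  case (Suc k)
  show ?case
  proof (cases "n - k")
    case 0
    have "(\<lambda>f. L (r ^ k * (r * f))) \<in> local_fun 0" using local_fun_mult[OF Suc assms(2)] 0 by simp
    then show ?thesis using 0 by (simp add: mult_ac)
  next
    case m: (Suc m)
    have "(\<lambda>f. L (r ^ k * (r * f))) \<in> local_fun m" using local_fun_mult_vanishing[of _ m, OF _ assms(2,3)] Suc m by simp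
    moreover have "n - Suc k = m" using m by simp
    ultimately show ?thesis by (simp add: mult_ac)
  qed
qed

lemma ann_power:
  assumes r: "r \<in> R lam" "ev v r = 0" shows "r ^ maxlen \<in> ann"
  using local_fun_0[OF local_fun_mult_power[OF _ r, of _ maxlen maxlen, unfolded diff_self_eq_0] R_1] r
  by (auto simp: ann_def)

text \<open>After scaling, \<open>r = 1 - t\<close> with \<open>t\<close> vanishing at \<open>v\<close>. A power of \<open>t\<close> is annihilated, so a
  truncated geometric series in \<open>t\<close> inverts \<open>r\<close>.\<close>

lemma ann_unit:
  assumes r: "r \<in> R lam" "ev v r \<noteq> 0"
  obtains p where "p \<in> R lam" "r * p - 1 \<in> ann"
proof -
  define c where "c = 1 / ev v r"
  define t where "t = 1 - const c * r"
  have cr: "const c * r \<in> R lam" using r by auto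
  have t: "t \<in> R lam" using cr by (auto simp: t_def)
  have "ev v t = 0"
    unfolding t_def ev_diff[OF R_1 cr] ev_mult[OF R_const r(1)] using r by (simp add: c_def)
  then have a: "t ^ maxlen \<in> ann" by (rule ann_power[OF t])
  define p where "p = const c * (\<Sum>k<maxlen. t ^ k)"
  have p: "p \<in> R lam" unfolding p_def using t by auto
  have "r * p = (1 - t) * (\<Sum>k<maxlen. t ^ k)" by (simp add: p_def t_def mult_ac)
  also have "\<dots> = 1 - t ^ maxlen" by (rule one_diff_power_eq[symmetric])
  finally have "r * p - 1 = - (t ^ maxlen)" by simp
  then have "r * p - 1 \<in> ann" using ann_uminus[OF a] by simp
  then show ?thesis using that p by blast
qed

lemma ann_eq: "L \<in> local_fun maxlen \<Longrightarrow> p - q \<in> ann \<Longrightarrow> p \<in> R lam \<Longrightarrow> q \<in> R lam \<Longrightarrow> f \<in> R lam \<Longrightarrow> L (p * f) = L (q * f)"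
proof -
  assume L: "L \<in> local_fun maxlen" and a: "p - q \<in> ann" and pq: "p \<in> R lam" "q \<in> R lam" and f: "f \<in> R lam"
  have "L ((p - q) * f + q * f) = L ((p - q) * f) + L (q * f)"
    using pq f by (intro local_fun_linear(1)[OF L]) auto
  moreover have "L ((p - q) * f) = 0" using annD[OF ann_mult'[OF a f] L] .
  ultimately show ?thesis by (simp add: algebra_simps)
qed

end

context gz_point
begin


section \<open>Dominant shifts\<close>

lemma hsI: "blk a (next_idx a) \<Longrightarrow> a \<in> blk_refl"
  by (auto simp: blk_refl_def simple_idx_def dest: blk_I)

definition dominant :: "(idx \<Rightarrow> int) \<Rightarrow> bool" where
  "dominant d \<longleftrightarrow> d \<in> shifts lam \<and> (\<forall>a\<in>blk_refl. d (next_idx a) \<le> d a)"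

lemma dominant_shifts: "dominant d \<Longrightarrow> d \<in> shifts lam"
  by (simp add: dominant_def)

lemma dominant_mono:
  assumes d: "dominant d" shows "blk a b \<Longrightarrow> snd a \<le> snd b \<Longrightarrow> d b \<le> d a"
proof -
  have "blk a (fst a, snd a + n) \<Longrightarrow> d (fst a, snd a + n) \<le> d a" for n
  proof (induction n)
    case (Suc n)
    have b: "blk a (fst a, snd a + n)" by (rule blk_convex[OF Suc.prems]) auto
    have "blk (fst a, snd a + n) (next_idx (fst a, snd a + n))"
      using blk_trans[OF blk_sym[OF b] Suc.prems] by (simp add: next_idx_def)
    then have "d (fst a, snd a + Suc n) \<le> d (fst a, snd a + n)"
      using d hsI by (force simp: dominant_def next_idx_def)
    then show ?case using Suc.IH[OF b] by linarith
  qed simp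
  from this[of "snd b - snd a"] show "blk a b \<Longrightarrow> snd a \<le> snd b \<Longrightarrow> d b \<le> d a"
    by (simp add: blk_fst)
qed

lemma shifts_comp_stab:
  assumes "d \<in> shifts lam" "g \<in> stab lam v" shows "d \<circ> g \<in> shifts lam"
proof -
  have g: "g \<in> G lam" using assms stab_G by blast
  have "a \<in> I lam \<and> fst a < length lam" if "d (g a) \<noteq> 0" for a
  proof -
    have ga: "g a \<in> I lam" "fst (g a) < length lam" using assms(1) that unfolding shifts_def by blast+
    then have "a \<in> I lam" using G_D(1)[OF g] by (metis permutes_in_image)
    then show ?thesis using ga G_D(4)[OF g] by simp
  qed
  then show ?thesis unfolding shifts_def by auto
qed

text \<open>Among the rearrangements by the stabilizer one that maximizes a weighted sum, with weights decreasing
  along the rows, cannot be improved by exchanging neighbours.\<close>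

lemma dominant_exists:
  assumes d: "d \<in> shifts lam" shows "\<exists>g\<in>stab lam v. dominant (d \<circ> g)"
proof -
  define \<phi> where "\<phi> g = - (\<Sum>a\<in>I lam. int (snd a) * d (g a))" for g
  have fin: "finite (stab lam v)" by (rule finite_subset[OF _ finite_G[of lam]]) (auto simp: stab_G)
  have ne: "stab lam v \<noteq> {}" using stab_id by blast
  have "Max (\<phi> ` stab lam v) \<in> \<phi> ` stab lam v" using fin ne by (intro Max_in) auto
  then obtain g where g: "g \<in> stab lam v" "\<phi> g = Max (\<phi> ` stab lam v)" by auto
  have max: "\<phi> h \<le> \<phi> g" if "h \<in> stab lam v" for h unfolding g(2) using fin that by simp
  have "d (g (next_idx a)) \<le> d (g a)" if a: "a \<in> blk_refl" for a
  proof -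
    have I: "a \<in> I lam" "next_idx a \<in> I lam" using blk_refl_simple[OF a] by (auto simp: simple_idx_def)
    let ?h = "g \<circ> simple_refl a"
    have split: "(\<Sum>b\<in>I lam. f b) = f a + (f (next_idx a) + (\<Sum>b\<in>I lam - {a} - {next_idx a}. f b))" for f :: "idx \<Rightarrow> int"
      using I by (simp add: sum.remove[OF finite_I, of a] sum.remove[of "I lam - {a}" "next_idx a"] finite_I)
    have "(\<Sum>b\<in>I lam - {a} - {next_idx a}. int (snd b) * d (?h b)) = (\<Sum>b\<in>I lam - {a} - {next_idx a}. int (snd b) * d (g b))"
      by (intro sum.cong) auto
    then have "\<phi> ?h - \<phi> g = d (g (next_idx a)) - d (g a)"
      unfolding \<phi>_def split by (simp add: algebra_simps)
    moreover have "\<phi> ?h \<le> \<phi> g" by (intro max stab_comp g blk_refl_stab a)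
    ultimately show ?thesis by simp
  qed
  then show ?thesis using g shifts_comp_stab[OF d g(1)] by (auto simp: dominant_def)
qed

text \<open>The multiset of coordinates of a shifted point in a row.\<close>

definition value_count :: "(idx \<Rightarrow> int) \<Rightarrow> nat \<Rightarrow> complex \<Rightarrow> nat" where
  "value_count d i c = card {b \<in> row lam i. add_shift v d b = c}"

lemma value_count_stab:
  assumes g: "g \<in> stab lam v" shows "value_count (d \<circ> g) i c = value_count d i c"
proof -
  have gG: "g \<in> G lam" using g by (rule stab_G)
  have eq: "add_shift v (d \<circ> g) b = add_shift v d (g b)" if "b \<in> row lam i" for b
    using blk_v[OF stab_blk[OF g], of b] that row_subset by (auto simp: add_shift_def)
  have "{b \<in> row lam i. add_shift v d b = c} = g ` {b \<in> row lam i. add_shift v (d \<circ> g) b = c}"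
  proof (intro set_eqI iffI)
    fix b assume b: "b \<in> {b \<in> row lam i. add_shift v d b = c}"
    then obtain b' where "b' \<in> row lam i" "b = g b'" using G_row[OF gG, of i] by blast
    then show "b \<in> g ` {b \<in> row lam i. add_shift v (d \<circ> g) b = c}" using b eq[of b'] by blast
  next
    fix b assume "b \<in> g ` {b \<in> row lam i. add_shift v (d \<circ> g) b = c}"
    then obtain b' where "b' \<in> row lam i" "b = g b'" "add_shift v (d \<circ> g) b' = c" by blast
    then show "b \<in> {b \<in> row lam i. add_shift v d b = c}" using eq[of b'] G_row[OF gG, of i] by auto
  qed
  then show ?thesis
    using inj_on_subset[OF bij_is_inj[OF G_D(2)[OF gG]]] by (simp add: value_count_def card_image)
qed

lemma value_count_blk:
  assumes a: "a \<in> I lam" "fst a < length lam" and d: "d \<in> shifts lam"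
  shows "value_count d (fst a) (v a + of_int t) = card {b. blk a b \<and> d b = t}"
proof -
  have "add_shift v d b = v a + of_int t \<longleftrightarrow> blk a b \<and> d b = t" if b: "b \<in> row lam (fst a)" for b
  proof
    assume eq: "add_shift v d b = v a + of_int t"
    then have "v a - v b = of_int (d b - t)" by (simp add: add_shift_def algebra_simps)
    then have ab: "blk a b" using a b by (intro v_diff_Ints) (auto simp: row_def)
    then show "blk a b \<and> d b = t" using eq blk_v[OF ab] by (simp add: add_shift_def)
  next
    assume "blk a b \<and> d b = t"
    then show "add_shift v d b = v a + of_int t" by (auto simp: add_shift_def blk_v)
  qed
  moreover have "b \<in> row lam (fst a)" if "blk a b" for b using that by (auto simp: row_def blk_def)
  ultimately have "{b \<in> row lam (fst a). add_shift v d b = v a + of_int t} = {b. blk a b \<and> d b = t}" by blast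
  then show ?thesis by (simp add: value_count_def)
qed

lemma finite_blk: "finite {b. blk a b}"
  by (rule finite_subset[OF _ finite_I[of lam]]) (auto dest: blk_I)

text \<open>In a block the entries at least \<open>t\<close> of a dominant shift form an initial segment, whose length is
  determined by the multiset of coordinates.\<close>

lemma dominant_unique_aux:
  assumes d: "dominant d" and d': "dominant d'" and eq: "\<And>i c. i < length lam \<Longrightarrow> value_count d i c = value_count d' i c"
    and a: "a \<in> I lam" "fst a < length lam"
  shows "d' a \<le> d a"
proof (rule ccontr)
  assume less: "\<not> d' a \<le> d a"
  have fin: "finite {b. blk a b \<and> P b}" for P
    by (rule finite_subset[OF _ finite_blk[of a]]) auto
  define T where "T = {s \<in> d ` {b. blk a b} \<union> d' ` {b. blk a b}. d' a \<le> s}"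
  have finT: "finite T" using finite_blk by (auto simp: T_def)
  have card: "card {b. blk a b \<and> d' a \<le> e b} = (\<Sum>s\<in>T. card {b. blk a b \<and> e b = s})" if "e = d \<or> e = d'" for e
  proof -
    have "{b. blk a b \<and> d' a \<le> e b} = (\<Union>s\<in>T. {b. blk a b \<and> e b = s})"
      using that by (auto simp: T_def)
    then show ?thesis by (simp add: card_UN_disjoint finT fin disjoint_iff)
  qed
  have "card {b. blk a b \<and> d' a \<le> d b} = card {b. blk a b \<and> d' a \<le> d' b}"
  proof -
    have "card {b. blk a b \<and> d b = s} = card {b. blk a b \<and> d' b = s}" for s
      using eq[OF a(2), of "v a + of_int s"] value_count_blk[OF a] dominant_shifts[OF d] dominant_shifts[OF d'] by simp
    then show ?thesis by (simp add: card)
  qed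
  moreover have "card {b. blk a b \<and> d' a \<le> d b} < card {b. blk a b \<and> d' a \<le> d' b}"
  proof (rule psubset_card_mono[OF fin])
    have "a \<in> {b. blk a b \<and> d' a \<le> d' b}" "a \<notin> {b. blk a b \<and> d' a \<le> d b}"
      using a less by (auto simp: blk_self)
    moreover have "{b. blk a b \<and> d' a \<le> d b} \<subseteq> {b. blk a b \<and> d' a \<le> d' b}"
    proof safe
      fix i j assume b: "blk a (i, j)" "d' a \<le> d (i, j)"
      then have "\<not> snd a \<le> snd (i, j)" using dominant_mono[OF d b(1)] less by auto
      then show "d' a \<le> d' (i, j)" using dominant_mono[OF d' blk_sym[OF b(1)]] by auto
    qed
    ultimately show "{b. blk a b \<and> d' a \<le> d b} \<subset> {b. blk a b \<and> d' a \<le> d' b}" by blast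
  qed
  ultimately show False by simp
qed

lemma dominant_unique:
  assumes "dominant d" "dominant d'" "\<And>i c. i < length lam \<Longrightarrow> value_count d i c = value_count d' i c"
  shows "d = d'"
proof
  fix a show "d a = d' a"
  proof (cases "a \<in> I lam \<and> fst a < length lam")
    case True
    then have "d' a \<le> d a" "d a \<le> d' a"
      using dominant_unique_aux[OF assms] dominant_unique_aux[OF assms(2,1) assms(3)[symmetric]] by simp_all
    then show ?thesis by simp
  next
    case False
    then have "d a = 0" "d' a = 0"
      using dominant_shifts[OF assms(1)] dominant_shifts[OF assms(2)] unfolding shifts_def by blast+
    then show ?thesis by simp
  qed
qed


section \<open>The module as a sum of local pieces\<close>

text \<open>The letters of a reduced word of a block-preserving permutation preserve the blocks, because a
  descent between two different blocks would have to reverse these blocks.\<close>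

lemma red_word_stab_blk_refl:
  "red_word lam as \<Longrightarrow> word_perm as \<in> stab lam v \<Longrightarrow> set as \<subseteq> blk_refl"
proof (induction as)
  case (Cons a as)
  define w where "w = word_perm (a # as)"
  have w: "w \<in> stab lam v" using Cons.prems(2) unfolding w_def .
  note r = red_word_Cons[OF Cons.prems(1), folded w_def]
  have aI: "a \<in> I lam" "next_idx a \<in> I lam" using r(1) by (auto simp: simple_idx_def)
  let ?x = "inv w a" and ?y = "inv w (next_idx a)"
  have bx: "blk a ?x" and "by": "blk (next_idx a) ?y" using stab_blk[OF stab_inv[OF w]] aI by auto
  have yx: "?y < ?x" using r(3) by (simp add: left_descent_def)
  then have "snd ?y < snd ?x" using blk_fst[OF bx] blk_fst[OF "by"] by (simp add: idx_less_iff)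
  have "blk a (next_idx a)"
  proof (cases "snd (next_idx a) \<le> snd ?x")
    case True
    then show ?thesis by (intro blk_convex[OF bx]) auto
  next
    case False
    then have "blk ?y a"
      using \<open>snd ?y < snd ?x\<close> blk_fst[OF "by"] by (intro blk_convex[OF blk_sym[OF "by"]]) auto
    then show ?thesis using blk_trans["OF" blk_sym blk_sym] "by" blk_sym blk_trans by blast
  qed
  then have a: "a \<in> blk_refl" by (rule hsI)
  have "word_perm as \<in> stab lam v" unfolding r(4)[symmetric] by (intro stab_comp blk_refl_stab a w)
  then show ?case using Cons.IH[OF r(2)] a by simp
qed simp

lemma local_fun_perm:
  assumes L: "L \<in> local_fun maxlen" and g: "g \<in> stab lam v" shows "(\<lambda>f. L (perm_act g f)) \<in> local_fun maxlen"
proof -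
  obtain as where as: "red_word lam as" "word_perm as = g" using red_word_ex[OF stab_G[OF g]] by blast
  then have "set as \<subseteq> blk_refl" using red_word_stab_blk_refl g by blast
  then have "(\<lambda>f. L (perm_act (word_perm as) f)) \<in> local_fun maxlen"
    using L
  proof (induction as arbitrary: L)
    case Nil
    then show ?case unfolding word_perm_simps(1) perm_act_id by simp
  next
    case (Cons a as)
    then have "word_perm as \<in> G lam" using blk_refl_simple by (intro word_perm_G) auto
    then have "perm_act (word_perm (a # as)) f = s_act a (perm_act (word_perm as) f)" for f
      unfolding word_perm_simps(2) by (intro perm_act_comp[symmetric] simple_refl_simps(4) G_D(2))
    then have eq: "(\<lambda>f. L (perm_act (word_perm (a # as)) f)) = (\<lambda>f. L (s_act a (perm_act (word_perm as) f)))"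
      by (simp only:)
    show ?case unfolding eq using Cons.IH[OF _ local_fun_s_act, of L a] Cons.prems by simp
  qed
  then show ?thesis by (simp add: as)
qed

text \<open>The functional \<open>L\<close> transported to the shifted point and restricted to the invariants.\<close>

definition twist :: "(idx \<Rightarrow> int) \<Rightarrow> (mrat \<Rightarrow> complex) \<Rightarrow> mrat \<Rightarrow> complex" where
  "twist d L = on_set (RG lam) (\<lambda>f. L (shift d f))"

lemma twist_eqI: "(\<And>f. f \<in> R lam \<Longrightarrow> L f = L' f) \<Longrightarrow> twist d L = twist d L'"
  by (simp add: twist_def on_set_def fun_eq_iff RG_R shift_R)

text \<open>Since invariants are fixed by permutations, a shift may be rearranged by the stabilizer at the cost of
  a permutation in the functional. So nothing is gained by admitting shifts that are not dominant.\<close>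

lemma twist_stab:
  assumes "g \<in> stab lam v" shows "twist d L = twist (d \<circ> g) (\<lambda>f. L (perm_act g f))"
proof -
  have g: "g \<in> G lam" using assms by (rule stab_G)
  have "perm_act g (shift (d \<circ> g) f) = shift d f" if "f \<in> RG lam" for f
  proof -
    have "d \<circ> g \<circ> inv g = d" using G_D(6)[OF g] by (simp add: fun_eq_iff)
    then show ?thesis by (simp add: perm_act_shift[OF G_D(2)[OF g]] RG_perm[OF that g])
  qed
  then show ?thesis by (simp add: twist_def on_set_def fun_eq_iff)
qed

definition M_car :: "(mrat \<Rightarrow> complex) set" where
  "M_car = {\<lambda>f. \<Sum>d\<in>J. twist d (L d) f | J L. finite J \<and> (\<forall>d\<in>J. dominant d \<and> L d \<in> local_fun maxlen)}"

lemma M_car_0: "(\<lambda>f. 0) \<in> M_car"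
  unfolding M_car_def by (rule CollectI, rule exI[of _ "{}"]) simp

lemma M_car_twist_dominant: "dominant d \<Longrightarrow> L \<in> local_fun maxlen \<Longrightarrow> twist d L \<in> M_car"
  unfolding M_car_def by (rule CollectI, rule exI[of _ "{d}"], rule exI[of _ "\<lambda>_. L"]) simp

lemma M_car_twist:
  assumes "d \<in> shifts lam" "L \<in> local_fun maxlen" shows "twist d L \<in> M_car"
proof -
  obtain g where "g \<in> stab lam v" "dominant (d \<circ> g)" using dominant_exists[OF assms(1)] by blast
  then show ?thesis using M_car_twist_dominant[OF _ local_fun_perm[OF assms(2)], of "d \<circ> g" g] twist_stab[of g d L] by simp
qed

lemma M_car_add:
  assumes "l \<in> M_car" "l' \<in> M_car" shows "(\<lambda>f. l f + l' f) \<in> M_car"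
proof -
  obtain J L where 1: "l = (\<lambda>f. \<Sum>d\<in>J. twist d (L d) f)" "finite J" "\<forall>d\<in>J. dominant d \<and> L d \<in> local_fun maxlen"
    using assms(1) unfolding M_car_def by blast
  obtain J' L' where 2: "l' = (\<lambda>f. \<Sum>d\<in>J'. twist d (L' d) f)" "finite J'" "\<forall>d\<in>J'. dominant d \<and> L' d \<in> local_fun maxlen"
    using assms(2) unfolding M_car_def by blast
  define K where "K d = (\<lambda>f. (if d \<in> J then L d f else 0) + (if d \<in> J' then L' d f else 0))" for d
  have "K d \<in> local_fun maxlen" if "d \<in> J \<union> J'" for d
  proof -
    have "(\<lambda>f. if d \<in> J then L d f else 0) \<in> local_fun maxlen" "(\<lambda>f. if d \<in> J' then L' d f else 0) \<in> local_fun maxlen"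
      using 1(3) 2(3) by (cases "d \<in> J"; cases "d \<in> J'"; simp add: local_fun_zero)+
    then show ?thesis unfolding K_def by (rule local_fun_add)
  qed
  moreover have "(\<lambda>f. l f + l' f) = (\<lambda>f. \<Sum>d\<in>J \<union> J'. twist d (K d) f)"
  proof
    fix f
    have "(\<Sum>d\<in>J. twist d (L d) f) = (\<Sum>d\<in>J \<union> J'. if d \<in> J then twist d (L d) f else 0)"
      using 1 2 by (intro sum.mono_neutral_cong_left) auto
    moreover have "(\<Sum>d\<in>J'. twist d (L' d) f) = (\<Sum>d\<in>J \<union> J'. if d \<in> J' then twist d (L' d) f else 0)"
      using 1 2 by (intro sum.mono_neutral_cong_left) auto
    moreover have "(if d \<in> J then twist d (L d) f else 0) + (if d \<in> J' then twist d (L' d) f else 0) = twist d (K d) f" for d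
      by (simp add: twist_def on_set_def K_def)
    ultimately show "l f + l' f = (\<Sum>d\<in>J \<union> J'. twist d (K d) f)"
      by (simp add: 1(1) 2(1) sum.distrib[symmetric])
  qed
  ultimately show ?thesis
    unfolding M_car_def using 1 2 by (intro CollectI exI[of _ "J \<union> J'"] exI[of _ K]) auto
qed

lemma M_car_scale:
  assumes "l \<in> M_car" shows "(\<lambda>f. c * l f) \<in> M_car"
proof -
  obtain J L where 1: "l = (\<lambda>f. \<Sum>d\<in>J. twist d (L d) f)" "finite J" "\<forall>d\<in>J. dominant d \<and> L d \<in> local_fun maxlen"
    using assms(1) unfolding M_car_def by blast
  have "c * twist d (L d) f = twist d (\<lambda>f. c * L d f) f" for d f by (simp add: twist_def on_set_def)
  then have "(\<lambda>f. c * l f) = (\<lambda>f. \<Sum>d\<in>J. twist d (\<lambda>f. c * L d f) f)"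
    by (simp add: 1(1) sum_distrib_left)
  then show ?thesis
    unfolding M_car_def using 1 by (intro CollectI exI[of _ J] exI[of _ "\<lambda>d f. c * L d f"]) (auto intro: local_fun_scale)
qed

lemma M_car_sum: "(\<And>a. a \<in> A \<Longrightarrow> l a \<in> M_car) \<Longrightarrow> (\<lambda>f. \<Sum>a\<in>A. l a f) \<in> M_car"
  by (induction A rule: infinite_finite_induct) (auto intro: M_car_0 M_car_add)

lemma M_car_outside: "l \<in> M_car \<Longrightarrow> f \<notin> RG lam \<Longrightarrow> l f = 0"
  by (auto simp: M_car_def twist_def on_set_def)

lemma M_car_linear:
  assumes "l \<in> M_car"
  shows "f \<in> RG lam \<Longrightarrow> g \<in> RG lam \<Longrightarrow> l (f + g) = l f + l g"
    and "f \<in> RG lam \<Longrightarrow> l (const c * f) = c * l f"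
proof -
  obtain J L where 1: "l = (\<lambda>f. \<Sum>d\<in>J. twist d (L d) f)" "finite J" "\<forall>d\<in>J. dominant d \<and> L d \<in> local_fun maxlen"
    using assms(1) unfolding M_car_def by blast
  { assume f: "f \<in> RG lam" and g: "g \<in> RG lam"
    have "twist d (L d) (f + g) = twist d (L d) f + twist d (L d) g" if "d \<in> J" for d
      using local_fun_linear(1)[of "L d" maxlen "shift d f" "shift d g"] 1(3) that f g
      by (simp add: twist_def on_set_def RG_add shift_simps shift_R RG_R)
    then show "l (f + g) = l f + l g" by (simp add: 1(1) sum.distrib) }
  { assume f: "f \<in> RG lam"
    then have cf: "const c * f \<in> RG lam" by auto
    have "twist d (L d) (const c * f) = c * twist d (L d) f" if "d \<in> J" for d
      using local_fun_linear(2)[of "L d" maxlen "shift d f" c] 1(3) that f cf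
      by (simp add: twist_def on_set_def shift_simps shift_R RG_R)
    then show "l (const c * f) = c * l f" by (simp add: 1(1) sum_distrib_left) }
qed


section \<open>The generators on local functionals\<close>

lemma ev_prod_nonzero:
  assumes "\<And>a. a \<in> A \<Longrightarrow> f a \<in> R lam \<and> ev v (f a) \<noteq> 0" shows "ev v (prod f A) \<noteq> 0"
  using assms
proof (induction A rule: infinite_finite_induct)
  case (insert x A)
  have "prod f A \<in> R lam" using insert.prems by (intro R_prod) blast
  then show ?case using insert by (simp add: ev_mult[where lam = lam])
qed simp_all

lemma add_of_int_eq_0: "x + of_int (m - n) = 0 \<Longrightarrow> x = (of_int (n - m) :: complex)"
  by (metis add_eq_0_iff2 minus_diff_eq of_int_minus)

text \<open>The coordinates in the block of \<open>a\<close> with the same shift as \<open>a\<close>: for a dominant shift they are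
  consecutive, and they are the coordinates of the shifted point equal to that of \<open>a\<close>.\<close>

definition grp :: "(idx \<Rightarrow> int) \<Rightarrow> idx \<Rightarrow> idx set" where
  "grp d a = {b. blk a b \<and> d b = d a}"

definition firsts :: "(idx \<Rightarrow> int) \<Rightarrow> nat \<Rightarrow> idx set" where
  "firsts d i = {a \<in> row lam i. \<forall>b\<in>grp d a. snd a \<le> snd b}"

definition grp_word :: "(idx \<Rightarrow> int) \<Rightarrow> idx \<Rightarrow> idx list" where
  "grp_word d a = rev (map (\<lambda>j. (fst a, snd a + j)) [0..<card (grp d a) - 1])"

lemma finite_grp: "finite (grp d a)"
  unfolding grp_def by (rule finite_subset[OF _ finite_blk[of a]]) auto

lemma grp_self: "a \<in> I lam \<Longrightarrow> a \<in> grp d a"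
  by (simp add: grp_def blk_self)

lemma grp_eq: "b \<in> grp d a \<Longrightarrow> grp d b = grp d a"
proof -
  assume "b \<in> grp d a"
  then have ab: "blk a b" "d b = d a" by (auto simp: grp_def)
  have "blk b c \<longleftrightarrow> blk a c" for c
    using blk_trans[OF ab(1), of c] blk_trans[OF blk_sym[OF ab(1)], of c] by blast
  then show "grp d b = grp d a" by (simp add: grp_def ab)
qed

lemma grp_row: "a \<in> row lam i \<Longrightarrow> grp d a \<subseteq> row lam i"
  by (auto simp: grp_def row_def blk_def)

lemma grp_interval:
  assumes d: "dominant d" and a: "a \<in> firsts d i"
  shows "grp d a = (\<lambda>l. (i, snd a + l)) ` {..card (grp d a) - 1}"
proof -
  have ai: "a \<in> I lam" "fst a = i" and min: "\<And>b. b \<in> grp d a \<Longrightarrow> snd a \<le> snd b"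
    using a by (auto simp: firsts_def row_def)
  define m where "m = Max (snd ` grp d a) - snd a"
  have ne: "grp d a \<noteq> {}" using grp_self[OF ai(1), of d] by blast
  have "Max (snd ` grp d a) \<in> snd ` grp d a" using finite_grp ne by (intro Max_in) auto
  then obtain c where c: "c \<in> grp d a" "snd c = Max (snd ` grp d a)" by auto
  have cm: "snd c = snd a + m" using min[OF c(1)] c(2) by (simp add: m_def)
  have eq: "grp d a = (\<lambda>l. (i, snd a + l)) ` {..m}"
  proof (intro set_eqI iffI)
    fix b assume b: "b \<in> grp d a"
    have "snd b \<le> snd c" unfolding c(2) using b finite_grp by simp
    moreover have "fst b = i" using b ai blk_fst[of a b] by (simp add: grp_def)
    ultimately show "b \<in> (\<lambda>l. (i, snd a + l)) ` {..m}"
      using min[OF b] cm by (intro image_eqI[of _ _ "snd b - snd a"]) (auto simp: prod_eq_iff)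
  next
    fix b assume "b \<in> (\<lambda>l. (i, snd a + l)) ` {..m}"
    then have b: "fst b = fst a" "snd a \<le> snd b" "snd b \<le> snd c" using ai cm by auto
    have ac: "blk a c" "d c = d a" using c(1) by (auto simp: grp_def)
    have ab: "blk a b" using blk_convex[OF ac(1) b] .
    have "d b \<le> d a" using dominant_mono[OF d ab b(2)] .
    moreover have "d c \<le> d b" using dominant_mono[OF d blk_trans[OF blk_sym[OF ab] ac(1)] b(3)] .
    ultimately show "b \<in> grp d a" using ab ac by (simp add: grp_def)
  qed
  have "card (grp d a) = Suc m" unfolding eq by (subst card_image) (auto simp: inj_on_def)
  then show ?thesis using eq by simp
qed

lemma grp_word_blk_refl:
  assumes d: "dominant d" and a: "a \<in> firsts d i"
  shows "set (grp_word d a) \<subseteq> blk_refl" "\<And>x. x \<in> set (grp_word d a) \<Longrightarrow> d (next_idx x) = d x"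
proof -
  have i: "fst a = i" using a by (auto simp: firsts_def row_def)
  have *: "x \<in> blk_refl \<and> d (next_idx x) = d x" if x: "x \<in> set (grp_word d a)" for x
  proof -
    obtain j where j: "x = (i, snd a + j)" "j < card (grp d a) - 1" using x i by (auto simp: grp_word_def)
    then have "x \<in> grp d a" "next_idx x \<in> grp d a"
      by (subst grp_interval[OF d a], force simp: next_idx_def)+
    then show ?thesis using blk_trans[OF blk_sym[of a x], of "next_idx x"] by (auto simp: grp_def intro: hsI)
  qed
  then show "set (grp_word d a) \<subseteq> blk_refl" "\<And>x. x \<in> set (grp_word d a) \<Longrightarrow> d (next_idx x) = d x" by auto
qed

lemma firsts_partition:
  assumes i: "i < length lam"
  shows "(\<Sum>c\<in>row lam i. h c) = (\<Sum>a\<in>firsts d i. \<Sum>c\<in>grp d a. (h c :: mrat))"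
proof -
  have "row lam i = (\<Union>a\<in>firsts d i. grp d a)"
  proof (intro set_eqI iffI)
    fix c assume c: "c \<in> row lam i"
    then have cI: "c \<in> I lam" by (simp add: row_def)
    have ne: "grp d c \<noteq> {}" using grp_self[OF cI, of d] by blast
    obtain a where a: "a \<in> grp d c" "\<And>b. b \<in> grp d c \<Longrightarrow> snd a \<le> snd b"
      using ex_min_if_finite[of "snd ` grp d c"] finite_grp ne
      by (metis (no_types, lifting) arg_min_if_finite(1) arg_min_least)
    have "a \<in> firsts d i" using a grp_row[OF c] grp_eq[OF a(1)] by (auto simp: firsts_def)
    moreover have "c \<in> grp d a" using grp_eq[OF a(1)] grp_self[OF cI] by simp
    ultimately show "c \<in> (\<Union>a\<in>firsts d i. grp d a)" by blast
  next
    fix c assume "c \<in> (\<Union>a\<in>firsts d i. grp d a)"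
    then show "c \<in> row lam i" using grp_row[of _ i d] by (auto simp: firsts_def)
  qed
  moreover have "(\<Sum>c\<in>(\<Union>a\<in>firsts d i. grp d a). h c) = (\<Sum>a\<in>firsts d i. \<Sum>c\<in>grp d a. h c)"
  proof (rule sum.UNION_disjoint)
    show "finite (firsts d i)" by (simp add: firsts_def)
    show "\<forall>a\<in>firsts d i. finite (grp d a)" by (simp add: finite_grp)
    show "\<forall>a\<in>firsts d i. \<forall>b\<in>firsts d i. a \<noteq> b \<longrightarrow> grp d a \<inter> grp d b = {}"
    proof (intro ballI impI, rule ccontr)
      fix a b assume a: "a \<in> firsts d i" and b: "b \<in> firsts d i" and "a \<noteq> b" "grp d a \<inter> grp d b \<noteq> {}"
      then have eq: "grp d a = grp d b" using grp_eq by blast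
      have "a \<in> grp d b" "b \<in> grp d a" using eq a b grp_self[of a d] grp_self[of b d] by (auto simp: firsts_def row_def)
      then have "snd a = snd b" using a b by (force simp: firsts_def intro: antisym)
      then show False using \<open>a \<noteq> b\<close> a b by (auto simp: firsts_def row_def prod_eq_iff)
    qed
  qed
  ultimately show ?thesis by simp
qed

text \<open>A generator, applied to a functional at a dominant shift, splits into one term for every group of
  equal coordinates of the shifted point. The poles inside a group are absorbed by divided differences.
  The other denominators do not vanish at the point; their product over the stabilizer is invariant, so
  multiplication by it only rescales functionals and the denominators can be cleared.\<close>

lemma gz_op_expansion:
  assumes d: "dominant d" and i: "1 \<le> i" "i < length lam" and i': "i' = i + 1 \<or> i' = i - 1"
  obtains H where "\<And>a. a \<in> row lam i \<Longrightarrow> H a \<in> R lam" "\<And>a. a \<in> row lam i \<Longrightarrow> ev v (H a) \<noteq> 0"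
    "\<And>L f. L \<in> local_fun maxlen \<Longrightarrow> f \<in> RG lam \<Longrightarrow> L (shift d (gz_op lam i i' s f))
        = (\<Sum>a\<in>firsts d i. L (dd (grp_word d a) (H a * shift (\<lambda>b. d b + delta a s b) f)))"
proof -
  define y where "y a b = shift d (X a - X b)" for a b
  have y: "y a b = X a - X b + const (of_int (d a - d b))" for a b
    by (simp add: y_def shift_simps const_simps)
  have yR: "y a b \<in> R lam" if "a \<in> I lam" "b \<in> I lam" for a b using that by (auto simp: y)
  have evy: "ev v (y a b) = v a - v b + of_int (d a - d b)" if "a \<in> I lam" "b \<in> I lam" for a b
    using that by (simp add: y ev_add[OF R_diff[OF R_X R_X] R_const, of a lam b] ev_diff[OF R_X R_X, of a lam b])
  \<comment> \<open>the factors of the denominator that come from outside the group of \<open>c\<close>\<close>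
  define den where "den c = (\<Prod>b\<in>row lam i - grp d c. y c b)" for c
  have rI: "c \<in> I lam" if "c \<in> row lam j" for c j using that by (auto simp: row_def)
  have denR: "den c \<in> R lam" if "c \<in> row lam i" for c
    unfolding den_def using yR[OF rI[OF that] rI] by (intro R_prod) blast
  have evden: "ev v (den c) \<noteq> 0" if c: "c \<in> row lam i" for c
  proof -
    have "ev v (y c b) \<noteq> 0" if b: "b \<in> row lam i - grp d c" for b
    proof
      assume "ev v (y c b) = 0"
      then have "v c - v b + of_int (d c - d b) = 0" using evy[OF rI[OF c] rI, of b i] b by simp
      then have 0: "v c - v b = of_int (d b - d c)" by (rule add_of_int_eq_0)
      then have "blk c b" using b c i by (intro v_diff_Ints) (auto simp: row_def)
      moreover from this have "d b = d c" using 0 blk_v[of c b] by simp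
      ultimately show False using b by (simp add: grp_def)
    qed
    then show ?thesis
      unfolding den_def using yR[OF rI[OF c] rI] by (intro ev_prod_nonzero) blast
  qed
  have stabR: "perm_act g f \<in> R lam" if "g \<in> stab lam v" "f \<in> R lam" for g f
    by (rule perm_act_R[OF G_D(1)[OF stab_G[OF that(1)]] that(2)])
  have fin: "finite (stab lam v)" by (rule finite_subset[OF _ finite_G[of lam]]) (auto simp: stab_G)
  define P where "P g c = perm_act g (den c)" for g c
  \<comment> \<open>the invariant common denominator; \<open>cof c\<close> is its cofactor with respect to \<open>den c\<close>\<close>
  define Q where "Q = (\<Prod>g\<in>stab lam v. \<Prod>c\<in>row lam i. P g c)"
  define cof where "cof c = (\<Prod>b\<in>row lam i - {c}. P id b) * (\<Prod>g\<in>stab lam v - {id}. \<Prod>b\<in>row lam i. P g b)" for c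
  have PR: "P g c \<in> R lam" "ev v (P g c) \<noteq> 0" if "g \<in> stab lam v" "c \<in> row lam i" for g c
    using stabR[OF that(1) denR[OF that(2)]] ev_stab[OF that(1) denR[OF that(2)]] evden[OF that(2)]
    by (simp_all add: P_def)
  have QR: "Q \<in> R lam" unfolding Q_def using PR by (intro R_prod) auto
  have evQ: "ev v Q \<noteq> 0"
    unfolding Q_def using PR by (intro ev_prod_nonzero conjI R_prod) blast+
  have cofR: "cof c \<in> R lam" for c
    unfolding cof_def using PR stab_id by (intro R_mult R_prod) auto
  have Qcof: "Q = den c * cof c" if c: "c \<in> row lam i" for c
  proof -
    have "Q = (\<Prod>b\<in>row lam i. P id b) * (\<Prod>g\<in>stab lam v - {id}. \<Prod>b\<in>row lam i. P g b)"
      unfolding Q_def by (rule prod.remove[OF fin stab_id])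
    also have "(\<Prod>b\<in>row lam i. P id b) = P id c * (\<Prod>b\<in>row lam i - {c}. P id b)"
      by (rule prod.remove) (use c in auto)
    finally show ?thesis unfolding cof_def P_def perm_act_id by (simp only: mult.assoc)
  qed
  have evcof: "ev v (cof c) \<noteq> 0" if c: "c \<in> row lam i" for c
    using evQ Qcof[OF c] ev_mult[OF denR[OF c] cofR, of v c] by auto
  have Qinv: "perm_act h Q = Q" if h: "h \<in> stab lam v" for h
  proof -
    have "perm_act h Q = (\<Prod>g\<in>stab lam v. \<Prod>c\<in>row lam i. P (h \<circ> g) c)"
      using h by (simp add: Q_def perm_act_simps[OF G_D(2)[OF stab_G[OF h]]] P_def perm_act_comp G_D(2)[OF stab_G])
    also have "\<dots> = Q" unfolding Q_def
    proof (rule prod.reindex_bij_betw)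
      show "bij_betw (\<lambda>g. h \<circ> g) (stab lam v) (stab lam v)"
        by (rule bij_betw_byWitness[where f' = "\<lambda>g. inv h \<circ> g"])
          (use G_D(6,7)[OF stab_G[OF h]] in \<open>auto simp: fun_eq_iff intro: stab_comp stab_inv h\<close>)
    qed
    finally show ?thesis .
  qed
  define num where "num c = (\<Prod>a\<in>row lam i'. y c a)" for c
  have numR: "num c \<in> R lam" if "c \<in> row lam i" for c
    unfolding num_def using yR[OF rI[OF that] rI] by (intro R_prod) blast
  have evnum: "ev v (num c) \<noteq> 0" if c: "c \<in> row lam i" for c
  proof -
    have "ev v (y c a) \<noteq> 0" if a: "a \<in> row lam i'" for a
    proof
      assume "ev v (y c a) = 0"
      then have "v c - v a + of_int (d c - d a) = 0" using evy[OF rI[OF c] rI[OF a]] by simp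
      then have e1: "v c - v a = of_int (d a - d c)" by (rule add_of_int_eq_0)
      have e2: "v a - v c = of_int (d c - d a)"
        using arg_cong[OF e1, of uminus] by (simp only: minus_diff_eq of_int_minus[symmetric])
      have "v c - v a \<in> \<int>" "v a - v c \<in> \<int>" unfolding e1 e2 by (rule Ints_of_int)+
      moreover have "1 \<le> i'" using a by (auto simp: row_def I_def)
      moreover have "i - 1 < length lam" "i - 1 + 1 = i" using i by auto
      ultimately show False using i' generic[OF i c, of a] generic[of "i - 1" a c] a c by auto
    qed
    then show ?thesis
      unfolding num_def using yR[OF rI[OF c] rI] by (intro ev_prod_nonzero) blast
  qed
  define H where "H a = const (1 / ev v Q) * (cof a * num a)" for a
  have HR: "H a \<in> R lam" if "a \<in> row lam i" for a
    unfolding H_def by (intro R_mult R_const cofR numR that)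
  have evH: "ev v (H a) \<noteq> 0" if "a \<in> row lam i" for a
    unfolding H_def ev_mult[OF R_const R_mult[OF cofR numR[OF that]]] ev_mult[OF cofR numR[OF that]]
    using evQ evcof[OF that] evnum[OF that] by simp
  have main: "L (shift d (gz_op lam i i' s f))
        = (\<Sum>a\<in>firsts d i. L (dd (grp_word d a) (H a * shift (\<lambda>b. d b + delta a s b) f)))"
    if L: "L \<in> local_fun maxlen" and f: "f \<in> RG lam" for L f
  proof -
    define N where "N c = shift d (gz_num lam i' s f c)" for c
    have N: "N c = num c * shift (\<lambda>b. d b + delta c s b) f" for c
      by (simp add: N_def gz_num_def shift_simps shift_shift num_def y_def)
    define F where "F c = cof c * N c" for c
    have frac: "Q * (N c / (\<Prod>b\<in>row lam i - {c}. y c b)) = F c / (\<Prod>b\<in>grp d c - {c}. X c - X b)"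
      if c: "c \<in> row lam i" for c
    proof -
      have "row lam i - {c} = (grp d c - {c}) \<union> (row lam i - grp d c)"
        using grp_row[OF c] grp_self[of c d] rI[OF c] by auto
      then have "(\<Prod>b\<in>row lam i - {c}. y c b) = (\<Prod>b\<in>grp d c - {c}. y c b) * den c"
        unfolding den_def by (simp add: prod.union_disjoint[symmetric] finite_grp Int_Diff disjoint_iff)
      moreover have "(\<Prod>b\<in>grp d c - {c}. y c b) = (\<Prod>b\<in>grp d c - {c}. X c - X b)"
        by (intro prod.cong) (auto simp: y grp_def const_simps)
      moreover have "den c \<noteq> 0" using evden[OF c] by auto
      ultimately show ?thesis by (simp add: Qcof[OF c] F_def)
    qed
    have "Q * shift d (gz_op lam i i' s f) = (\<Sum>c\<in>row lam i. Q * (N c / (\<Prod>b\<in>row lam i - {c}. y c b)))"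
      by (simp add: gz_op_def shift_simps(6,7,11) N_def y_def sum_distrib_left)
    also have "\<dots> = (\<Sum>c\<in>row lam i. F c / (\<Prod>b\<in>grp d c - {c}. X c - X b))"
      by (intro sum.cong refl frac)
    also have "\<dots> = (\<Sum>a\<in>firsts d i. \<Sum>c\<in>grp d a. F c / (\<Prod>b\<in>grp d c - {c}. X c - X b))"
      by (rule firsts_partition[OF i(2)])
    also have "\<dots> = (\<Sum>a\<in>firsts d i. dd (grp_word d a) (F a))"
    proof (rule sum.cong[OF refl])
      fix a assume a: "a \<in> firsts d i"
      have ai: "fst a = i" "a \<in> row lam i" using a by (auto simp: firsts_def row_def)
      let ?m = "card (grp d a) - 1"
      note int = grp_interval[OF d a]
      have step: "s_act x (F c) = F (simple_refl x c)" if x: "x \<in> set (grp_word d a)" and c: "c \<in> grp d a" for x c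
      proof -
        have xh: "x \<in> blk_refl" and dx: "d (next_idx x) = d x" using grp_word_blk_refl[OF d a] x by auto
        let ?t = "simple_refl x"
        have tG: "?t \<in> G lam" by (rule stab_G[OF blk_refl_stab[OF xh]])
        have "d (?t b) = d b" for b using dx by (cases "b = x"; cases "b = next_idx x") auto
        then have dt: "d \<circ> inv ?t = d" by (simp add: fun_eq_iff)
        have tN: "s_act x (N c) = N (?t c)"
          using dt by (simp add: N_def perm_act_shift gz_num_perm[OF tG f])
        have ty: "s_act x (y c b) = y (?t c) (?t b)" for b
          using dt by (simp add: y_def perm_act_shift s_act_simps)
        have tg: "?t b \<in> grp d (?t c) \<longleftrightarrow> b \<in> grp d c" if b: "b \<in> row lam i" for b
        proof -
          have c': "c \<in> row lam i" using c grp_row[OF ai(2)] by blast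
          have "blk c (?t c)" "blk b (?t b)" using stab_blk[OF blk_refl_stab[OF xh]] rI b c' by auto
          then have "blk (?t c) (?t b) \<longleftrightarrow> blk c b" using blk_trans blk_sym by blast
          then show ?thesis using \<open>\<And>b. d (?t b) = d b\<close> by (simp add: grp_def)
        qed
        have tden: "s_act x (den c) = den (?t c)"
        proof -
          have "bij_betw ?t (row lam i - grp d c) (row lam i - grp d (?t c))"
          proof (rule bij_betw_byWitness[where f' = ?t])
            have row: "?t b \<in> row lam i" if "b \<in> row lam i" for b using G_row[OF tG, of i] that by blast
            show "?t ` (row lam i - grp d c) \<subseteq> row lam i - grp d (?t c)"
            proof (rule image_subsetI)
              fix b assume "b \<in> row lam i - grp d c"
              then show "?t b \<in> row lam i - grp d (?t c)" using tg[of b] row[of b] by simp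
            qed
            show "?t ` (row lam i - grp d (?t c)) \<subseteq> row lam i - grp d c"
            proof (rule image_subsetI)
              fix b assume "b \<in> row lam i - grp d (?t c)"
              then show "?t b \<in> row lam i - grp d c" using tg[of "?t b"] row[of b] by simp
            qed
          qed simp_all
          from prod.reindex_bij_betw[OF this, of "y (?t c)"] show ?thesis
            by (simp add: den_def s_act_simps ty)
        qed
        have c': "c \<in> row lam i" "?t c \<in> row lam i" using c grp_row[OF ai(2)] G_row[OF tG, of i] by blast+
        have "den (?t c) * s_act x (cof c) = den (?t c) * cof (?t c)"
          using Qcof[OF c'(1)] Qcof[OF c'(2)] Qinv[OF blk_refl_stab[OF xh]] s_act_simps(3)[of x "den c" "cof c"] tden by simp
        moreover have "den (?t c) \<noteq> 0" using evden[OF c'(2)] by auto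
        ultimately have "s_act x (cof c) = cof (?t c)" by simp
        then show ?thesis by (simp add: F_def s_act_simps tN)
      qed
      have "(\<Sum>c\<in>grp d a. F c / (\<Prod>b\<in>grp d c - {c}. X c - X b)) = (\<Sum>c\<in>grp d a. F c / (\<Prod>b\<in>grp d a - {c}. X c - X b))"
        by (intro sum.cong refl) (simp add: grp_eq)
      also have "\<dots> = (\<Sum>c\<in>(\<lambda>l. (i, snd a + l)) ` {..?m}. F c / (\<Prod>b\<in>(\<lambda>l. (i, snd a + l)) ` {..?m} - {c}. X c - X b))"
        by (simp only: int[symmetric])
      also have "\<dots> = dd (rev (map (\<lambda>j. (i, snd a + j)) [0..<?m])) (F (i, snd a))"
      proof (rule symmetrized_fraction_interval)
        fix j c assume j: "j < ?m" and "c \<in> (\<lambda>l. (i, snd a + l)) ` {..?m}"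
        then have "c \<in> grp d a" by (simp only: int[symmetric])
        moreover have "(i, snd a + j) \<in> set (grp_word d a)" using j ai by (simp add: grp_word_def)
        ultimately show "s_act (i, snd a + j) (F c) = F (simple_refl (i, snd a + j) c)" by (intro step)
      qed
      also have "\<dots> = dd (grp_word d a) (F a)" unfolding grp_word_def ai(1)[symmetric] prod.collapse ..
      finally show "(\<Sum>c\<in>grp d a. F c / (\<Prod>b\<in>grp d c - {c}. X c - X b)) = dd (grp_word d a) (F a)" .
    qed
    finally have eq: "Q * shift d (gz_op lam i i' s f) = (\<Sum>a\<in>firsts d i. dd (grp_word d a) (F a))" .
    have FR: "F a \<in> R lam" if "a \<in> row lam i" for a
      unfolding F_def N by (intro R_mult cofR numR shift_R RG_R f that)
    have fr: "a \<in> row lam i" if "a \<in> firsts d i" for a using that by (simp add: firsts_def)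
    have ddF: "dd (grp_word d a) (F a) \<in> R lam" if "a \<in> firsts d i" for a
      by (rule words_R[OF grp_word_blk_refl(1)[OF d that] FR[OF fr[OF that]]])
    have Lsum: "L (sum h A) = (\<Sum>a\<in>A. L (h a))" if "\<And>a. a \<in> A \<Longrightarrow> h a \<in> R lam" for A :: "idx set" and h
      using that
    proof (induction A rule: infinite_finite_induct)
      case (insert x A)
      then show ?case using local_fun_linear(1)[OF L _ R_sum, of "h x" A h] by simp
    qed (use annD[OF ann_0 L] in simp_all)
    have gR: "shift d (gz_op lam i i' s f) \<in> R lam" using RG_R[OF gz_op_RG[OF f]] by auto
    have "ev v Q * L (shift d (gz_op lam i i' s f)) = L (Q * shift d (gz_op lam i i' s f))"
      using local_fun_mult_invariant[OF L QR _ gR] Qinv blk_refl_stab by simp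
    also have "\<dots> = (\<Sum>a\<in>firsts d i. L (dd (grp_word d a) (F a)))"
      unfolding eq by (rule Lsum[OF ddF])
    finally have "L (shift d (gz_op lam i i' s f)) = (\<Sum>a\<in>firsts d i. 1 / ev v Q * L (dd (grp_word d a) (F a)))"
      using evQ by (simp add: sum_distrib_left[symmetric] sum_divide_distrib[symmetric] field_simps)
    also have "\<dots> = (\<Sum>a\<in>firsts d i. L (dd (grp_word d a) (H a * shift (\<lambda>b. d b + delta a s b) f)))"
    proof (rule sum.cong[OF refl])
      fix a assume a: "a \<in> firsts d i"
      have "H a * shift (\<lambda>b. d b + delta a s b) f = const (1 / ev v Q) * F a"
        by (simp add: H_def F_def N mult_ac)
      then show "1 / ev v Q * L (dd (grp_word d a) (F a)) = L (dd (grp_word d a) (H a * shift (\<lambda>b. d b + delta a s b) f))"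
        using local_fun_linear(2)[OF L ddF[OF a], of "1 / ev v Q"] by (simp add: dd_const_mult)
    qed
    finally show ?thesis .
  qed
  show ?thesis by (rule that[OF HR evH main])
qed

lemma M_car_U:
  assumes "u \<in> U lam" "l \<in> M_car" shows "on_set (RG lam) (\<lambda>f. l (u f)) \<in> M_car"
proof -
  have from_twist: "on_set (RG lam) (\<lambda>f. l (u f)) \<in> M_car"
    if l: "l \<in> M_car" and twist: "\<And>d L. dominant d \<Longrightarrow> L \<in> local_fun maxlen \<Longrightarrow> on_set (RG lam) (\<lambda>f. twist d L (u f)) \<in> M_car" for l u
  proof -
    obtain J L where 1: "l = (\<lambda>f. \<Sum>d\<in>J. twist d (L d) f)" "finite J" "\<forall>d\<in>J. dominant d \<and> L d \<in> local_fun maxlen"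
      using l unfolding M_car_def by blast
    have "on_set (RG lam) (\<lambda>f. l (u f)) = (\<lambda>f. \<Sum>d\<in>J. on_set (RG lam) (\<lambda>f. twist d (L d) (u f)) f)"
      by (simp add: 1(1) on_set_def fun_eq_iff)
    also have "\<dots> \<in> M_car" by (rule M_car_sum, rule twist) (use 1(3) in blast)+
    finally show ?thesis .
  qed
  have "\<forall>l\<in>M_car. on_set (RG lam) (\<lambda>f. l (u f)) \<in> M_car"
    using assms(1)
  proof (induction rule: U_generic_induct)
    case one
    show ?case
    proof
      fix l assume l: "l \<in> M_car"
      have eq: "on_set (RG lam) (\<lambda>f. l (on_set (Omega lam) id f)) = l"
      proof
        fix f show "on_set (RG lam) (\<lambda>f. l (on_set (Omega lam) id f)) f = l f"
          using M_car_outside[OF l, of f] by (cases "f \<in> RG lam") (simp_all add: on_set_def R_subset_Omega RG_R)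
      qed
      show "on_set (RG lam) (\<lambda>f. l (on_set (Omega lam) id f)) \<in> M_car" unfolding eq by (rule l)
    qed
  next
    case (op u i i' s)
    have *: "on_set (RG lam) (\<lambda>f. twist d L (u f)) \<in> M_car" if d: "dominant d" and L: "L \<in> local_fun maxlen" for d L
    proof -
      obtain H where H: "\<And>a. a \<in> row lam i \<Longrightarrow> H a \<in> R lam"
        and "\<And>a. a \<in> row lam i \<Longrightarrow> ev v (H a) \<noteq> 0"
        and H': "\<And>L f. L \<in> local_fun maxlen \<Longrightarrow> f \<in> RG lam \<Longrightarrow> L (shift d (gz_op lam i i' s f))
          = (\<Sum>a\<in>firsts d i. L (dd (grp_word d a) (H a * shift (\<lambda>b. d b + delta a s b) f)))"
        by (rule gz_op_expansion[OF d op(1,2,3), where s = s]) (rule that)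
      define K where "K a = (\<lambda>f. L (dd (grp_word d a) (H a * f)))" for a
      have "on_set (RG lam) (\<lambda>f. twist d L (u f)) = (\<lambda>f. \<Sum>a\<in>firsts d i. twist (\<lambda>b. d b + delta a s b) (K a) f)"
        using H'[OF L] by (auto simp: on_set_def twist_def fun_eq_iff op(5) gz_op_RG K_def)
      also have "\<dots> \<in> M_car"
      proof (rule M_car_sum)
        fix a assume a: "a \<in> firsts d i"
        have r: "a \<in> row lam i" "a \<in> I lam" "fst a = i" using a by (auto simp: firsts_def row_def)
        have "K a \<in> local_fun maxlen"
          unfolding K_def by (rule local_fun_mult[OF local_fun_dd_top[OF L grp_word_blk_refl(1)[OF d a]] H[OF r(1)]])
        moreover have "(\<lambda>b. d b + delta a s b) \<in> shifts lam"
          using shifts_add[OF dominant_shifts[OF d] shifts_delta[OF r(2), of s]] r(3) op(2) by simp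
        ultimately show "twist (\<lambda>b. d b + delta a s b) (K a) \<in> M_car" by (rule M_car_twist[rotated])
      qed
      finally show ?thesis .
    qed
    show ?case by (rule ballI, erule from_twist, rule *)
  next
    case (mul u q)
    have *: "on_set (RG lam) (\<lambda>f. twist d L (u f)) \<in> M_car" if d: "dominant d" and L: "L \<in> local_fun maxlen" for d L
    proof -
      have "on_set (RG lam) (\<lambda>f. twist d L (u f)) = twist d (\<lambda>f. L (shift d q * f))"
        using RG_mult[OF mul(1)] by (simp add: on_set_def twist_def fun_eq_iff mul(3) shift_simps)
      also have "\<dots> \<in> M_car" by (rule M_car_twist_dominant[OF d local_fun_mult[OF L shift_R[OF RG_R[OF mul(1)]]]])
      finally show ?thesis .
    qed
    show ?case by (rule ballI, erule from_twist, rule *)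
  next
    case (add u u')
    have "on_set (RG lam) (\<lambda>f. l (u f + u' f)) \<in> M_car" if l: "l \<in> M_car" for l
    proof -
      have eq: "on_set (RG lam) (\<lambda>f. l (u f + u' f)) = (\<lambda>f. on_set (RG lam) (\<lambda>f. l (u f)) f + on_set (RG lam) (\<lambda>f. l (u' f)) f)"
        using M_car_linear(1)[OF l U_RG[OF add(1)] U_RG[OF add(2)]] by (auto simp: on_set_def fun_eq_iff)
      show ?thesis unfolding eq by (intro M_car_add) (use add.IH l in blast)+
    qed
    then show ?case by blast
  next
    case (scale u c)
    have "on_set (RG lam) (\<lambda>f. l (const c * u f)) \<in> M_car" if l: "l \<in> M_car" for l
    proof -
      have eq: "on_set (RG lam) (\<lambda>f. l (const c * u f)) = (\<lambda>f. c * on_set (RG lam) (\<lambda>f. l (u f)) f)"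
        using M_car_linear(2)[OF l U_RG[OF scale(1)]] by (auto simp: on_set_def fun_eq_iff)
      show ?thesis unfolding eq by (intro M_car_scale) (use scale.IH l in blast)
    qed
    then show ?case by blast
  next
    case (comp u u')
    have "on_set (RG lam) (\<lambda>f. l ((u \<circ> u') f)) \<in> M_car" if l: "l \<in> M_car" for l
    proof -
      have eq: "on_set (RG lam) (\<lambda>f. l ((u \<circ> u') f)) = on_set (RG lam) (\<lambda>f. on_set (RG lam) (\<lambda>f. l (u f)) (u' f))"
        using U_RG[OF comp(2)] by (auto simp: on_set_def fun_eq_iff)
      show ?thesis unfolding eq using comp.IH l by blast
    qed
    then show ?case by blast
  qed
  then show ?thesis using assms(2) by blast
qed

end

context gz_point
begin


section \<open>Interpolation by symmetric polynomials\<close>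

text \<open>With \<open>e = (x - c) / (c' - c)\<close> the polynomial \<open>(1 - e\<^sup>n)\<^sup>n\<close> in \<open>x\<close> is \<open>1\<close> to order \<open>n\<close> at \<open>c\<close> and \<open>0\<close> to
  order \<open>n\<close> at \<open>c'\<close>.\<close>

definition bump :: "complex \<Rightarrow> complex set \<Rightarrow> mrat \<Rightarrow> mrat" where
  "bump c C f = (\<Prod>c'\<in>C. (1 - (const (1 / (c' - c)) * (f - const c)) ^ maxlen) ^ maxlen)"

lemma bump_R: "f \<in> R lam \<Longrightarrow> bump c C f \<in> R lam"
  unfolding bump_def by (intro R_prod R_power R_diff R_1 R_mult R_const)

lemma bump_fhom: "fhom \<phi> \<Longrightarrow> \<phi> (bump c C f) = bump c C (\<phi> f)"
  by (simp add: bump_def fhomD)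

lemma ann_one_mult:
  assumes "p - 1 \<in> ann" "q - 1 \<in> ann" "q \<in> R lam" shows "p * q - 1 \<in> ann"
proof -
  have eq: "p * q - 1 = (p - 1) * q + (q - 1)" by (simp add: algebra_simps)
  show ?thesis unfolding eq by (rule ann_add[OF ann_mult'[OF assms(1,3)] assms(2)])
qed

lemma ann_one_prod:
  assumes "\<And>a. a \<in> A \<Longrightarrow> f a - 1 \<in> ann" "\<And>a. a \<in> A \<Longrightarrow> f a \<in> R lam" shows "prod f A - 1 \<in> ann"
  using assms
proof (induction A rule: infinite_finite_induct)
  case (insert x A)
  have "f x * prod f A - 1 \<in> ann" using insert by (intro ann_one_mult R_prod) blast+
  then show ?case using insert by simp
qed (simp_all add: ann_0)

lemma ann_one_power: "p - 1 \<in> ann \<Longrightarrow> p \<in> R lam \<Longrightarrow> p ^ n - 1 \<in> ann"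
proof (induction n)
  case (Suc n)
  then show ?case using ann_one_mult[of p "p ^ n"] by (simp add: R_power)
qed (simp add: ann_0)

lemma bump_one:
  assumes f: "f \<in> R lam" "ev v f = c" shows "bump c C f - 1 \<in> ann"
  unfolding bump_def
proof (rule ann_one_prod)
  fix c' assume "c' \<in> C"
  let ?e = "const (1 / (c' - c)) * (f - const c)"
  have e: "?e \<in> R lam" using f by (intro R_mult R_const R_diff)
  have "ev v ?e = 0"
    unfolding ev_mult[OF R_const R_diff[OF f(1) R_const]] ev_diff[OF f(1) R_const] using f by simp
  then have "?e ^ maxlen \<in> ann" by (rule ann_power[OF e])
  then have "1 - ?e ^ maxlen - 1 \<in> ann" using ann_uminus[of "?e ^ maxlen"] by simp
  then show "(1 - ?e ^ maxlen) ^ maxlen - 1 \<in> ann"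
    by (rule ann_one_power) (intro R_diff R_1 R_power e)
  show "(1 - ?e ^ maxlen) ^ maxlen \<in> R lam" by (intro R_diff R_1 R_power e)
qed

lemma bump_zero:
  assumes f: "f \<in> R lam" "ev v f \<in> C" and C: "finite C" "c \<notin> C" shows "bump c C f \<in> ann"
proof -
  define g where "g c' = (1 - (const (1 / (c' - c)) * (f - const c)) ^ maxlen) ^ maxlen" for c'
  have gR: "g c' \<in> R lam" for c'
    unfolding g_def using f by (intro R_power R_diff R_1 R_mult R_const)
  define c' where "c' = ev v f"
  have ne: "c' \<noteq> c" using f C by (auto simp: c'_def)
  let ?e = "const (1 / (c' - c)) * (f - const c)"
  have e: "?e \<in> R lam" using f by (intro R_mult R_const R_diff)
  have "ev v ?e = 1"
    unfolding ev_mult[OF R_const R_diff[OF f(1) R_const]] ev_diff[OF f(1) R_const]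
    using ne by (simp flip: c'_def)
  then have "ev v (1 - ?e ^ maxlen) = 0"
    using ev_diff[OF R_1 R_power[OF e], of v maxlen] ev_power[OF e, of v maxlen] by simp
  then have "g c' \<in> ann" unfolding g_def by (rule ann_power[rotated]) (intro R_diff R_1 R_power e)
  then have "g c' * (\<Prod>b\<in>C - {c'}. g b) \<in> ann" by (rule ann_mult') (intro R_prod gR)
  moreover have "bump c C f = g c' * (\<Prod>b\<in>C - {c'}. g b)"
    using prod.remove[OF C(1) f(2), of g] unfolding bump_def g_def c'_def .
  ultimately show ?thesis by simp
qed

text \<open>Near a point whose row \<open>i\<close> has the coordinate \<open>c\<close> only once, and its others in \<open>C\<close>, this symmetric
  polynomial behaves like a power of a single variable. With exponent \<open>0\<close> it counts the coordinates
  equal to \<open>c\<close>.\<close>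

definition row_bump :: "nat \<Rightarrow> complex \<Rightarrow> complex set \<Rightarrow> nat \<Rightarrow> mrat" where
  "row_bump i c C k = (\<Sum>b\<in>row lam i. (X b - const c) ^ k * bump c C (X b))"

lemma row_I: "b \<in> row lam i \<Longrightarrow> b \<in> I lam"
  using row_subset by blast

lemma row_bump_RG: "row_bump i c C k \<in> RG lam"
  unfolding row_bump_def
proof (rule row_sum_RG)
  fix b assume b: "b \<in> row lam i"
  show "(X b - const c) ^ k * bump c C (X b) \<in> R lam"
    by (intro R_mult R_power R_diff R_X R_const bump_R row_I[OF b])
next
  fix g b assume g: "g \<in> G lam"
  note h = perm_act_fhom[OF G_D(2)[OF g]]
  show "perm_act g ((X b - const c) ^ k * bump c C (X b)) = (X (g b) - const c) ^ k * bump c C (X (g b))"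
    by (simp add: fhomD[OF h] bump_fhom[OF h] perm_act_X[OF G_D(2)[OF g]])
qed

lemma shift_row_bump:
  "shift d (row_bump i c C k) = (\<Sum>b\<in>row lam i. (shift d (X b) - const c) ^ k * bump c C (shift d (X b)))"
  unfolding row_bump_def by (simp only: shift_simps bump_fhom[OF shift_fhom])

lemma ev_shift_X: "b \<in> I lam \<Longrightarrow> ev v (shift d (X b)) = add_shift v d b"
  using ev_shift'[OF R_X, of b lam v d] by simp

lemma row_bump_single:
  assumes a: "a \<in> row lam i" and C: "finite C" "add_shift v d a \<notin> C"
    and others: "\<And>b. b \<in> row lam i \<Longrightarrow> b \<noteq> a \<Longrightarrow> add_shift v d b \<in> C"
  shows "shift d (row_bump i (add_shift v d a) C k) - (X a - const (v a)) ^ k \<in> ann"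
proof -
  let ?c = "add_shift v d a"
  let ?t = "\<lambda>b. (shift d (X b) - const ?c) ^ k * bump ?c C (shift d (X b))"
  let ?y = "(X a - const (v a)) ^ k"
  have XR: "shift d (X b) \<in> R lam" if "b \<in> row lam i" for b
    by (intro shift_R R_X row_I[OF that])
  have y: "?y \<in> R lam" by (intro R_power R_diff R_X R_const row_I[OF a])
  have e: "shift d (X a) - const ?c = X a - const (v a)"
    by (simp add: add_shift_def const_simps(2))
  have "?t a - ?y = ?y * (bump ?c C (shift d (X a)) - 1)"
    unfolding e by (simp only: right_diff_distrib mult_1_right)
  then have 1: "?t a - ?y \<in> ann"
    using ann_mult[OF bump_one[OF XR[OF a] ev_shift_X[OF row_I[OF a]]] y] by simp
  have 2: "(\<Sum>b\<in>row lam i - {a}. ?t b) \<in> ann"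
  proof (rule ann_sum)
    fix b assume b: "b \<in> row lam i - {a}"
    then have bi: "b \<in> row lam i" "b \<noteq> a" by auto
    have "ev v (shift d (X b)) \<in> C" using others[OF bi] by (simp only: ev_shift_X[OF row_I[OF bi(1)]])
    then have "bump ?c C (shift d (X b)) \<in> ann" by (rule bump_zero[OF XR[OF bi(1)] _ C])
    then show "?t b \<in> ann" by (rule ann_mult) (intro R_power R_diff R_const XR bi)
  qed
  have "shift d (row_bump i ?c C k) = ?t a + (\<Sum>b\<in>row lam i - {a}. ?t b)"
    unfolding shift_row_bump by (rule sum.remove) (use a in simp_all)
  then have eq: "shift d (row_bump i ?c C k) - ?y = (?t a - ?y) + (\<Sum>b\<in>row lam i - {a}. ?t b)"
    by (simp only: diff_add_eq)
  show ?thesis unfolding eq by (rule ann_add[OF 1 2])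
qed

lemma ann_ev: "r \<in> ann \<Longrightarrow> ev v r = 0"
  using annD[OF _ ev_local_fun] .

lemma ann_one_ev: "p - 1 \<in> ann \<Longrightarrow> p \<in> R lam \<Longrightarrow> ev v p = 1"
  using ann_ev[of "p - 1"] ev_diff[OF _ R_1, of p lam v] by simp

lemma ev_row_bump:
  assumes C: "finite C" "c \<notin> C" and all: "\<And>b. b \<in> row lam i \<Longrightarrow> add_shift v d b \<in> insert c C"
  shows "ev v (shift d (row_bump i c C 0)) = of_nat (value_count d i c)"
proof -
  have XR: "shift d (X b) \<in> R lam" if "b \<in> row lam i" for b
    by (intro shift_R R_X row_I[OF that])
  have "ev v (shift d (row_bump i c C 0)) = (\<Sum>b\<in>row lam i. ev v (bump c C (shift d (X b))))"
    unfolding shift_row_bump power_0 mult_1_left by (rule ev_sum[where lam = lam]) (intro bump_R XR)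
  also have "\<dots> = (\<Sum>b\<in>row lam i. if add_shift v d b = c then 1 else 0)"
  proof (rule sum.cong[OF refl])
    fix b assume b: "b \<in> row lam i"
    show "ev v (bump c C (shift d (X b))) = (if add_shift v d b = c then 1 else 0)"
    proof (cases "add_shift v d b = c")
      case True
      then show ?thesis
        using ann_one_ev[OF bump_one[OF XR[OF b]] bump_R[OF XR[OF b]]] ev_shift_X[OF row_I[OF b], of d] by simp
    next
      case False
      then show ?thesis
        using ann_ev[OF bump_zero[OF XR[OF b] _ C]] all[OF b] ev_shift_X[OF row_I[OF b], of d] by simp
    qed
  qed
  also have "\<dots> = of_nat (value_count d i c)"
    by (simp add: value_count_def sum.If_cases Int_def)
  finally show ?thesis .
qed

text \<open>How often \<open>c\<close> occurs among the coordinates is the value of a symmetric polynomial, and composing it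
  with \<open>bump\<close> turns two different values into \<open>1\<close> and \<open>0\<close> to high order.\<close>

lemma separate:
  assumes "value_count d i c \<noteq> value_count d' i c"
  shows "\<exists>q\<in>RG lam. shift d q - 1 \<in> ann \<and> shift d' q \<in> ann"
proof -
  define C where "C = (add_shift v d ` row lam i \<union> add_shift v d' ` row lam i) - {c}"
  have C: "finite C" "c \<notin> C" by (simp_all add: C_def)
  define e where "e = row_bump i c C 0"
  have e: "e \<in> RG lam" unfolding e_def by (rule row_bump_RG)
  have ev: "ev v (shift d e) = of_nat (value_count d i c)" "ev v (shift d' e) = of_nat (value_count d' i c)"
    unfolding e_def by (rule ev_row_bump[OF C]; simp add: C_def)+
  define q where "q = bump (of_nat (value_count d i c)) {of_nat (value_count d' i c)} e"
  have "q \<in> RG lam"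
    unfolding q_def using RG_perm[OF e]
    by (intro RG_I bump_R RG_R[OF e]) (simp add: bump_fhom[OF perm_act_fhom[OF G_D(2)]])
  moreover have "shift d q - 1 \<in> ann"
    unfolding q_def bump_fhom[OF shift_fhom] by (rule bump_one[OF shift_R[OF RG_R[OF e]] ev(1)])
  moreover have "shift d' q \<in> ann"
    unfolding q_def bump_fhom[OF shift_fhom]
    by (rule bump_zero[OF shift_R[OF RG_R[OF e]]]) (use ev assms in simp_all)
  ultimately show ?thesis by blast
qed

lemma separate_many:
  assumes "finite J" "\<And>x. x \<in> J \<Longrightarrow> \<exists>i c. value_count d i c \<noteq> value_count (e x) i c"
  shows "\<exists>q\<in>RG lam. shift d q - 1 \<in> ann \<and> (\<forall>x\<in>J. shift (e x) q \<in> ann)"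
  using assms
proof (induction J rule: finite_induct)
  case empty
  show ?case by (rule bexI[of _ 1]) (simp_all add: shift_simps ann_0)
next
  case (insert x J)
  obtain q where q: "q \<in> RG lam" "shift d q - 1 \<in> ann" "\<forall>y\<in>J. shift (e y) q \<in> ann"
    using insert.IH insert.prems by blast
  obtain q' where q': "q' \<in> RG lam" "shift d q' - 1 \<in> ann" "shift (e x) q' \<in> ann"
    using insert.prems[of x] separate by blast
  have R: "shift y q \<in> R lam" "shift y q' \<in> R lam" for y
    by (intro shift_R RG_R q q')+
  have "shift (e y) (q * q') \<in> ann" if "y \<in> insert x J" for y
    unfolding shift_simps(3) using that q(3) q'(3) ann_mult[OF _ R(1)] ann_mult'[OF _ R(2)] by blast
  moreover have "shift d (q * q') - 1 \<in> ann"
    unfolding shift_simps(3) by (rule ann_one_mult[OF q(2) q'(2) R(2)])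
  ultimately show ?case using RG_mult[OF q(1) q'(1)] by blast
qed


section \<open>Submodules\<close>

text \<open>The submodules of the module with carrier \<open>M_car\<close>.\<close>

definition stable :: "(mrat \<Rightarrow> complex) set \<Rightarrow> bool" where
  "stable S \<longleftrightarrow> S \<subseteq> M_car \<and> (\<lambda>f. 0) \<in> S \<and> (\<forall>l\<in>S. \<forall>l'\<in>S. (\<lambda>f. l f + l' f) \<in> S) \<and>
    (\<forall>c. \<forall>l\<in>S. (\<lambda>f. c * l f) \<in> S) \<and> (\<forall>l\<in>S. \<forall>u\<in>U lam. on_set (RG lam) (\<lambda>f. l (u f)) \<in> S)"

text \<open>The part of \<open>S\<close> at the shift \<open>d\<close>, as functionals at the point \<open>v\<close> itself. In this form the parts at
  different shifts can be compared.\<close>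

definition piece :: "(mrat \<Rightarrow> complex) set \<Rightarrow> (idx \<Rightarrow> int) \<Rightarrow> (mrat \<Rightarrow> complex) set" where
  "piece S d = {L \<in> local_fun maxlen. twist d L \<in> S}"

lemma piece_local_fun: "L \<in> piece S d \<Longrightarrow> L \<in> local_fun maxlen" and piece_twist: "L \<in> piece S d \<Longrightarrow> twist d L \<in> S"
  by (simp_all add: piece_def)

lemma piece_cong: "L \<in> piece S d \<Longrightarrow> (\<And>f. f \<in> R lam \<Longrightarrow> L' f = L f) \<Longrightarrow> L' \<in> piece S d"
  using local_fun_cong[of L maxlen L'] twist_eqI[of L' L d] by (simp add: piece_def)

context
  fixes S
  assumes S: "stable S"
begin

lemma S_M_car: "l \<in> S \<Longrightarrow> l \<in> M_car"
  using S unfolding stable_def by blast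

lemma S_0: "(\<lambda>f. 0) \<in> S"
  using S unfolding stable_def by blast

lemma S_add: "l \<in> S \<Longrightarrow> l' \<in> S \<Longrightarrow> (\<lambda>f. l f + l' f) \<in> S"
  using S unfolding stable_def by blast

lemma S_scale: "l \<in> S \<Longrightarrow> (\<lambda>f. c * l f) \<in> S"
  using S unfolding stable_def by blast

lemma S_U: "l \<in> S \<Longrightarrow> u \<in> U lam \<Longrightarrow> on_set (RG lam) (\<lambda>f. l (u f)) \<in> S"
  using S unfolding stable_def by blast

lemma S_mult:
  assumes "l \<in> S" "q \<in> RG lam" shows "on_set (RG lam) (\<lambda>f. l (q * f)) \<in> S"
proof -
  have "on_set (RG lam) (\<lambda>f. l (mulop lam q f)) = on_set (RG lam) (\<lambda>f. l (q * f))"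
    by (simp add: on_set_def mulop_def fun_eq_iff RG_R R_subset_Omega)
  then show ?thesis using S_U[OF assms(1) mulop_RG[OF assms(2)]] by simp
qed

lemma piece_0: "(\<lambda>f. 0) \<in> piece S d"
  using local_fun_zero[of maxlen] S_0 by (simp add: piece_def twist_def on_set_def if_distrib cong: if_cong)

lemma piece_add: "L \<in> piece S d \<Longrightarrow> L' \<in> piece S d \<Longrightarrow> (\<lambda>f. L f + L' f) \<in> piece S d"
proof -
  assume 1: "L \<in> piece S d" "L' \<in> piece S d"
  have "twist d (\<lambda>f. L f + L' f) = (\<lambda>f. twist d L f + twist d L' f)" by (simp add: twist_def on_set_def fun_eq_iff)
  then show ?thesis using 1 local_fun_add[of L maxlen L'] S_add by (simp add: piece_def)
qed

lemma piece_scale: "L \<in> piece S d \<Longrightarrow> (\<lambda>f. c * L f) \<in> piece S d"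
proof -
  assume 1: "L \<in> piece S d"
  have "twist d (\<lambda>f. c * L f) = (\<lambda>f. c * twist d L f)" by (simp add: twist_def on_set_def fun_eq_iff)
  then show ?thesis using 1 local_fun_scale[of L maxlen c] S_scale by (simp add: piece_def)
qed

lemma piece_RG:
  assumes L: "L \<in> piece S d" and q: "q \<in> RG lam" shows "(\<lambda>f. L (shift d q * f)) \<in> piece S d"
proof -
  have "twist d (\<lambda>f. L (shift d q * f)) = on_set (RG lam) (\<lambda>f. twist d L (q * f))"
    using RG_mult[OF q] by (simp add: twist_def on_set_def fun_eq_iff shift_simps(3))
  then have "twist d (\<lambda>f. L (shift d q * f)) \<in> S" using S_mult[OF piece_twist[OF L] q] by simp
  then show ?thesis using local_fun_mult[OF piece_local_fun[OF L] shift_R[OF RG_R[OF q]]] by (simp add: piece_def)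
qed

text \<open>Distinct dominant shifts have different multisets of coordinates, so a symmetric polynomial that is
  \<open>1\<close> at one of them and \<open>0\<close> at the others cuts out a single summand.\<close>

lemma extract_component:
  assumes "l \<in> S" "l \<noteq> (\<lambda>f. 0)"
  shows "\<exists>d L. dominant d \<and> L \<in> piece S d \<and> twist d L \<noteq> (\<lambda>f. 0)"
proof -
  obtain J L where l: "l = (\<lambda>f. \<Sum>d\<in>J. twist d (L d) f)" and J: "finite J"
    and L: "\<And>d. d \<in> J \<Longrightarrow> dominant d \<and> L d \<in> local_fun maxlen"
    using S_M_car[OF assms(1)] unfolding M_car_def by blast
  have "\<exists>d\<in>J. twist d (L d) \<noteq> (\<lambda>f. 0)"
  proof (rule ccontr)
    assume "\<not> ?thesis"
    then have "twist d (L d) f = 0" if "d \<in> J" for d f using that by metis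
    then have "l = (\<lambda>f. 0)" unfolding l by (simp add: sum.neutral)
    then show False using assms by blast
  qed
  then obtain d where d: "d \<in> J" "twist d (L d) \<noteq> (\<lambda>f. 0)" by blast
  have "\<exists>q\<in>RG lam. shift d q - 1 \<in> ann \<and> (\<forall>x\<in>J - {d}. shift x q \<in> ann)"
  proof (rule separate_many)
    fix x assume x: "x \<in> J - {d}"
    then have "dominant d" "dominant x" "d \<noteq> x" using L d by blast+
    then show "\<exists>i c. value_count d i c \<noteq> value_count x i c" using dominant_unique[of d x] by blast
  qed (use J in simp)
  then obtain q where q: "q \<in> RG lam" "shift d q - 1 \<in> ann" "\<And>x. x \<in> J - {d} \<Longrightarrow> shift x q \<in> ann" by blast
  have "on_set (RG lam) (\<lambda>f. l (q * f)) = twist d (L d)"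
  proof
    fix f show "on_set (RG lam) (\<lambda>f. l (q * f)) f = twist d (L d) f"
    proof (cases "f \<in> RG lam")
      case f: True
      have qR: "shift x q \<in> R lam" and fR: "shift x f \<in> R lam" for x
        by (intro shift_R RG_R q f)+
      have twist: "twist x (L x) (q * f) = L x (shift x q * shift x f)" for x
        using RG_mult[OF q(1) f] by (simp add: twist_def on_set_def shift_simps(3))
      have "twist x (L x) (q * f) = 0" if x: "x \<in> J - {d}" for x
        unfolding twist using annD[OF ann_mult'[OF q(3)[OF x] fR]] L x by blast
      moreover have "twist d (L d) (q * f) = twist d (L d) f"
        unfolding twist using ann_eq[OF _ q(2) qR R_1 fR, of "L d"] L[OF d(1)] f by (simp add: twist_def on_set_def)
      ultimately have "l (q * f) = twist d (L d) f"
        unfolding l using sum.remove[OF J d(1), of "\<lambda>x. twist x (L x) (q * f)"] by simp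
      then show ?thesis using f by (simp add: on_set_def)
    qed (simp add: on_set_def twist_def)
  qed
  then have "twist d (L d) \<in> S" using S_mult[OF assms(1) q(1)] by simp
  then show ?thesis using d L[OF d(1)] unfolding piece_def by blast
qed

text \<open>A shortest functional of the part of a submodule at a shift is killed by all invariants that vanish at
  the shifted point, so it is a multiple of evaluation.\<close>

lemma socle:
  assumes L: "L \<in> piece S d" "twist d L \<noteq> (\<lambda>f. 0)" shows "ev v \<in> piece S d"
proof -
  define P where "P n \<longleftrightarrow> (\<exists>L. L \<in> local_fun n \<and> L \<in> piece S d \<and> twist d L \<noteq> (\<lambda>f. 0))" for n
  have "P maxlen" unfolding P_def using L piece_local_fun by blast
  then have Pn: "P (LEAST n. P n)" by (rule LeastI)
  obtain K where K: "K \<in> local_fun (LEAST n. P n)" "K \<in> piece S d" "twist d K \<noteq> (\<lambda>f. 0)"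
    using Pn unfolding P_def by blast
  have "(LEAST n. P n) \<noteq> 0"
  proof
    assume "(LEAST n. P n) = 0"
    then have "twist d K = (\<lambda>f. 0)" using local_fun_0[of K] K(1) by (simp add: twist_def on_set_def fun_eq_iff shift_R RG_R)
    then show False using K by blast
  qed
  then obtain m where m: "(LEAST n. P n) = Suc m" by (cases "LEAST n. P n") auto
  then have notP: "\<not> P m" using not_less_Least[of m P] by simp
  have val: "K (shift d q) = K 1 * ev v (shift d q)" if q: "q \<in> RG lam" for q
  proof -
    define c where "c = ev v (shift d q)"
    have qR: "shift d q \<in> R lam" by (intro shift_R RG_R q)
    define r where "r = shift d q - const c"
    have r: "r \<in> R lam" "ev v r = 0"
      unfolding r_def using qR by (auto simp: ev_diff[OF qR R_const] c_def)
    have "(\<lambda>f. K (shift d q * f) + (- c) * K f) \<in> piece S d" by (intro piece_add piece_RG piece_scale K q)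
    then have "(\<lambda>f. K (r * f)) \<in> piece S d"
    proof (rule piece_cong)
      fix f assume f: "f \<in> R lam"
      have eq: "r * f = shift d q * f + const (- c) * f" by (simp add: r_def const_simps(8) algebra_simps)
      show "K (r * f) = K (shift d q * f) + (- c) * K f"
        unfolding eq using local_fun_linear[OF K(1)] f qR by (simp add: R_mult)
    qed
    moreover have "(\<lambda>f. K (r * f)) \<in> local_fun m" using local_fun_mult_vanishing[OF _ r, of K m] K(1) m by simp
    ultimately have "twist d (\<lambda>f. K (r * f)) = (\<lambda>f. 0)" using notP unfolding P_def by blast
    from fun_cong[OF this, of 1] have "K r = 0" by (simp add: twist_def on_set_def shift_simps(1))
    moreover have "K (r + const c * 1) = K r + c * K 1"
      unfolding local_fun_linear(1)[OF K(1) r(1) R_mult[OF R_const R_1]] local_fun_linear(2)[OF K(1) R_1] ..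
    ultimately show ?thesis by (simp add: r_def c_def)
  qed
  have K1: "K 1 \<noteq> 0"
  proof
    assume "K 1 = 0"
    then have "twist d K = (\<lambda>f. 0)" using val by (simp add: twist_def on_set_def fun_eq_iff)
    then show False using K by blast
  qed
  have "twist d (ev v) = (\<lambda>f. 1 / K 1 * twist d K f)"
    using K1 val by (simp add: twist_def on_set_def fun_eq_iff)
  then show ?thesis using S_scale[OF piece_twist[OF K(2)], of "1 / K 1"] ev_local_fun by (simp add: piece_def)
qed

lemma firsts_grp_unique:
  assumes "a \<in> firsts d i" "b \<in> firsts d i" "b \<in> grp d a" shows "b = a"
proof -
  have ab: "fst a = i" "fst b = i" "a \<in> I lam" using assms by (auto simp: firsts_def row_def)
  have "a \<in> grp d b" using grp_eq[OF assms(3)] grp_self[OF ab(3), of d] by simp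
  then have "snd b \<le> snd a" "snd a \<le> snd b" using assms unfolding firsts_def by blast+
  then have "snd a = snd b" by simp
  then show ?thesis using ab by (simp add: prod_eq_iff)
qed

text \<open>The basic move: a generator followed by the projection to one of the resulting shifts.\<close>

lemma move:
  assumes d: "dominant d" and a: "a \<in> firsts d i" and i: "1 \<le> i" "i < length lam" and s: "s = 1 \<or> s = - 1"
  obtains h where "h \<in> R lam" "ev v h \<noteq> 0"
    "\<And>L. L \<in> piece S d \<Longrightarrow> (\<lambda>f. L (dd (grp_word d a) (h * f))) \<in> piece S (\<lambda>b. d b + delta a s b)"
proof -
  define i' where "i' = (if s = 1 then i + 1 else i - 1)"
  have i': "i' = i + 1 \<or> i' = i - 1" by (simp add: i'_def)
  have "\<exists>u\<in>U lam. \<forall>f\<in>RG lam. u f = gz_op lam i i' s f"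
  proof (cases "s = 1")
    case True
    then show ?thesis
      by (intro bexI[OF _ U_E[OF i]]) (simp add: E_op_Omega R_subset_Omega RG_R i'_def)
  next
    case False
    then have "s = - 1" using s by blast
    then show ?thesis
      by (intro bexI[OF _ U_F[OF i]]) (simp add: F_op_Omega R_subset_Omega RG_R i'_def)
  qed
  then obtain u where u: "u \<in> U lam" "\<And>f. f \<in> RG lam \<Longrightarrow> u f = gz_op lam i i' s f" by blast
  obtain H where H: "\<And>a. a \<in> row lam i \<Longrightarrow> H a \<in> R lam" "\<And>a. a \<in> row lam i \<Longrightarrow> ev v (H a) \<noteq> 0"
    and H': "\<And>L f. L \<in> local_fun maxlen \<Longrightarrow> f \<in> RG lam \<Longrightarrow> L (shift d (gz_op lam i i' s f))
        = (\<Sum>a\<in>firsts d i. L (dd (grp_word d a) (H a * shift (\<lambda>b. d b + delta a s b) f)))"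
    by (rule gz_op_expansion[OF d i i', where s = s]) (rule that)
  have fr: "b \<in> row lam i" if "b \<in> firsts d i" for b using that by (simp add: firsts_def)
  let ?e = "\<lambda>x b. d b + delta x s b"
  have fin: "finite (firsts d i)" by (simp add: firsts_def)
  have "\<exists>q\<in>RG lam. shift (?e a) q - 1 \<in> ann \<and> (\<forall>x\<in>firsts d i - {a}. shift (?e x) q \<in> ann)"
  proof (rule separate_many)
    fix x assume x: "x \<in> firsts d i - {a}"
    \<comment> \<open>the new value of the moved coordinate occurs more often after moving \<open>a\<close> than after moving \<open>x\<close>\<close>
    define c where "c = add_shift v (?e a) a"
    have c: "c = v a + of_int (d a + s)" by (simp add: c_def add_shift_def delta_def)
    have xr: "x \<in> firsts d i" "x \<in> row lam i" "x \<noteq> a" using x fr by auto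
    have s0: "s \<noteq> 0" using s by auto
    have "value_count (?e x) i c < value_count (?e a) i c"
      unfolding value_count_def
    proof (rule psubset_card_mono)
      show "finite {b \<in> row lam i. add_shift v (?e a) b = c}" by simp
      have "{b \<in> row lam i. add_shift v (?e x) b = c} \<subseteq> {b \<in> row lam i. add_shift v (?e a) b = c} - {a}"
      proof (rule subsetI)
        fix b assume "b \<in> {b \<in> row lam i. add_shift v (?e x) b = c}"
        then have b: "b \<in> row lam i" "add_shift v (?e x) b = c" by auto
        have "b \<noteq> a"
        proof
          assume "b = a"
          then have "of_int (d a) = (of_int (d a + s) :: complex)" using b xr(3) c by (simp add: add_shift_def delta_def)
          then show False using s0 by (simp only: of_int_eq_iff)
        qed
        moreover have "b \<noteq> x"
        proof
          assume "b = x"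
          then have "v x + of_int (d x + s) = v a + of_int (d a + s)"
            using b c by (simp add: add_shift_def delta_def)
          then have "v a - v x + of_int (d a - d x) = 0" by (simp add: algebra_simps)
          then have ax: "v a - v x = of_int (d x - d a)" by (rule add_of_int_eq_0)
          then have blk: "blk a x"
            using fr[OF a] xr i by (intro v_diff_Ints) (auto simp: row_def)
          then have "d x = d a" using ax blk_v[OF blk] by simp
          then have "x \<in> grp d a" using blk by (simp add: grp_def)
          then show False using firsts_grp_unique[OF a xr(1)] xr(3) by blast
        qed
        ultimately show "b \<in> {b \<in> row lam i. add_shift v (?e a) b = c} - {a}"
          using b by (simp add: add_shift_def delta_def)
      qed
      moreover have "a \<in> {b \<in> row lam i. add_shift v (?e a) b = c}" using fr[OF a] by (simp add: c_def)
      ultimately show "{b \<in> row lam i. add_shift v (?e x) b = c} \<subset> {b \<in> row lam i. add_shift v (?e a) b = c}" by blast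
    qed
    then have "value_count (?e a) i c \<noteq> value_count (?e x) i c" by simp
    then show "\<exists>j c. value_count (?e a) j c \<noteq> value_count (?e x) j c" by blast
  qed (use fin in simp)
  then obtain q where q: "q \<in> RG lam" "shift (?e a) q - 1 \<in> ann"
    "\<And>x. x \<in> firsts d i - {a} \<Longrightarrow> shift (?e x) q \<in> ann" by blast
  have "(\<lambda>f. L (dd (grp_word d a) (H a * f))) \<in> piece S (?e a)" if L: "L \<in> piece S d" for L
  proof -
    define K where "K x = (\<lambda>f. L (dd (grp_word d x) (H x * f)))" for x
    have KS: "K x \<in> local_fun maxlen" if x: "x \<in> firsts d i" for x
      unfolding K_def by (rule local_fun_mult[OF local_fun_dd_top[OF piece_local_fun[OF L] grp_word_blk_refl(1)[OF d x]] H(1)[OF fr[OF x]]])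
    define l where "l = on_set (RG lam) (\<lambda>f. twist d L (u f))"
    have l: "l \<in> S" unfolding l_def by (rule S_U[OF piece_twist[OF L] u(1)])
    have lf: "l f = (\<Sum>x\<in>firsts d i. K x (shift (?e x) f))" if f: "f \<in> RG lam" for f
      using H'[OF piece_local_fun[OF L] f] f gz_op_RG[OF f] by (simp add: l_def on_set_def twist_def u(2) K_def)
    have "on_set (RG lam) (\<lambda>f. l (q * f)) = twist (?e a) (K a)"
    proof
      fix f show "on_set (RG lam) (\<lambda>f. l (q * f)) f = twist (?e a) (K a) f"
      proof (cases "f \<in> RG lam")
        case f: True
        have qR: "shift e q \<in> R lam" and fR: "shift e f \<in> R lam" for e
          by (intro shift_R RG_R q f)+
        have "K x (shift (?e x) (q * f)) = 0" if x: "x \<in> firsts d i - {a}" for x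
          unfolding shift_simps(3) using annD[OF ann_mult'[OF q(3)[OF x] fR] KS] x by blast
        moreover have "K a (shift (?e a) (q * f)) = K a (shift (?e a) f)"
          unfolding shift_simps(3) using ann_eq[OF KS[OF a] q(2) qR R_1 fR] by simp
        ultimately have "l (q * f) = K a (shift (?e a) f)"
          unfolding lf[OF RG_mult[OF q(1) f]]
          using sum.remove[OF fin a, of "\<lambda>x. K x (shift (?e x) (q * f))"] by simp
        then show ?thesis using f by (simp add: on_set_def twist_def)
      qed (simp add: on_set_def twist_def)
    qed
    then have "twist (?e a) (K a) \<in> S" using S_mult[OF l q(1)] by simp
    then show ?thesis using KS[OF a] by (simp add: piece_def K_def)
  qed
  then show ?thesis using that[OF H(1)[OF fr[OF a]] H(2)[OF fr[OF a]]] by blast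
qed

end

text \<open>The divided differences along a group lower the exponent of the linear form of its first
  variable one by one.\<close>

lemma ev_dd_top_power:
  assumes "set (rev (map (\<lambda>j. (i, p + j)) [0..<m])) \<subseteq> blk_refl" "(i, p) \<in> I lam" "F \<in> R lam"
  shows "ev v (dd (rev (map (\<lambda>j. (i, p + j)) [0..<m])) ((X (i, p) - const (v (i, p))) ^ m * F)) = ev v F"
  using assms
proof (induction m arbitrary: p F)
  case (Suc m)
  let ?b = "(i, p)"
  let ?w = "rev (map (\<lambda>j. (i, Suc p + j)) [0..<m])"
  have word: "rev (map (\<lambda>j. (i, p + j)) [0..<Suc m]) = ?w @ [?b]"
    by (simp add: upt_rec[of 0 "Suc m"] map_Suc_upt[symmetric] comp_def del: upt_Suc)
  have w: "set ?w \<subseteq> blk_refl" and b: "?b \<in> blk_refl" using Suc.prems(1) unfolding word by auto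
  have bs: "?b \<in> simple_idx lam" and nb: "(i, Suc p) \<in> I lam"
    using blk_refl_simple[OF b] by (auto simp: simple_idx_def next_idx_def)
  have vv: "v (i, Suc p) = v ?b" using blk_v[OF blk_refl_blk[OF b]] by (simp add: next_idx_def)
  define y0 y1 where "y0 = X ?b - const (v ?b)" and "y1 = X (i, Suc p) - const (v (i, Suc p))"
  have y0: "y0 \<in> R lam" "ev v y0 = 0" and y1: "y1 \<in> R lam" "ev v y1 = 0"
    unfolding y0_def y1_def using Suc.prems(2) nb
    by (auto simp: ev_diff[OF R_X[OF Suc.prems(2)] R_const] ev_diff[OF R_X[OF nb] R_const])
  have sy: "s_act ?b y0 = y1" and Dy: "D ?b y0 = 1"
  proof -
    show "s_act ?b y0 = y1" by (simp add: y0_def y1_def s_act_simps vv next_idx_def)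
    have "D ?b (X ?b + const (- v ?b)) = 1" unfolding D_add by (simp add: D_X)
    then show "D ?b y0 = 1" by (simp add: y0_def const_simps(8))
  qed
  have F: "F \<in> R lam" and DF: "D ?b F \<in> R lam" and Dp: "D ?b (y0 ^ m) \<in> R lam"
    using Suc.prems bs y0 by (auto intro!: D_R)
  have "D ?b (y0 ^ Suc m) = y0 * D ?b (y0 ^ m) + y1 ^ m"
    unfolding power_Suc2 D_leibniz by (simp add: Dy sy s_act_simps(5) mult.commute)
  then have "D ?b (y0 ^ Suc m * F) = (y0 * D ?b (y0 ^ m) + y1 ^ m) * F + y1 ^ Suc m * D ?b F"
    unfolding D_leibniz[of ?b "y0 ^ Suc m" F] by (simp only: s_act_simps(5) sy)
  then have expand: "D ?b (y0 ^ Suc m * F) = y0 * (D ?b (y0 ^ m) * F) + (y1 ^ m * F + y1 ^ Suc m * D ?b F)"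
    by (simp only: distrib_right mult.assoc add.assoc)
  have "s_act x y0 = y0" if "x \<in> set ?w" for x
    using that by (auto simp: y0_def s_act_simps next_idx_def)
  then have "dd ?w (y0 * (D ?b (y0 ^ m) * F)) = y0 * dd ?w (D ?b (y0 ^ m) * F)"
    by (rule dd_mult_invariant)
  then have 1: "ev v (dd ?w (y0 * (D ?b (y0 ^ m) * F))) = 0"
    using ev_mult[OF y0(1) words_R[OF w R_mult[OF Dp F]]] y0(2) by (simp only: mult_zero_left)
  have "(\<lambda>f. ev v (dd ?w f)) \<in> local_fun (Suc m)" by (rule local_fun_word[OF w]) simp
  from local_fun_0[OF local_fun_mult_power[OF this y1, of "Suc m", unfolded diff_self_eq_0] DF]
  have 2: "ev v (dd ?w (y1 ^ Suc m * D ?b F)) = 0" .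
  have 3: "ev v (dd ?w (y1 ^ m * F)) = ev v F"
    unfolding y1_def by (rule Suc.IH[OF w nb F])
  have R: "dd ?w (y0 * (D ?b (y0 ^ m) * F)) \<in> R lam" "dd ?w (y1 ^ m * F) \<in> R lam" "dd ?w (y1 ^ Suc m * D ?b F) \<in> R lam"
    by (intro words_R[OF w] R_mult R_power y0 y1 Dp F DF)+
  show ?case
    unfolding word dd_append dd_simps y0_def[symmetric] expand dd_add
    unfolding ev_add[OF R(1) R_add[OF R(2,3)]] ev_add[OF R(2,3)] 1 2 3 by simp
qed simp

end

context gz_point
begin


section \<open>Moving between dominant shifts\<close>

text \<open>At a regular shift no two coordinates of the shifted point in a row but the last coincide, so symmetric
  polynomials realize all jets.\<close>

definition regular :: "(idx \<Rightarrow> int) \<Rightarrow> bool" where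
  "regular d \<longleftrightarrow> (\<forall>a b. blk a b \<longrightarrow> a \<noteq> b \<longrightarrow> d a \<noteq> d b)"

lemma regularD: "regular d \<Longrightarrow> blk a b \<Longrightarrow> a \<noteq> b \<Longrightarrow> d a \<noteq> d b"
  unfolding regular_def by blast

lemma dominant_next: "dominant d \<Longrightarrow> x \<in> blk_refl \<Longrightarrow> d (next_idx x) \<le> d x"
  unfolding dominant_def by blast

lemma dominant_add_delta:
  assumes d: "dominant d" and a: "a \<in> I lam" "fst a < length lam"
    and 1: "\<And>x. x \<in> blk_refl \<Longrightarrow> next_idx x = a \<Longrightarrow> d a + s \<le> d x"
    and 2: "a \<in> blk_refl \<Longrightarrow> d (next_idx a) \<le> d a + s"
  shows "dominant (\<lambda>b. d b + delta a s b)"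
  unfolding dominant_def
proof (intro conjI ballI)
  show "(\<lambda>b. d b + delta a s b) \<in> shifts lam"
    by (intro shifts_add dominant_shifts[OF d] shifts_delta a)
  fix x assume x: "x \<in> blk_refl"
  consider "x = a" | "next_idx x = a" | "x \<noteq> a" "next_idx x \<noteq> a" by blast
  then show "d (next_idx x) + delta a s (next_idx x) \<le> d x + delta a s x"
  proof cases
    case 1
    then show ?thesis using 2 x by (simp add: delta_def)
  next
    case 2
    then have "x \<noteq> a" by auto
    then show ?thesis using 1[OF x 2] 2 by (simp add: delta_def)
  next
    case 3
    then show ?thesis using dominant_next[OF d x] by (simp add: delta_def)
  qed
qed

lemma sum_delta: "a \<in> I lam \<Longrightarrow> (\<Sum>b\<in>I lam. delta a s b) = s"
  by (simp add: delta_def finite_I)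

lemma same_value_blk:
  assumes "a \<in> row lam i" "b \<in> row lam i" "i < length lam" "add_shift v d b = add_shift v e a + of_int n"
  shows "blk a b" "d b = e a + n"
proof -
  have "v a - v b + of_int (e a + n - d b) = (v a + of_int (e a) + of_int n) - (v b + of_int (d b))" by simp
  also have "\<dots> = 0" using assms(4) by (simp only: add_shift_def right_minus_eq)
  finally have eq: "v a - v b = of_int (d b - (e a + n))" by (rule add_of_int_eq_0)
  then show blk: "blk a b" using assms by (intro v_diff_Ints) (auto simp: row_def)
  have "of_int (d b - (e a + n)) = (0 :: complex)" unfolding eq[symmetric] using blk_v[OF blk] by simp
  then have "d b - (e a + n) = 0" by (simp only: of_int_eq_0_iff)
  then show "d b = e a + n" by simp
qed

lemma shifts_support: "d \<in> shifts lam \<Longrightarrow> e \<in> shifts lam \<Longrightarrow> d a \<noteq> e a \<Longrightarrow> a \<in> I lam \<and> fst a < length lam"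
  unfolding shifts_def by (metis (mono_tags, lifting) mem_Collect_eq)

text \<open>A regular dominant shift is reached from below by raising, again and again, a coordinate with the
  smallest column among those that are still too low. It is the first of its group, and its new value
  is not taken by another coordinate.\<close>

lemma climb:
  assumes t: "dominant t" "regular t"
    and step: "\<And>e a i. dominant e \<Longrightarrow> a \<in> firsts e i \<Longrightarrow> 1 \<le> i \<Longrightarrow> i < length lam \<Longrightarrow> a \<in> row lam i \<Longrightarrow>
      (\<And>b. b \<in> row lam i \<Longrightarrow> b \<noteq> a \<Longrightarrow> add_shift v e b \<noteq> add_shift v e a + 1) \<Longrightarrow>
      dominant (\<lambda>b. e b + delta a 1 b) \<Longrightarrow> Q e \<Longrightarrow> Q (\<lambda>b. e b + delta a 1 b)"
  shows "dominant d \<Longrightarrow> (\<And>a. d a \<le> t a) \<Longrightarrow> Q d \<Longrightarrow> Q t"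
proof (induction "nat (\<Sum>a\<in>I lam. t a - d a)" arbitrary: d rule: less_induct)
  case less
  note d = less.prems(1) and le = less.prems(2)
  show ?case
  proof (cases "\<exists>a. d a < t a")
    case False
    then have "d a = t a" for a using le[of a] by (metis order_le_less)
    then have "d = t" by (rule ext)
    then show ?thesis using less.prems(3) by simp
  next
    case True
    then obtain a where a: "d a < t a" and least: "\<And>b. d b < t b \<Longrightarrow> snd a \<le> snd b"
      using ex_has_least_nat[of "\<lambda>a. d a < t a" _ snd] by blast
    have aI: "a \<in> I lam" "fst a < length lam"
      using shifts_support[OF dominant_shifts[OF d] dominant_shifts[OF t(1)], of a] a by auto
    define i where "i = fst a"
    have i: "1 \<le> i" "i < length lam" "a \<in> row lam i" using aI by (auto simp: i_def I_def row_def)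
    have before: "t a < d b" if b: "blk a b" "snd b < snd a" for b
    proof -
      have "d b = t b" using least[of b] le[of b] b(2) by linarith
      moreover have "t a \<le> t b" using dominant_mono[OF t(1) blk_sym[OF b(1)]] b(2) by simp
      moreover have "t a \<noteq> t b" using regularD[OF t(2) b(1)] b(2) by blast
      ultimately show ?thesis by simp
    qed
    have first: "a \<in> firsts d i"
      unfolding firsts_def
    proof (intro CollectI conjI ballI i(3))
      fix b assume "b \<in> grp d a"
      then have b: "blk a b" "d b = d a" by (auto simp: grp_def)
      show "snd a \<le> snd b"
      proof (rule ccontr)
        assume "\<not> snd a \<le> snd b"
        then show False using before[OF b(1)] b(2) a by simp
      qed
    qed
    have free: "add_shift v d b \<noteq> add_shift v d a + 1" if b: "b \<in> row lam i" "b \<noteq> a" for b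
    proof
      assume eq: "add_shift v d b = add_shift v d a + 1"
      have ab: "blk a b" "d b = d a + 1" using same_value_blk[OF i(3) b(1) i(2), of d d 1] eq by auto
      show False
      proof (cases "snd b < snd a")
        case True
        then show False using before[OF ab(1)] ab(2) a by simp
      next
        case False
        then show False using dominant_mono[OF d ab(1)] ab(2) by simp
      qed
    qed
    let ?e = "\<lambda>b. d b + delta a 1 b"
    have e: "dominant ?e"
    proof (rule dominant_add_delta[OF d aI])
      fix x assume x: "x \<in> blk_refl" "next_idx x = a"
      have "blk a x" using blk_sym[OF blk_refl_blk[OF x(1)]] x(2) by simp
      moreover have "snd x < snd a" using x(2) by auto
      ultimately show "d a + 1 \<le> d x" using before[of x] a by linarith
    next
      assume "a \<in> blk_refl"
      then show "d (next_idx a) \<le> d a + 1" using dominant_next[OF d] by fastforce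
    qed
    have le': "?e b \<le> t b" for b using le[of b] a by (simp add: delta_def)
    have "(\<Sum>b\<in>I lam. t b - d b) = (\<Sum>b\<in>I lam. t b - ?e b) + 1"
      using sum_delta[OF aI(1), of 1] by (simp add: sum_subtractf sum.distrib)
    moreover have "0 \<le> (\<Sum>b\<in>I lam. t b - ?e b)" by (rule sum_nonneg) (use le' in simp)
    ultimately have "nat (\<Sum>b\<in>I lam. t b - ?e b) < nat (\<Sum>b\<in>I lam. t b - d b)" by linarith
    moreover have "Q ?e" by (rule step[OF d first i(1,2,3) free e less.prems(3)])
    ultimately show ?thesis using less.hyps[OF _ e le'] by blast
  qed
qed

text \<open>Regular dominant shifts above any bound, with gaps that leave room to move single coordinates.\<close>

definition stair :: "int \<Rightarrow> idx \<Rightarrow> int" where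
  "stair M a = (if a \<in> I lam \<and> fst a < length lam then M - 3 * int (snd a) else 0)"

lemma blk_length: "blk a b \<Longrightarrow> a \<noteq> b \<Longrightarrow> fst a < length lam"
  by (auto simp: blk_def)

lemma blk_snd: "blk a b \<Longrightarrow> a \<noteq> b \<Longrightarrow> snd a \<noteq> snd b"
  by (auto simp: blk_def prod_eq_iff)

lemma blk_refl_length: "x \<in> blk_refl \<Longrightarrow> fst x < length lam"
  by (rule blk_length[OF blk_refl_blk]) simp_all

lemma blk_refl_I: "x \<in> blk_refl \<Longrightarrow> x \<in> I lam" "x \<in> blk_refl \<Longrightarrow> next_idx x \<in> I lam"
  using blk_I[OF blk_refl_blk] by blast+

lemma stair_dominant: "dominant (stair M)"
  unfolding dominant_def
proof (intro conjI ballI)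
  show "stair M \<in> shifts lam" by (auto simp: shifts_def stair_def split: if_splits)
  fix x assume "x \<in> blk_refl"
  then show "stair M (next_idx x) \<le> stair M x" using blk_refl_I blk_refl_length by (simp add: stair_def)
qed

lemma stair_regular: "regular (stair M)"
  unfolding regular_def
proof (intro allI impI)
  fix a b assume ab: "blk a b" "a \<noteq> b"
  have "fst b = fst a" using blk_fst[OF ab(1)] by simp
  then show "stair M a \<noteq> stair M b"
    using blk_length[OF ab] blk_snd[OF ab] blk_I[OF ab(1)] by (simp add: stair_def)
qed

lemma stair_above:
  assumes d: "d \<in> shifts lam" and M: "(\<Sum>a\<in>I lam. \<bar>d a\<bar> + 3 * int (snd a)) \<le> M"
  shows "d a \<le> stair M a"
proof (cases "a \<in> I lam \<and> fst a < length lam")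
  case True
  have "\<bar>d a\<bar> + 3 * int (snd a) \<le> (\<Sum>a\<in>I lam. \<bar>d a\<bar> + 3 * int (snd a))"
    by (rule member_le_sum) (use True finite_I in auto)
  then show ?thesis using True M by (simp add: stair_def)
next
  case False
  then have "d a = 0" using d unfolding shifts_def by blast
  moreover have "stair M a = 0" using False unfolding stair_def by (rule if_not_P)
  ultimately show ?thesis by simp
qed

lemma common_above:
  assumes "d \<in> shifts lam" "e \<in> shifts lam"
  shows "\<exists>t. dominant t \<and> regular t \<and> (\<forall>a. d a \<le> t a) \<and> (\<forall>a. e a \<le> t a)"
proof -
  define M where "M = max (\<Sum>a\<in>I lam. \<bar>d a\<bar> + 3 * int (snd a)) (\<Sum>a\<in>I lam. \<bar>e a\<bar> + 3 * int (snd a))"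
  have "d a \<le> stair M a" "e a \<le> stair M a" for a
    by (rule stair_above[OF assms(1)], simp add: M_def) (rule stair_above[OF assms(2)], simp add: M_def)
  then show ?thesis using stair_dominant stair_regular by blast
qed

lemma grp_single:
  assumes "a \<in> I lam" "\<And>b. blk a b \<Longrightarrow> b \<noteq> a \<Longrightarrow> d b \<noteq> d a"
  shows "grp d a = {a}" "grp_word d a = []" "a \<in> row lam i \<Longrightarrow> a \<in> firsts d i"
proof -
  show g: "grp d a = {a}"
  proof (rule equalityI, rule subsetI)
    fix b assume "b \<in> grp d a"
    then show "b \<in> {a}" using assms(2)[of b] unfolding grp_def by blast
  qed (use grp_self[OF assms(1)] in blast)
  show "grp_word d a = []" by (simp add: grp_word_def g)
  show "a \<in> row lam i \<Longrightarrow> a \<in> firsts d i" by (simp add: firsts_def g)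
qed

context
  fixes S
  assumes S: "stable S"
begin

text \<open>The moves along a climb only split groups. The resulting functional is a divided difference; a
  symmetric polynomial that behaves like a power of the raised variable, with the exponent equal to the
  number of letters, shows that it is not zero on the invariants.\<close>

lemma ev_climb:
  assumes t: "dominant t" "regular t" and d: "dominant d" "\<And>a. d a \<le> t a" and ev: "ev v \<in> piece S d"
  shows "ev v \<in> piece S t"
proof (rule climb[where Q = "\<lambda>e. ev v \<in> piece S e", OF t _ d ev])
  fix e a i
  assume e: "dominant e" and first: "a \<in> firsts e i" and i: "1 \<le> i" "i < length lam" and a: "a \<in> row lam i"
    and free: "\<And>b. b \<in> row lam i \<Longrightarrow> b \<noteq> a \<Longrightarrow> add_shift v e b \<noteq> add_shift v e a + 1"
    and e': "dominant (\<lambda>b. e b + delta a 1 b)" and ev: "ev v \<in> piece S e"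
  let ?e = "\<lambda>b. e b + delta a 1 b"
  obtain h where h: "h \<in> R lam" "ev v h \<noteq> 0"
    and move: "\<And>L. L \<in> piece S e \<Longrightarrow> (\<lambda>f. L (dd (grp_word e a) (h * f))) \<in> piece S ?e"
    by (rule move[OF S e first i, of 1]) (simp, rule that)
  define K where "K = (\<lambda>f. ev v (dd (grp_word e a) (h * f)))"
  have K: "K \<in> piece S ?e" unfolding K_def by (rule move[OF ev])
  define c C k where "c = add_shift v ?e a" and "C = add_shift v ?e ` (row lam i - {a})"
    and "k = card (grp e a) - 1"
  have c: "c = add_shift v e a + 1" by (simp add: c_def add_shift_def delta_def)
  have "c \<notin> C"
  proof
    assume "c \<in> C"
    then obtain b where b: "b \<in> row lam i" "b \<noteq> a" "c = add_shift v ?e b" unfolding C_def by blast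
    then have "add_shift v e b = add_shift v e a + 1" using c by (simp add: add_shift_def delta_def)
    then show False using free[OF b(1,2)] by blast
  qed
  moreover have "finite C" by (simp add: C_def)
  ultimately have "shift ?e (row_bump i c C k) - (X a - const (v a)) ^ k \<in> ann"
    unfolding c_def by (intro row_bump_single[OF a]) (auto simp: C_def)
  moreover have y: "(X a - const (v a)) ^ k \<in> R lam" by (intro R_power R_diff R_X R_const row_I[OF a])
  moreover have "shift ?e (row_bump i c C k) \<in> R lam" by (intro shift_R RG_R row_bump_RG)
  ultimately have "K (shift ?e (row_bump i c C k) * 1) = K ((X a - const (v a)) ^ k * 1)"
    by (intro ann_eq[OF piece_local_fun[OF K]] R_1)
  also have "\<dots> = ev v (dd (grp_word e a) ((X a - const (v a)) ^ k * h))"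
    by (simp add: K_def mult.commute)
  also have "\<dots> = ev v h"
  proof -
    have ai: "a = (i, snd a)" using a by (simp add: row_def prod_eq_iff)
    have w: "grp_word e a = rev (map (\<lambda>j. (i, snd a + j)) [0..<k])" using a by (simp add: grp_word_def k_def row_def)
    have "set (rev (map (\<lambda>j. (i, snd a + j)) [0..<k])) \<subseteq> blk_refl" using grp_word_blk_refl(1)[OF e first] unfolding w .
    from ev_dd_top_power[OF this _ h(1)] show ?thesis
      using row_I[OF a] unfolding w ai[symmetric] by blast
  qed
  finally have "twist ?e K (row_bump i c C k) \<noteq> 0" using h(2) row_bump_RG by (simp add: twist_def on_set_def)
  then have "twist ?e K \<noteq> (\<lambda>f. 0)" by auto
  then show "ev v \<in> piece S ?e" by (rule socle[OF S K])
qed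

text \<open>Multiplication by \<open>X a\<close> is imitated by a symmetric polynomial, because the value of the coordinate \<open>a\<close>
  occurs only once in its row. In the last row, which is not shifted, \<open>X a\<close> acts by a scalar.\<close>

lemma regular_mult:
  assumes d: "regular d" and r: "r \<in> R lam"
  shows "L \<in> piece S d \<Longrightarrow> (\<lambda>f. L (r * f)) \<in> piece S d"
  using r
proof (induction arbitrary: L rule: R_induct)
  case (const c)
  show ?case by (rule piece_cong[OF piece_scale[OF S const, of c]]) (rule local_fun_linear(2)[OF piece_local_fun[OF const]])
next
  case (X a L)
  note L = piece_local_fun[OF X(2)]
  have split: "L (X a * f) = L ((X a - const (v a)) * f) + v a * L f" if f: "f \<in> R lam" for f
  proof -
    have eq: "X a * f = (X a - const (v a)) * f + const (v a) * f" by (simp add: algebra_simps)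
    show ?thesis
      unfolding eq local_fun_linear(1)[OF L R_mult[OF R_diff[OF R_X[OF X(1)] R_const] f] R_mult[OF R_const f]]
        local_fun_linear(2)[OF L f] ..
  qed
  show ?case
  proof (cases "fst a < length lam")
    case True
    define i where "i = fst a"
    have a: "a \<in> row lam i" using X(1) by (simp add: row_def i_def)
    define c C where "c = add_shift v d a" and "C = add_shift v d ` (row lam i - {a})"
    have "c \<notin> C"
    proof
      assume "c \<in> C"
      then obtain b where b: "b \<in> row lam i" "b \<noteq> a" "c = add_shift v d b" unfolding C_def by blast
      then have "blk a b" "d b = d a" using same_value_blk[OF a b(1), of d d 0] True by (auto simp: c_def i_def)
      then show False using regularD[OF d, of a b] b(2) by auto
    qed
    moreover have "finite C" by (simp add: C_def)
    ultimately have "shift d (row_bump i c C 1) - (X a - const (v a)) ^ 1 \<in> ann"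
      unfolding c_def by (intro row_bump_single[OF a]) (auto simp: C_def)
    then have ann: "shift d (row_bump i c C 1) - (X a - const (v a)) \<in> ann" by simp
    have "(\<lambda>f. L (shift d (row_bump i c C 1) * f) + v a * L f) \<in> piece S d"
      by (intro piece_add[OF S] piece_RG[OF S] piece_scale[OF S] X(2) row_bump_RG)
    then show ?thesis
    proof (rule piece_cong)
      fix f assume f: "f \<in> R lam"
      have "L (shift d (row_bump i c C 1) * f) = L ((X a - const (v a)) * f)"
        by (intro ann_eq[OF L ann] shift_R RG_R row_bump_RG R_diff R_X R_const X(1) f)
      then show "L (X a * f) = L (shift d (row_bump i c C 1) * f) + v a * L f" using split[OF f] by simp
    qed
  next
    case False
    have "s_act b (X a) = X a" if b: "b \<in> blk_refl" for b
    proof -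
      have "fst b \<noteq> fst a" using blk_refl_length[OF b] False by auto
      then have "a \<noteq> b" "a \<noteq> next_idx b" by auto
      then show ?thesis by simp
    qed
    then have "L (X a * f) = v a * L f" if "f \<in> R lam" for f
      using local_fun_mult_invariant[OF L R_X[OF X(1)] _ that] by simp
    then show ?thesis by (rule piece_cong[OF piece_scale[OF S X(2), of "v a"]])
  qed
next
  case (add f g)
  have L: "L \<in> local_fun maxlen" by (rule piece_local_fun[OF add.prems])
  have "(\<lambda>h. L (f * h) + L (g * h)) \<in> piece S d" by (intro piece_add[OF S] add.IH add.prems)
  then show ?case
  proof (rule piece_cong)
    fix h assume "h \<in> R lam"
    then show "L ((f + g) * h) = L (f * h) + L (g * h)"
      unfolding distrib_right by (intro local_fun_linear(1)[OF L] R_mult add.hyps)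
  qed
next
  case (mult f g)
  have "(\<lambda>h. L (f * (g * h))) \<in> piece S d" using mult.IH(2)[OF mult.IH(1)[OF mult.prems]] .
  then show ?case by (simp add: mult.assoc)
qed

lemma regular_unit:
  assumes d: "regular d" and h: "h \<in> R lam" "ev v h \<noteq> 0" and L: "L \<in> local_fun maxlen"
    and Lh: "(\<lambda>f. L (h * f)) \<in> piece S d"
  shows "L \<in> piece S d"
proof -
  obtain p where p: "p \<in> R lam" "h * p - 1 \<in> ann" using ann_unit[OF h] by blast
  show ?thesis
  proof (rule piece_cong[OF regular_mult[OF d p(1) Lh]])
    fix f assume f: "f \<in> R lam"
    show "L f = L (h * (p * f))"
      using ann_eq[OF L p(2) R_mult[OF h(1) p(1)] R_1 f] by (simp add: mult.assoc)
  qed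
qed

lemma regular_grp:
  assumes "regular d" "a \<in> I lam"
  shows "grp_word d a = []" "a \<in> row lam i \<Longrightarrow> a \<in> firsts d i"
proof -
  have "d b \<noteq> d a" if "blk a b" "b \<noteq> a" for b using regularD[OF assms(1), of a b] that by simp
  note grp = grp_single[OF assms(2), of d, OF this]
  show "grp_word d a = []" by (rule grp(2))
  show "a \<in> row lam i \<Longrightarrow> a \<in> firsts d i" by (rule grp(3))
qed

text \<open>Between regular shifts a move multiplies functionals by a polynomial that is invertible modulo
  \<open>ann\<close>, so nothing is lost.\<close>

lemma regular_move:
  assumes d: "dominant d" "regular d" and a: "a \<in> row lam i" and i: "1 \<le> i" "i < length lam" and s: "s = 1 \<or> s = - 1"
    and e: "regular (\<lambda>b. d b + delta a s b)"
  shows "piece S d \<subseteq> piece S (\<lambda>b. d b + delta a s b)"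
proof
  fix L assume L: "L \<in> piece S d"
  obtain h where h: "h \<in> R lam" "ev v h \<noteq> 0"
    and move: "\<And>L. L \<in> piece S d \<Longrightarrow> (\<lambda>f. L (dd (grp_word d a) (h * f))) \<in> piece S (\<lambda>b. d b + delta a s b)"
    by (rule move[OF S d(1) regular_grp(2)[OF d(2) row_I[OF a] a] i s]) (rule that)
  have "(\<lambda>f. L (h * f)) \<in> piece S (\<lambda>b. d b + delta a s b)"
    using move[OF L] regular_grp(1)[OF d(2) row_I[OF a]] by simp
  then show "L \<in> piece S (\<lambda>b. d b + delta a s b)" by (rule regular_unit[OF e h piece_local_fun[OF L]])
qed

lemma regular_below:
  assumes t: "dominant t" "regular t" and d: "dominant d" "regular d" "\<And>a. d a \<le> t a"
  shows "piece S t = piece S d"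
proof -
  have "regular t \<and> piece S t = piece S d"
  proof (rule climb[where Q = "\<lambda>e. regular e \<and> piece S e = piece S d", OF t _ d(1,3)])
    fix e a i
    assume e: "dominant e" and i: "1 \<le> i" "i < length lam" and a: "a \<in> row lam i"
      and free: "\<And>b. b \<in> row lam i \<Longrightarrow> b \<noteq> a \<Longrightarrow> add_shift v e b \<noteq> add_shift v e a + 1"
      and e': "dominant (\<lambda>b. e b + delta a 1 b)" and Q: "regular e \<and> piece S e = piece S d"
    let ?e = "\<lambda>b. e b + delta a 1 b"
    have free': "e b \<noteq> e a + 1" if b: "blk a b" "b \<noteq> a" for b
    proof
      assume "e b = e a + 1"
      then have "add_shift v e b = add_shift v e a + 1" using blk_v[OF b(1)] by (simp add: add_shift_def)
      moreover have "b \<in> row lam i" using a blk_I[OF b(1)] blk_fst[OF b(1)] by (simp add: row_def)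
      ultimately show False using free b(2) by blast
    qed
    have reg: "regular ?e"
      unfolding regular_def
    proof (intro allI impI)
      fix x y assume xy: "blk x y" "x \<noteq> y"
      consider "x = a" | "y = a" | "x \<noteq> a" "y \<noteq> a" by blast
      then show "?e x \<noteq> ?e y"
      proof cases
        case 1
        then show ?thesis using free'[of y] xy by (simp add: delta_def)
      next
        case 2
        then show ?thesis using free'[of x] xy blk_sym[OF xy(1)] by (simp add: delta_def)
      next
        case 3
        then show ?thesis using regularD[of e, OF _ xy] Q by (simp add: delta_def)
      qed
    qed
    have "(\<lambda>b. ?e b + delta a (- 1) b) = e" by (simp add: delta_def fun_eq_iff)
    then have "piece S ?e \<subseteq> piece S e" using regular_move[OF e' reg a i, of "- 1"] Q by simp
    moreover have "piece S e \<subseteq> piece S ?e" using regular_move[OF e _ a i _ reg] Q by simp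
    ultimately show "regular ?e \<and> piece S ?e = piece S d" using reg Q by blast
  qed (use d in simp)
  then show ?thesis by blast
qed

lemma regular_piece_eq:
  assumes "dominant d" "regular d" "dominant e" "regular e" shows "piece S d = piece S e"
proof -
  obtain t where t: "dominant t" "regular t" "\<And>a. d a \<le> t a" "\<And>a. e a \<le> t a"
    using common_above[OF dominant_shifts[OF assms(1)] dominant_shifts[OF assms(3)]] by blast
  show ?thesis
    using regular_below[OF t(1,2) assms(1,2) t(3)] regular_below[OF t(1,2) assms(3,4) t(4)] by simp
qed

text \<open>Raising \<open>next_idx b\<close> onto \<open>b\<close> and then \<open>b\<close> away from it applies the divided difference at \<open>b\<close>.\<close>

lemma regular_D:
  assumes d: "dominant d" "regular d" and L: "L \<in> piece S d" and b: "b \<in> blk_refl"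
  shows "(\<lambda>f. L (D b f)) \<in> piece S d"
proof -
  let ?n = "next_idx b"
  define i where "i = fst b"
  have bI: "b \<in> I lam" "?n \<in> I lam" "fst b < length lam" using blk_refl_I[OF b] blk_refl_length[OF b] by auto
  have rows: "b \<in> row lam i" "?n \<in> row lam i" and i: "1 \<le> i" "i < length lam"
    using bI by (auto simp: row_def i_def I_def)
  \<comment> \<open>\<open>d0\<close> puts \<open>?n\<close> one step below \<open>b\<close>, \<open>d1\<close> makes them meet, \<open>d2\<close> separates them again\<close>
  define d0 where "d0 a = stair 0 a + delta ?n 2 a" for a
  define d1 where "d1 a = d0 a + delta ?n 1 a" for a
  define d2 where "d2 a = d1 a + delta b 1 a" for a
  have val: "stair 0 a = - 3 * int (snd a)" if "blk b a" for a
    using that bI(3) by (auto simp: stair_def blk_def)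
  have bn: "blk b ?n" by (rule blk_refl_blk[OF b])
  have domI: "dominant (\<lambda>a. stair 0 a + e a)"
    if e: "e \<in> shifts lam" and small: "\<And>a. e a \<le> 3" "\<And>a. 0 \<le> e a" for e
    unfolding dominant_def
  proof (intro conjI ballI)
    show "(\<lambda>a. stair 0 a + e a) \<in> shifts lam" by (intro shifts_add dominant_shifts[OF stair_dominant] e)
    fix x assume x: "x \<in> blk_refl"
    then have "stair 0 (next_idx x) = stair 0 x - 3" using blk_refl_I[OF x] blk_refl_length[OF x] by (simp add: stair_def)
    then show "stair 0 (next_idx x) + e (next_idx x) \<le> stair 0 x + e x"
      using small(1)[of "next_idx x"] small(2)[of x] by linarith
  qed
  have regI: "regular (\<lambda>a. stair 0 a + e a)"
    if small: "\<And>x y. blk x y \<Longrightarrow> snd x < snd y \<Longrightarrow> e y - e x < 3 * (int (snd y) - int (snd x))" for e :: "idx \<Rightarrow> int"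
  proof -
    have less: "stair 0 y + e y < stair 0 x + e x" if xy: "blk x y" "snd x < snd y" for x y
    proof -
      have "x \<noteq> y" using xy by auto
      then have "fst x < length lam" using blk_length[OF xy(1)] by blast
      then have "stair 0 x = - 3 * int (snd x)" "stair 0 y = - 3 * int (snd y)"
        using blk_I[OF xy(1)] blk_fst[OF xy(1)] by (simp_all add: stair_def)
      then show ?thesis using small[OF xy] by (simp add: right_diff_distrib)
    qed
    show ?thesis
      unfolding regular_def
    proof (intro allI impI)
      fix x y assume xy: "blk x y" "x \<noteq> y"
      then have "snd x < snd y \<or> snd y < snd x" using blk_snd by fastforce
      then show "stair 0 x + e x \<noteq> stair 0 y + e y" using less[OF xy(1)] less[OF blk_sym[OF xy(1)]] by auto
    qed
  qed
  have nb: "?n \<noteq> b" "b \<noteq> ?n" "snd ?n = Suc (snd b)" by simp_all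
  have delta_shifts: "delta ?n k \<in> shifts lam" "delta b k \<in> shifts lam" for k
    using bI by (auto intro: shifts_delta)
  have D0: "dominant d0"
    unfolding d0_def by (rule domI[OF delta_shifts(1)]) (simp_all add: delta_def)
  have R0: "regular d0"
    unfolding d0_def
  proof (rule regI)
    fix x y assume xy: "blk x y" "snd x < snd y"
    have "delta ?n 2 y \<le> 2" "0 \<le> delta ?n 2 x" by (simp_all add: delta_def)
    moreover have "int (snd x) + 1 \<le> int (snd y)" using xy(2) by simp
    ultimately show "delta ?n 2 y - delta ?n 2 x < 3 * (int (snd y) - int (snd x))" by (simp add: right_diff_distrib)
  qed
  have d1: "d1 = (\<lambda>a. stair 0 a + delta ?n 3 a)" by (simp add: d1_def d0_def delta_def fun_eq_iff)
  have D1: "dominant d1"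
    unfolding d1 by (rule domI[OF delta_shifts(1)]) (simp_all add: delta_def)
  have d2: "d2 = (\<lambda>a. stair 0 a + (delta ?n 3 a + delta b 1 a))" by (simp add: d2_def d1 fun_eq_iff)
  have D2: "dominant d2"
    unfolding d2 by (rule domI[OF shifts_add[OF delta_shifts]]) (simp_all add: delta_def)
  have R2: "regular d2"
    unfolding d2
  proof (rule regI)
    fix x y assume xy: "blk x y" "snd x < snd y"
    have e: "0 \<le> delta ?n 3 x" "0 \<le> delta b 1 x" by (simp_all add: delta_def)
    show "delta ?n 3 y + delta b 1 y - (delta ?n 3 x + delta b 1 x) < 3 * (int (snd y) - int (snd x))"
    proof (cases "y = ?n")
      case y: True
      show ?thesis
      proof (cases "x = b")
        case True
        then show ?thesis using y nb by (simp add: delta_def)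
      next
        case False
        have "fst x = fst b" using blk_fst[OF xy(1)] y by simp
        then have "snd x \<noteq> snd b" using False by (simp add: prod_eq_iff)
        then have "snd x < snd b" using xy(2) y by simp
        then show ?thesis using y nb e by (simp add: delta_def)
      qed
    next
      case False
      then have "delta ?n 3 y + delta b 1 y \<le> 1" by (simp add: delta_def)
      moreover have "int (snd x) + 1 \<le> int (snd y)" using xy(2) by simp
      ultimately show ?thesis using e by (simp add: right_diff_distrib)
    qed
  qed
  have B: "piece S d0 = piece S d" "piece S d2 = piece S d" by (rule regular_piece_eq[OF _ _ d]; fact)+
  obtain h where h: "h \<in> R lam" "ev v h \<noteq> 0"
    and move1: "\<And>L. L \<in> piece S d0 \<Longrightarrow> (\<lambda>f. L (dd (grp_word d0 ?n) (h * f))) \<in> piece S (\<lambda>b. d0 b + delta ?n 1 b)"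
    by (rule move[OF S D0 regular_grp(2)[OF R0 bI(2) rows(2)] i, of 1]) (simp, rule that)
  have L': "L \<in> local_fun maxlen" by (rule piece_local_fun[OF L])
  obtain p where p: "p \<in> R lam" "h * p - 1 \<in> ann" using ann_unit[OF h] by blast
  have "(\<lambda>f. L (p * f)) \<in> piece S d0" unfolding B by (rule regular_mult[OF d(2) p(1) L])
  from move1[OF this] have "(\<lambda>f. L (p * (h * f))) \<in> piece S d1"
    by (simp add: regular_grp(1)[OF R0 bI(2)] d1_def[abs_def])
  then have L1: "L \<in> piece S d1"
  proof (rule piece_cong)
    fix f assume f: "f \<in> R lam"
    have eq: "p * (h * f) = (h * p) * f" by (simp add: mult_ac)
    show "L f = L (p * (h * f))"
      unfolding eq using ann_eq[OF L' p(2) R_mult[OF h(1) p(1)] R_1 f] by simp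
  qed
  have grp: "grp d1 b = {b, ?n}"
  proof (intro set_eqI iffI)
    fix c assume "c \<in> grp d1 b"
    then have c: "blk b c" "d1 c = d1 b" by (auto simp: grp_def)
    show "c \<in> {b, ?n}"
    proof (rule ccontr)
      assume "c \<notin> {b, ?n}"
      then have ne: "c \<noteq> b" "c \<noteq> ?n" by auto
      then have "snd c \<noteq> snd b" using blk_snd[OF c(1)] by auto
      moreover have "d1 c = - 3 * int (snd c)" "d1 b = - 3 * int (snd b)"
        using val[OF c(1)] val[OF blk_self[OF bI(1)]] ne nb by (simp_all add: d1 delta_def)
      ultimately show False using c(2) by simp
    qed
  next
    fix c assume "c \<in> {b, ?n}"
    moreover have "d1 ?n = d1 b" using val[OF bn] val[OF blk_self[OF bI(1)]] nb by (simp add: d1 delta_def)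
    ultimately show "c \<in> grp d1 b" using bn blk_self[OF bI(1)] by (auto simp: grp_def)
  qed
  have first: "b \<in> firsts d1 i" using rows by (simp add: firsts_def grp)
  have word: "grp_word d1 b = [b]" using nb by (simp add: grp_word_def grp)
  obtain h' where h': "h' \<in> R lam" "ev v h' \<noteq> 0"
    and move2: "\<And>L. L \<in> piece S d1 \<Longrightarrow> (\<lambda>f. L (dd (grp_word d1 b) (h' * f))) \<in> piece S (\<lambda>a. d1 a + delta b 1 a)"
    by (rule move[OF S D1 first i, of 1]) (simp, rule that)
  have "(\<lambda>f. L (D b (h' * f))) \<in> piece S d2"
    using move2[OF L1] by (simp add: word d2_def[abs_def])
  then have "(\<lambda>f. L (D b f)) \<in> piece S d2"
    by (rule regular_unit[OF R2 h' local_fun_D_top[OF L' b]])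
  then show ?thesis unfolding B .
qed

lemma regular_full:
  assumes d: "dominant d" "regular d" and ev: "ev v \<in> piece S d"
  shows "L \<in> local_fun maxlen \<Longrightarrow> L \<in> piece S d"
proof (induction rule: local_fun.induct)
  case (local_fun_word as)
  have "set as \<subseteq> blk_refl \<Longrightarrow> (\<lambda>f. ev v (dd as f)) \<in> piece S d" for as
  proof (induction as rule: rev_induct)
    case Nil
    show ?case using ev by simp
  next
    case (snoc b as)
    then show ?case using regular_D[OF d, of "\<lambda>f. ev v (dd as f)" b] by simp
  qed
  then show ?case using local_fun_word by blast
next
  case (local_fun_cong L L')
  show ?case by (rule piece_cong[OF local_fun_cong.IH local_fun_cong.hyps(2)])
qed (intro piece_0[OF S] piece_add[OF S] piece_scale[OF S]; assumption)+

text \<open>Any dominant shift below a regular one is reached by lowering coordinates, the largest columns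
  first. The lowered coordinate is always alone in its group, so the moves are invertible.\<close>

lemma descend:
  assumes z: "dominant z" and full: "local_fun maxlen \<subseteq> piece S t" and t: "dominant t" "\<And>a. z a \<le> t a"
    and sep: "\<And>a b. blk a b \<Longrightarrow> snd b < snd a \<Longrightarrow> z a < t a \<Longrightarrow> t a < t b"
  shows "local_fun maxlen \<subseteq> piece S z"
  using full t sep
proof (induction "nat (\<Sum>a\<in>I lam. t a - z a)" arbitrary: t rule: less_induct)
  case less
  note full = less.prems(1) and t = less.prems(2) and le = less.prems(3) and sep = less.prems(4)
  show ?case
  proof (cases "\<exists>a. z a < t a")
    case False
    then have "t a = z a" for a using le[of a] by (metis order_le_less)
    then have "t = z" by (rule ext)
    then show ?thesis using full by simp
  next
    case True
    have supp: "a \<in> I lam \<and> fst a < length lam" if "z a < t a" for a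
      using shifts_support[OF dominant_shifts[OF z] dominant_shifts[OF t], of a] that by auto
    define A where "A = {a. z a < t a}"
    have "finite A" by (rule finite_subset[OF _ finite_I[of lam]]) (use supp in \<open>simp add: A_def subset_iff\<close>)
    moreover have "A \<noteq> {}" using True by (simp add: A_def)
    ultimately have "Max (snd ` A) \<in> snd ` A" "\<And>b. b \<in> A \<Longrightarrow> snd b \<le> Max (snd ` A)" by simp_all
    then obtain a where aA: "a \<in> A" and "\<And>b. b \<in> A \<Longrightarrow> snd b \<le> snd a" by (metis imageE)
    then have a: "z a < t a" and most: "\<And>b. z b < t b \<Longrightarrow> snd b \<le> snd a" by (simp_all add: A_def)
    have aI: "a \<in> I lam" "fst a < length lam" using supp[OF a] by auto
    define i where "i = fst a"
    have i: "1 \<le> i" "i < length lam" "a \<in> row lam i" using aI by (auto simp: i_def I_def row_def)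
    have after: "t b < t a" if b: "blk a b" "snd a < snd b" for b
    proof -
      have "t b = z b" using most[of b] le[of b] b(2) by linarith
      moreover have "z b \<le> z a" using dominant_mono[OF z b(1)] b(2) by simp
      ultimately show ?thesis using a by simp
    qed
    have single: "t b \<noteq> t a" if b: "blk a b" "b \<noteq> a" for b
    proof (cases "snd b < snd a")
      case True
      then show ?thesis using sep[OF b(1) _ a] by simp
    next
      case False
      then have "snd a < snd b" using blk_snd[OF b(1)] b(2) by force
      then show ?thesis using after[OF b(1)] by simp
    qed
    have g2: "grp_word t a = []" by (rule grp_single(2)[OF aI(1)]) (rule single)
    have g3: "a \<in> firsts t i" by (rule grp_single(3)[OF aI(1) _ i(3)]) (rule single)
    let ?e = "\<lambda>b. t b + delta a (- 1) b"
    obtain h where h: "h \<in> R lam" "ev v h \<noteq> 0"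
      and move: "\<And>L. L \<in> piece S t \<Longrightarrow> (\<lambda>f. L (dd (grp_word t a) (h * f))) \<in> piece S ?e"
      by (rule move[OF S t g3 i(1,2), of "- 1"]) (simp, rule that)
    obtain p where p: "p \<in> R lam" "h * p - 1 \<in> ann" using ann_unit[OF h] by blast
    have full': "local_fun maxlen \<subseteq> piece S ?e"
    proof
      fix L assume L: "L \<in> local_fun maxlen"
      have "(\<lambda>f. L (p * f)) \<in> piece S t" using local_fun_mult[OF L p(1)] full by blast
      from move[OF this] have "(\<lambda>f. L (p * (h * f))) \<in> piece S ?e" by (simp add: g2)
      then show "L \<in> piece S ?e"
      proof (rule piece_cong)
        fix f assume f: "f \<in> R lam"
        have eq: "p * (h * f) = (h * p) * f" by (simp add: mult_ac)
        show "L f = L (p * (h * f))"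
          unfolding eq using ann_eq[OF L p(2) R_mult[OF h(1) p(1)] R_1 f] by simp
      qed
    qed
    have e: "dominant ?e"
    proof (rule dominant_add_delta[OF t aI])
      fix x assume x: "x \<in> blk_refl" "next_idx x = a"
      then show "t a + - 1 \<le> t x" using dominant_next[OF t x(1)] by simp
    next
      assume "a \<in> blk_refl"
      then show "t (next_idx a) \<le> t a + - 1" using after[OF blk_refl_blk] by force
    qed
    have le': "z b \<le> ?e b" for b using le[of b] a by (simp add: delta_def)
    have sep': "?e x < ?e y" if xy: "blk x y" "snd y < snd x" "z x < ?e x" for x y
    proof -
      have zx: "z x < t x" using xy(3) by (simp add: delta_def split: if_splits)
      then have "snd x \<le> snd a" by (rule most)
      then have "y \<noteq> a" using xy(2) by auto
      then have "?e y = t y" by (simp add: delta_def)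
      moreover have "t x < t y" by (rule sep[OF xy(1,2) zx])
      moreover have "?e x \<le> t x" by (simp add: delta_def)
      ultimately show ?thesis by linarith
    qed
    have "(\<Sum>b\<in>I lam. t b - z b) = (\<Sum>b\<in>I lam. ?e b - z b) + 1"
      using sum_delta[OF aI(1), of "- 1"] by (simp add: sum_subtractf sum.distrib)
    moreover have "0 \<le> (\<Sum>b\<in>I lam. ?e b - z b)" by (rule sum_nonneg) (use le' in simp)
    ultimately have "nat (\<Sum>b\<in>I lam. ?e b - z b) < nat (\<Sum>b\<in>I lam. t b - z b)" by linarith
    then show ?thesis by (rule less.hyps[OF _ full' e le' sep'])
  qed
qed

text \<open>A submodule contains an evaluation, hence the evaluation at a regular shift, hence the whole part at
  this shift and at all regular ones, and so, descending from these, every part.\<close>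

theorem stable_simple: "S = {\<lambda>f. 0} \<or> S = M_car"
proof (cases "S = {\<lambda>f. 0}")
  case False
  then obtain l where "l \<in> S" "l \<noteq> (\<lambda>f. 0)" using S_0[OF S] by blast
  then obtain d L where d: "dominant d" and L: "L \<in> piece S d" "twist d L \<noteq> (\<lambda>f. 0)"
    using extract_component[OF S] by blast
  have ev: "ev v \<in> piece S d" by (rule socle[OF S L])
  have full: "local_fun maxlen \<subseteq> piece S z" if z: "dominant z" for z
  proof -
    obtain t where t: "dominant t" "regular t" "\<And>a. d a \<le> t a" "\<And>a. z a \<le> t a"
      using common_above[OF dominant_shifts[OF d] dominant_shifts[OF z]] by blast
    have "ev v \<in> piece S t" by (rule ev_climb[OF t(1,2) d t(3) ev])
    then have "local_fun maxlen \<subseteq> piece S t" using regular_full[OF t(1,2)] by blast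
    then show ?thesis
    proof (rule descend[OF z _ t(1) t(4)])
      fix a b assume ab: "blk a b" "snd b < snd a"
      have "t a \<le> t b" using dominant_mono[OF t(1) blk_sym[OF ab(1)]] ab(2) by simp
      moreover have "t a \<noteq> t b" using regularD[OF t(2) ab(1)] ab(2) by blast
      ultimately show "t a < t b" by simp
    qed
  qed
  have "M_car \<subseteq> S"
  proof
    fix l assume "l \<in> M_car"
    then obtain J L where l: "l = (\<lambda>f. \<Sum>d\<in>J. twist d (L d) f)" and J: "finite J"
      and dL: "\<And>d. d \<in> J \<Longrightarrow> dominant d \<and> L d \<in> local_fun maxlen"
      unfolding M_car_def by blast
    have "twist d (L d) \<in> S" if "d \<in> J" for d using full dL[OF that] piece_twist by blast
    with J have "(\<lambda>f. \<Sum>d\<in>J. twist d (L d) f) \<in> S"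
      by (induction J rule: finite_induct) (simp_all add: S_0[OF S] S_add[OF S])
    then show "l \<in> S" unfolding l .
  qed
  then show ?thesis using S_M_car[OF S] by blast
qed simp

end

end


section \<open>Quotients of simple modules\<close>

lemma
  assumes "right_module lam M"
  shows right_module_assoc: "x \<in> mcar M \<Longrightarrow> y \<in> mcar M \<Longrightarrow> z \<in> mcar M \<Longrightarrow> madd M (madd M x y) z = madd M x (madd M y z)"
    and right_module_zero_left: "x \<in> mcar M \<Longrightarrow> madd M (mzero M) x = x"
    and right_module_inverse: "x \<in> mcar M \<Longrightarrow> \<exists>y\<in>mcar M. madd M x y = mzero M"
proof -
  note conj = assms[unfolded right_module_def, THEN conjunct2, THEN conjunct2]
  show "x \<in> mcar M \<Longrightarrow> y \<in> mcar M \<Longrightarrow> z \<in> mcar M \<Longrightarrow> madd M (madd M x y) z = madd M x (madd M y z)"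
    by (rule conj[THEN conjunct1, rule_format])
  show "x \<in> mcar M \<Longrightarrow> madd M (mzero M) x = x"
    by (rule conj[THEN conjunct2, THEN conjunct2, THEN conjunct1, rule_format])
  show "x \<in> mcar M \<Longrightarrow> \<exists>y\<in>mcar M. madd M x y = mzero M"
    by (rule conj[THEN conjunct2, THEN conjunct2, THEN conjunct2, THEN conjunct1, rule_format])
qed

lemma
  assumes "right_module lam M"
  shows right_module_zero: "mzero M \<in> mcar M"
    and right_module_add_closed: "x \<in> mcar M \<Longrightarrow> y \<in> mcar M \<Longrightarrow> madd M x y \<in> mcar M"
    and right_module_commute: "x \<in> mcar M \<Longrightarrow> y \<in> mcar M \<Longrightarrow> madd M x y = madd M y x"
    and right_module_scale_closed: "x \<in> mcar M \<Longrightarrow> mscale M c x \<in> mcar M"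
    and right_module_scale_add: "x \<in> mcar M \<Longrightarrow> y \<in> mcar M \<Longrightarrow> mscale M c (madd M x y) = madd M (mscale M c x) (mscale M c y)"
    and right_module_act_closed: "x \<in> mcar M \<Longrightarrow> u \<in> U lam \<Longrightarrow> mact M x u \<in> mcar M"
    and right_module_act_add: "x \<in> mcar M \<Longrightarrow> y \<in> mcar M \<Longrightarrow> u \<in> U lam \<Longrightarrow> mact M (madd M x y) u = madd M (mact M x u) (mact M y u)"
    and right_module_act_plus: "x \<in> mcar M \<Longrightarrow> u \<in> U lam \<Longrightarrow> u' \<in> U lam \<Longrightarrow> mact M x (\<lambda>f. u f + u' f) = madd M (mact M x u) (mact M x u')"
    and right_module_act_scale: "x \<in> mcar M \<Longrightarrow> u \<in> U lam \<Longrightarrow> mact M x (\<lambda>f. const c * u f) = mscale M c (mact M x u)"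
    and right_module_act_comp: "x \<in> mcar M \<Longrightarrow> u \<in> U lam \<Longrightarrow> u' \<in> U lam \<Longrightarrow> mact M x (u \<circ> u') = mact M (mact M x u) u'"
    and right_module_act_one: "x \<in> mcar M \<Longrightarrow> mact M x (on_set (Omega lam) id) = x"
  using assms by (simp_all add: right_module_def)

lemma right_module_zero_right:
  assumes M: "right_module lam M" and x: "x \<in> mcar M" shows "madd M x (mzero M) = x"
  using right_module_commute[OF M x right_module_zero[OF M]] right_module_zero_left[OF M x] by simp

lemma right_module_cancel:
  assumes M: "right_module lam M" and x: "x \<in> mcar M" "madd M x x = x" shows "x = mzero M"
proof -
  obtain y where y: "y \<in> mcar M" "madd M x y = mzero M"
    using right_module_inverse[OF M x(1)] by blast
  have "madd M (madd M x x) y = madd M x (madd M x y)"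
    by (rule right_module_assoc[OF M x(1) x(1) y(1)])
  then show ?thesis using x y right_module_zero_right[OF M x(1)] by simp
qed

lemma submodule_zero:
  assumes M: "right_module lam M" shows "submodule lam M {mzero M}"
proof -
  have z: "mzero M \<in> mcar M" by (rule right_module_zero[OF M])
  have zz: "madd M (mzero M) (mzero M) = mzero M" by (rule right_module_zero_left[OF M z])
  have "mscale M c (mzero M) = mzero M" for c
    by (rule right_module_cancel[OF M right_module_scale_closed[OF M z]])
      (use right_module_scale_add[OF M z z] in \<open>simp add: zz\<close>)
  moreover have "mact M (mzero M) u = mzero M" if u: "u \<in> U lam" for u
    by (rule right_module_cancel[OF M right_module_act_closed[OF M z u]])
      (use right_module_act_add[OF M z z u] in \<open>simp add: zz\<close>)
  ultimately show ?thesis unfolding submodule_def using z zz by simp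
qed

text \<open>The zero submodule of a simple module is its only maximal one.\<close>

lemma simple_module_quotient_iso:
  assumes M: "simple_module lam M"
  shows "module_iso lam M (quot_module M (THE K. maximal_submodule lam M K))"
proof -
  have rm: "right_module lam M" and ne: "mcar M \<noteq> {mzero M}"
    and sub: "\<And>S. submodule lam M S \<Longrightarrow> S = {mzero M} \<or> S = mcar M"
    using M unfolding simple_module_def by blast+
  have z: "submodule lam M {mzero M}" by (rule submodule_zero[OF rm])
  have K: "(THE K. maximal_submodule lam M K) = {mzero M}"
  proof (rule the_equality)
    show "maximal_submodule lam M {mzero M}"
      unfolding maximal_submodule_def using z ne sub by blast
    show "K = {mzero M}" if "maximal_submodule lam M K" for K
      using that sub unfolding maximal_submodule_def by blast
  qed
  let ?Q = "quot_module M {mzero M}"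
  have coset: "coset M {mzero M} x = {x}" if "x \<in> mcar M" for x
    using right_module_zero_right[OF rm that] by (simp add: coset_def)
  have "bij_betw (\<lambda>x. {x}) (mcar M) (mcar ?Q)"
    unfolding quot_module_def using coset by (auto simp: bij_betw_def inj_on_def image_iff)
  then show ?thesis
    unfolding module_iso_def K
    by (intro exI[of _ "\<lambda>x. {x}"]) (simp add: quot_module_def coset right_module_add_closed[OF rm]
        right_module_scale_closed[OF rm] right_module_act_closed[OF rm])
qed

context gz_point
begin


section \<open>The module of the statement\<close>

lemma dual_module: "module dual_scale"
  by unfold_locales (simp_all add: dual_scale_def fun_eq_iff algebra_simps)

lemma dual_act_shift:
  assumes g: "g \<in> stab lam v" shows "dual_act g (add_shift v d) = add_shift v (d \<circ> inv g)"
proof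
  fix a
  have gG: "g \<in> G lam" by (rule stab_G[OF g])
  have "v (inv g a) = v a"
  proof (cases "a \<in> I lam")
    case True
    then show ?thesis using blk_v[OF stab_blk[OF stab_inv[OF g]], of a] by simp
  next
    case False
    then have "inv g a = a" by (rule permutes_not_in[OF permutes_inv[OF G_D(1)[OF gG]]])
    then show ?thesis by simp
  qed
  then show "dual_act g (add_shift v d) a = add_shift v (d \<circ> inv g) a"
    by (simp add: dual_act_def add_shift_def)
qed

lemma stab_orbit_eq: "(\<lambda>g. dual_act g (add_shift v d)) ` stab lam v = (\<lambda>g. add_shift v (d \<circ> g)) ` stab lam v"
proof (intro equalityI image_subsetI)
  fix g assume g: "g \<in> stab lam v"
  show "dual_act g (add_shift v d) \<in> (\<lambda>g. add_shift v (d \<circ> g)) ` stab lam v"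
    unfolding dual_act_shift[OF g] by (rule image_eqI[OF refl stab_inv[OF g]])
  have "add_shift v (d \<circ> g) = dual_act (inv g) (add_shift v d)"
    unfolding dual_act_shift[OF stab_inv[OF g]] inv_inv_eq[OF G_D(2)[OF stab_G[OF g]]] ..
  then show "add_shift v (d \<circ> g) \<in> (\<lambda>g. dual_act g (add_shift v d)) ` stab lam v"
    by (rule image_eqI[OF _ stab_inv[OF g]])
qed

lemma stab_orbits_eq: "stab_orbits lam v = {(\<lambda>g. add_shift v (d \<circ> g)) ` stab lam v | d. d \<in> shifts lam}"
  unfolding stab_orbits_def gimel_orbit_eq[OF v] using stab_orbit_eq by blast

lemma dominant_rel_iff:
  assumes d: "d \<in> shifts lam" shows "dominant_rel lam v (add_shift v d) \<longleftrightarrow> dominant d"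
proof -
  have "next_idx a \<in> idx_orbit (stab lam v) a \<longleftrightarrow> a \<in> blk_refl" if "a \<in> simple_idx lam" for a
    using that idx_orbit_eq[of a] by (auto simp: blk_refl_def simple_idx_def)
  moreover have "Re (add_shift v d a - v a) = d a" for a by (simp add: add_shift_def)
  ultimately show ?thesis
    unfolding dominant_rel_def dominant_def using d blk_refl_simple by auto
qed

lemma orbit_rep_eq:
  assumes d: "dominant d" shows "orbit_rep lam v ((\<lambda>g. add_shift v (d \<circ> g)) ` stab lam v) = add_shift v d"
  unfolding orbit_rep_def
proof (rule the_equality)
  have "add_shift v d \<in> (\<lambda>g. add_shift v (d \<circ> g)) ` stab lam v"
    by (rule image_eqI[OF _ stab_id]) simp
  then show "add_shift v d \<in> (\<lambda>g. add_shift v (d \<circ> g)) ` stab lam v \<and> dominant_rel lam v (add_shift v d)"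
    using d dominant_rel_iff[OF dominant_shifts[OF d]] by blast
next
  fix u assume "u \<in> (\<lambda>g. add_shift v (d \<circ> g)) ` stab lam v \<and> dominant_rel lam v u"
  then obtain g where g: "g \<in> stab lam v" "u = add_shift v (d \<circ> g)" "dominant_rel lam v (add_shift v (d \<circ> g))" by blast
  have "dominant (d \<circ> g)" using g(3) dominant_rel_iff[OF shifts_comp_stab[OF dominant_shifts[OF d] g(1)]] by blast
  then have "d \<circ> g = d" by (rule dominant_unique[OF _ d]) (rule value_count_stab[OF g(1)])
  then show "u = add_shift v d" using g(2) by simp
qed

lemma orbit_shift_eq:
  assumes d: "dominant d"
  shows "orbit_shift lam v ((\<lambda>g. add_shift v (d \<circ> g)) ` stab lam v) = on_set (Omega lam) (shift d)"
  unfolding orbit_shift_def orbit_rep_eq[OF d]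
proof (rule the_equality)
  show "on_set (Omega lam) (shift d) \<in> gimel lam
      \<and> (\<forall>f\<in>R lam. ev v (on_set (Omega lam) (shift d) f) = ev (add_shift v d) f)"
    using shift_gimel[OF dominant_shifts[OF d]] by (simp add: on_set_def R_subset_Omega ev_shift')
next
  fix \<xi> assume \<xi>: "\<xi> \<in> gimel lam \<and> (\<forall>f\<in>R lam. ev v (\<xi> f) = ev (add_shift v d) f)"
  then obtain e where e: "e \<in> shifts lam" "\<xi> = on_set (Omega lam) (shift e)" using gimel_shift by blast
  have "add_shift v e = add_shift v d"
    by (rule V_dual_eqI[OF add_shift_V_dual[OF v e(1)] add_shift_V_dual[OF v dominant_shifts[OF d]]])
      (use \<xi> e(2) in \<open>simp add: on_set_def R_subset_Omega ev_shift'\<close>)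
  then have "e = d" by (simp only: add_shift_inj)
  then show "\<xi> = on_set (Omega lam) (shift d)" using e(2) by simp
qed

lemma generator_eq:
  assumes d: "dominant d"
  shows "on_set (RG lam) (ev v \<circ> div_diff lam w \<circ> orbit_shift lam v ((\<lambda>g. add_shift v (d \<circ> g)) ` stab lam v))
    = twist d (\<lambda>f. ev v (div_diff lam w f))"
  unfolding orbit_shift_eq[OF d] by (simp add: twist_def on_set_def fun_eq_iff R_subset_Omega RG_R)

lemma generators_eq:
  "{on_set (RG lam) (ev v \<circ> div_diff lam w \<circ> orbit_shift lam v O') | O' w. O' \<in> stab_orbits lam v \<and> w \<in> stab lam v}
    = {twist d (\<lambda>f. ev v (div_diff lam w f)) | d w. dominant d \<and> w \<in> stab lam v}"
proof (intro equalityI subsetI)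
  fix l assume "l \<in> {on_set (RG lam) (ev v \<circ> div_diff lam w \<circ> orbit_shift lam v O') | O' w.
      O' \<in> stab_orbits lam v \<and> w \<in> stab lam v}"
  then obtain O' w where l: "l = on_set (RG lam) (ev v \<circ> div_diff lam w \<circ> orbit_shift lam v O')"
    and O: "O' \<in> stab_orbits lam v" and w: "w \<in> stab lam v" by blast
  obtain d where d: "d \<in> shifts lam" "O' = (\<lambda>g. add_shift v (d \<circ> g)) ` stab lam v"
    using O unfolding stab_orbits_eq by blast
  obtain g where g: "g \<in> stab lam v" "dominant (d \<circ> g)" using dominant_exists[OF d(1)] by blast
  have gG: "g \<in> G lam" by (rule stab_G[OF g(1)])
  have "O' = (\<lambda>h. add_shift v (d \<circ> g \<circ> h)) ` stab lam v"
    unfolding d(2)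
  proof (intro equalityI image_subsetI)
    fix h assume h: "h \<in> stab lam v"
    have "d \<circ> h = d \<circ> g \<circ> (inv g \<circ> h)" using G_D(6)[OF gG] by (simp add: fun_eq_iff)
    then show "add_shift v (d \<circ> h) \<in> (\<lambda>h. add_shift v (d \<circ> g \<circ> h)) ` stab lam v"
      by (intro image_eqI[OF _ stab_comp[OF stab_inv[OF g(1)] h]]) simp
    show "add_shift v (d \<circ> g \<circ> h) \<in> (\<lambda>g. add_shift v (d \<circ> g)) ` stab lam v"
      by (rule image_eqI[OF _ stab_comp[OF g(1) h]]) (simp add: o_assoc)
  qed
  then have "l = twist (d \<circ> g) (\<lambda>f. ev v (div_diff lam w f))" unfolding l by (simp only: generator_eq[OF g(2)])
  then show "l \<in> {twist d (\<lambda>f. ev v (div_diff lam w f)) | d w. dominant d \<and> w \<in> stab lam v}" using g(2) w by blast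
next
  fix l assume "l \<in> {twist d (\<lambda>f. ev v (div_diff lam w f)) | d w. dominant d \<and> w \<in> stab lam v}"
  then obtain d w where dw: "l = twist d (\<lambda>f. ev v (div_diff lam w f))" "dominant d" "w \<in> stab lam v" by blast
  have "(\<lambda>g. add_shift v (d \<circ> g)) ` stab lam v \<in> stab_orbits lam v"
    unfolding stab_orbits_eq using dominant_shifts[OF dw(2)] by blast
  then show "l \<in> {on_set (RG lam) (ev v \<circ> div_diff lam w \<circ> orbit_shift lam v O') | O' w.
      O' \<in> stab_orbits lam v \<and> w \<in> stab lam v}"
    unfolding dw(1) generator_eq[OF dw(2), symmetric] using dw(3) by blast
qed

lemma word_perm_stab: "set as \<subseteq> blk_refl \<Longrightarrow> word_perm as \<in> stab lam v"
proof (induction as)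
  case Nil
  show ?case unfolding word_perm_simps(1) by (rule stab_id)
next
  case (Cons a as)
  then show ?case unfolding word_perm_simps(2) by (intro stab_comp blk_refl_stab) auto
qed

text \<open>Every functional given by a word is zero or belongs to a reduced word, and the reduced words in
  question represent exactly the elements of the stabilizer.\<close>

lemma carrier_M: "mcar (M_mod lam v) = M_car"
proof -
  interpret dual: module dual_scale by (rule dual_module)
  define B where "B = {twist d (\<lambda>f. ev v (div_diff lam w f)) | d w. dominant d \<and> w \<in> stab lam v}"
  have "dual.span B \<subseteq> M_car"
  proof (rule dual.span_minimal)
    show "B \<subseteq> M_car"
    proof
      fix l assume "l \<in> B"
      then obtain d w where dw: "l = twist d (\<lambda>f. ev v (div_diff lam w f))" "dominant d" "w \<in> stab lam v"
        unfolding B_def by blast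
      obtain as where as: "red_word lam as" "word_perm as = w" using red_word_ex[OF stab_G[OF dw(3)]] by blast
      then have "set as \<subseteq> blk_refl" using red_word_stab_blk_refl dw(3) by blast
      then show "l \<in> M_car"
        unfolding dw(1) as(2)[symmetric] div_diff_eq_dd[OF as(1)] by (intro M_car_twist_dominant dw(2) word_top)
    qed
    show "dual.subspace M_car"
      unfolding dual.subspace_def using M_car_0 M_car_add M_car_scale
      by (simp add: zero_fun_def plus_fun_def dual_scale_def)
  qed
  moreover have "M_car \<subseteq> dual.span B"
  proof
    have zero: "(\<lambda>f. 0) \<in> dual.span B" using dual.span_zero[of B] by (simp add: zero_fun_def)
    have add: "(\<lambda>f. l f + l' f) \<in> dual.span B" if "l \<in> dual.span B" "l' \<in> dual.span B" for l l'
      using dual.span_add[OF that] by (simp add: plus_fun_def)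
    have scale: "(\<lambda>f. c * l f) \<in> dual.span B" if "l \<in> dual.span B" for l c
      using dual.span_scale[OF that, of c] by (simp add: dual_scale_def)
    have twist: "twist d L \<in> dual.span B" if d: "dominant d" and L: "L \<in> local_fun maxlen" for d L
      using L
    proof induction
      case (local_fun_word as)
      show ?case
      proof (cases "red_word lam as")
        case True
        have "twist d (\<lambda>f. ev v (div_diff lam (word_perm as) f)) \<in> B"
          unfolding B_def using d word_perm_stab[OF local_fun_word(1)] by blast
        then show ?thesis unfolding div_diff_eq_dd[OF True] by (rule dual.span_base)
      next
        case False
        have "set as \<subseteq> simple_idx lam" using local_fun_word(1) blk_refl_simple by blast
        then have "twist d (\<lambda>f. ev v (dd as f)) = (\<lambda>f. 0)"
          using dd_nonreduced[OF _ False] by (simp add: twist_def on_set_def fun_eq_iff)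
        then show ?thesis using zero by simp
      qed
    next
      case local_fun_zero
      have "twist d (\<lambda>f. 0) = (\<lambda>f. 0)" by (simp add: twist_def on_set_def fun_eq_iff)
      then show ?case using zero by simp
    next
      case (local_fun_add L L')
      have "twist d (\<lambda>f. L f + L' f) = (\<lambda>f. twist d L f + twist d L' f)" by (simp add: twist_def on_set_def fun_eq_iff)
      then show ?case using add[OF local_fun_add.IH] by simp
    next
      case (local_fun_scale L c)
      have "twist d (\<lambda>f. c * L f) = (\<lambda>f. c * twist d L f)" by (simp add: twist_def on_set_def fun_eq_iff)
      then show ?case using scale[OF local_fun_scale.IH] by simp
    next
      case (local_fun_cong L L')
      then show ?case using twist_eqI[of L' L d] by simp
    qed
    fix l assume "l \<in> M_car"
    then obtain J L where l: "l = (\<lambda>f. \<Sum>d\<in>J. twist d (L d) f)" and J: "finite J"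
      and dL: "\<And>d. d \<in> J \<Longrightarrow> dominant d \<and> L d \<in> local_fun maxlen"
      unfolding M_car_def by blast
    have "(\<lambda>f. \<Sum>d\<in>J. twist d (L d) f) \<in> dual.span B"
      using J dL by (induction J rule: finite_induct) (simp_all add: zero add twist)
    then show "l \<in> dual.span B" unfolding l .
  qed
  ultimately show ?thesis
    unfolding M_mod_def generators_eq B_def[symmetric] by simp
qed

lemma M_mod_simps [simp]:
  "mzero (M_mod lam v) = (\<lambda>f. 0)" "madd (M_mod lam v) = (\<lambda>l l' f. l f + l' f)"
  "mscale (M_mod lam v) = dual_scale" "mact (M_mod lam v) = (\<lambda>l u. on_set (RG lam) (\<lambda>f. l (u f)))"
  by (simp_all add: M_mod_def RG_dual_def)

lemma right_module_M: "right_module lam (M_mod lam v)"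
proof -
  have comp: "on_set (RG lam) (\<lambda>f. x ((u \<circ> u') f)) = on_set (RG lam) (\<lambda>f. on_set (RG lam) (\<lambda>f. x (u f)) (u' f))"
    if "u' \<in> U lam" for x :: "mrat \<Rightarrow> complex" and u u'
    using U_RG[OF that] by (simp add: on_set_def fun_eq_iff)
  have add: "on_set (RG lam) (\<lambda>f. x (u f + u' f)) = (\<lambda>f. on_set (RG lam) (\<lambda>f. x (u f)) f + on_set (RG lam) (\<lambda>f. x (u' f)) f)"
    if "x \<in> M_car" "u \<in> U lam" "u' \<in> U lam" for x u u'
    using M_car_linear(1)[OF that(1)] U_RG[OF that(2)] U_RG[OF that(3)] by (simp add: on_set_def fun_eq_iff)
  have scale: "on_set (RG lam) (\<lambda>f. x (const c * u f)) = dual_scale c (on_set (RG lam) (\<lambda>f. x (u f)))"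
    if "x \<in> M_car" "u \<in> U lam" for x u c
    using M_car_linear(2)[OF that(1)] U_RG[OF that(2)] by (simp add: on_set_def dual_scale_def fun_eq_iff)
  have one: "on_set (RG lam) (\<lambda>f. x (on_set (Omega lam) id f)) = x" if "x \<in> M_car" for x
  proof
    fix f show "on_set (RG lam) (\<lambda>f. x (on_set (Omega lam) id f)) f = x f"
      using M_car_outside[OF that, of f] by (cases "f \<in> RG lam") (simp_all add: on_set_def R_subset_Omega RG_R)
  qed
  have neg: "\<exists>y\<in>M_car. (\<lambda>f. x f + y f) = (\<lambda>f. 0)" if "x \<in> M_car" for x
    by (rule bexI[OF _ M_car_scale[OF that, of "- 1"]]) simp
  have scaleMM: "dual_scale c x \<in> M_car" if "x \<in> M_car" for c x
    using M_car_scale[OF that, of c] by (simp add: dual_scale_def)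
  show ?thesis
    unfolding right_module_def carrier_M M_mod_simps
    apply (intro conjI allI ballI)
    subgoal by (rule M_car_0)
    subgoal by (rule M_car_add)
    subgoal by (simp add: add.assoc)
    subgoal by (simp add: add.commute)
    subgoal by simp
    subgoal by (rule neg)
    subgoal by (rule scaleMM)
    subgoal by (simp add: dual_scale_def distrib_left)
    subgoal by (simp add: dual_scale_def distrib_right)
    subgoal by (simp add: dual_scale_def mult.assoc)
    subgoal by (simp add: dual_scale_def)
    subgoal by (rule M_car_U)
    subgoal by (simp add: on_set_def fun_eq_iff)
    subgoal by (simp add: on_set_def dual_scale_def fun_eq_iff)
    subgoal by (rule add)
    subgoal by (rule scale)
    subgoal by (rule comp)
    subgoal by (rule one)
    done
qed

lemma submodule_stable: "submodule lam (M_mod lam v) S \<longleftrightarrow> stable S"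
  by (simp add: submodule_def stable_def carrier_M dual_scale_def)

lemma dominant_0: "dominant (\<lambda>a. 0)"
  by (simp add: dominant_def shifts_0)

definition ev0 :: "mrat \<Rightarrow> complex" where
  "ev0 = on_set (RG lam) (ev v)"

lemma ev0_M_car: "ev0 \<in> M_car"
proof -
  have "ev0 = twist (\<lambda>a. 0) (ev v)" by (simp add: ev0_def twist_def on_set_def fun_eq_iff shift_0)
  then show ?thesis using M_car_twist_dominant[OF dominant_0 ev_local_fun] by simp
qed

lemma ev0_nonzero: "ev0 \<noteq> (\<lambda>f. 0)"
proof
  assume "ev0 = (\<lambda>f. 0)"
  from fun_cong[OF this, of 1] show False by (simp add: ev0_def on_set_def)
qed

lemma M_simple: "simple_module lam (M_mod lam v)"
  unfolding simple_module_def carrier_M submodule_stable M_mod_simps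
  using right_module_M stable_simple ev0_M_car ev0_nonzero by blast

text \<open>The submodule generated by evaluation at \<open>v\<close> is not zero, so it is everything.\<close>

lemma carrier_N: "{on_set (RG lam) (\<lambda>f. ev0 (u f)) | u. u \<in> U lam} = M_car" (is "?N = _")
proof -
  have N: "on_set (RG lam) (\<lambda>f. ev0 (u f)) \<in> ?N" if "u \<in> U lam" for u using that by blast
  have one: "ev0 \<in> ?N"
  proof -
    have "on_set (RG lam) (\<lambda>f. ev0 (on_set (Omega lam) id f)) = ev0"
      using right_module_act_one[OF right_module_M, of ev0] ev0_M_car by (simp add: carrier_M)
    then show ?thesis using N[OF U_one] by simp
  qed
  have "stable ?N"
    unfolding stable_def
  proof (intro conjI ballI allI subsetI)
    fix l assume "l \<in> ?N"
    then show "l \<in> M_car" using M_car_U[OF _ ev0_M_car] by blast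
  next
    have "(\<lambda>f. 0) = on_set (RG lam) (\<lambda>f. ev0 (const 0 * on_set (Omega lam) id f))"
      by (simp add: on_set_def fun_eq_iff const_simps(4) ev0_def)
    then show "(\<lambda>f. 0) \<in> ?N" using N[OF U_scale[OF U_one], of 0] by simp
  next
    fix l l' assume "l \<in> ?N" "l' \<in> ?N"
    then obtain u u' where u: "u \<in> U lam" "l = on_set (RG lam) (\<lambda>f. ev0 (u f))"
      "u' \<in> U lam" "l' = on_set (RG lam) (\<lambda>f. ev0 (u' f))" by blast
    have "on_set (RG lam) (\<lambda>f. ev0 (u f + u' f)) = (\<lambda>f. l f + l' f)"
      using right_module_act_plus[OF right_module_M, of ev0 u u'] ev0_M_car u by (simp add: carrier_M)
    then show "(\<lambda>f. l f + l' f) \<in> ?N" using N[OF U_add[OF u(1,3)]] by simp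
  next
    fix c l assume "l \<in> ?N"
    then obtain u where u: "u \<in> U lam" "l = on_set (RG lam) (\<lambda>f. ev0 (u f))" by blast
    have "on_set (RG lam) (\<lambda>f. ev0 (const c * u f)) = dual_scale c l"
      using right_module_act_scale[OF right_module_M, of ev0 u c] ev0_M_car u by (simp add: carrier_M)
    then show "(\<lambda>f. c * l f) \<in> ?N" using N[OF U_scale[OF u(1), of c]] by (simp add: dual_scale_def)
  next
    fix l u' assume "l \<in> ?N" and u': "u' \<in> U lam"
    then obtain u where u: "u \<in> U lam" "l = on_set (RG lam) (\<lambda>f. ev0 (u f))" by blast
    have "on_set (RG lam) (\<lambda>f. ev0 ((u \<circ> u') f)) = on_set (RG lam) (\<lambda>f. l (u' f))"
      using right_module_act_comp[OF right_module_M, of ev0 u u'] ev0_M_car u u' by (simp only: carrier_M M_mod_simps)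
    then show "on_set (RG lam) (\<lambda>f. l (u' f)) \<in> ?N" using N[OF U_mult[OF u(1) u']] by simp
  qed
  then show ?thesis using stable_simple[of ?N] one ev0_nonzero by blast
qed

lemma N_mod_eq: "N_mod lam v = M_mod lam v"
proof -
  have act: "mact (RG_dual lam) (on_set (RG lam) (ev v)) u = on_set (RG lam) (\<lambda>f. ev0 (u f))" for u
    by (simp add: RG_dual_def ev0_def)
  have "mcar (M_mod lam v) = {mact (RG_dual lam) (on_set (RG lam) (ev v)) u | u. u \<in> U lam}"
    unfolding act carrier_N carrier_M ..
  then show ?thesis unfolding N_mod_def M_mod_def by simp
qed

lemma M_iso_L: "module_iso lam (M_mod lam v) (L_mod lam v)"
  unfolding L_mod_def N_mod_eq by (rule simple_module_quotient_iso[OF M_simple])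

end

theorem theorem11:
  fixes lam :: "nat list" and v :: "idx \<Rightarrow> complex"
  assumes k_pos: "length lam \<ge> 1"
    and lam_pos: "\<And>i. 1 \<le> i \<Longrightarrow> i \<le> length lam \<Longrightarrow> lam ! (i - 1) > 0"
    and v: "v \<in> V_dual lam"
    and stab_max: "\<And>w. w \<in> gimel_orbit lam v \<Longrightarrow> stab lam w \<subseteq> stab lam v"
    and stab_intervals: "\<And>i a. 1 \<le> i \<Longrightarrow> i \<le> length lam \<Longrightarrow> a \<in> row lam i \<Longrightarrow>
           \<exists>p q. idx_orbit (stab lam v) a = {(i, r) | r. p \<le> r \<and> r \<le> p + q}"
    and generic: "\<And>i a b. 1 \<le> i \<Longrightarrow> i < length lam \<Longrightarrow> a \<in> row lam i \<Longrightarrow> b \<in> row lam (i + 1) \<Longrightarrow>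
           v a - v b \<notin> \<int>"
  shows "simple_module lam (M_mod lam v) \<and> module_iso lam (M_mod lam v) (L_mod lam v)"
proof -
  interpret gz_point lam v
    by (rule gz_point.intro[OF v stab_max stab_intervals generic])
  show ?thesis using M_simple M_iso_L by blast
qed

end
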